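(* Let $(R,\mathfrak{m},\mathbb{K})$ be an $F$-finite regular ring of prime characteristic $p>0$ which is either local with maximal ideal $\mathfrak{m}$ or a positively graded polynomial ring over the field $\mathbb{K}$ with homogeneous maximal ideal $\mathfrak{m}$ (in the graded case all elements and ideals considered are homogeneous). Let $\mathfrak{a}$ be an $F$-König ideal in $R$. Then $$\mathcal{C}^{\mathfrak{m}}(\mathfrak{a}^{\bullet})=\mathcal{C}^{\mathfrak{m}}(\mathfrak{a}^{(\bullet)})=\operatorname{ht}(\mathfrak{a}).$$
   Context: A non-zero proper ideal $\mathfrak{a}$ of $R$ with $\operatorname{ht}(\mathfrak{a})=h$ is $F$-König if there is a regular sequence $f_1,\ldots,f_h$ in $\mathfrak{a}$ such that $R/(f_1,\ldots,f_h)$ is $F$-split. A ring $S$ of characteristic $p$ is $F$-finite if it is a finite module over itself via Frobenius; a reduced ring $S$ is $F$-split if the inclusion $S\to S^{1/p}$ splits as a map of $S$-modules. $\mathfrak{a}^\bullet=\{\mathfrak{a}^i\}_{i\ge 0}$, and $\mathfrak{a}^{(\bullet)}=\{\mathfrak{a}^{(i)}\}_{i\ge 0}$ with $\mathfrak{a}^{(i)}=\bigcap_{\mathfrak{q}\in\operatorname{Ass}(\mathfrak{a})}(\mathfrak{a}^iR_{\mathfrak{q}}\cap R)$, where $\operatorname{Ass}(\mathfrak{a})$ is the set of associated primes of $\mathfrak{a}$. $\mathfrak{m}^{[p^e]}$ is the ideal generated by all $f^{p^e}$, $f\in\mathfrak{m}$. For a filtration of ideals $\mathfrak{a}_\bullet$,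 $\nu_{\mathfrak{a}_\bullet}^{\mathfrak{m}}(p^e)=\sup\{r\in\mathbb{Z}_{\ge 0}:\mathfrak{a}_r\not\subseteq\mathfrak{m}^{[p^e]}\}$ and $\mathcal{C}^{\mathfrak{m}}(\mathfrak{a}_\bullet)=\lim_{e\to\infty}\nu_{\mathfrak{a}_\bullet}^{\mathfrak{m}}(p^e)/p^e$ (which exists as a finite real number for these filtrations). *)

theory Defs
  imports "HOL-Algebra.Algebra" "HOL-Library.Extended_Real"
begin

(* these shadow fields of the ring record *)
hide_const (open) Multiset.mult Wellorder_Constructions.zero

section \<open>Height, dimension, associated primes\<close>

text \<open>\<open>prime_chain R n q\<close>: a strict chain \<open>q 0 \<subset> \<dots> \<subset> q n\<close> of prime ideals, of length \<open>n\<close>.\<close>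

definition prime_chain :: "('a, 'b) ring_scheme \<Rightarrow> nat \<Rightarrow> (nat \<Rightarrow> 'a set) \<Rightarrow> bool" where
  "prime_chain R n q \<longleftrightarrow> (\<forall>i\<le>n. primeideal (q i) R) \<and> (\<forall>i<n. q i \<subset> q (Suc i))"

definition krull_dim :: "('a, 'b) ring_scheme \<Rightarrow> enat" where
  "krull_dim R = Sup {enat n | n. \<exists>q. prime_chain R n q}"

definition prime_height :: "('a, 'b) ring_scheme \<Rightarrow> 'a set \<Rightarrow> enat" where
  "prime_height R P = Sup {enat n | n. \<exists>q. prime_chain R n q \<and> q n = P}"

definition ideal_height :: "('a, 'b) ring_scheme \<Rightarrow> 'a set \<Rightarrow> enat" where
  "ideal_height R I = Inf {prime_height R P | P. primeideal P R \<and> I \<subseteq> P}"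

text \<open>\<open>Ass(I)\<close> is the set of associated primes of the module \<open>R/I\<close>: the prime ideals that are
  annihilators \<open>(I : x)\<close> of the class of some \<open>x\<close>.\<close>

definition ass_primes :: "('a, 'b) ring_scheme \<Rightarrow> 'a set \<Rightarrow> 'a set set" where
  "ass_primes R I =
     {Q. primeideal Q R \<and> (\<exists>x\<in>carrier R. Q = {r \<in> carrier R. r \<otimes>\<^bsub>R\<^esub> x \<in> I})}"


section \<open>Localization at a prime ideal\<close>

text \<open>\<open>loc_frac R Q r s\<close> is the fraction \<open>r/s\<close> in \<open>R\<^sub>Q\<close>, as an equivalence class of pairs.\<close>

definition loc_frac :: "('a, 'b) ring_scheme \<Rightarrow> 'a set \<Rightarrow> 'a \<Rightarrow> 'a \<Rightarrow> ('a \<times> 'a) set" where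
  "loc_frac R Q r s =
     {(r', s'). r' \<in> carrier R \<and> s' \<in> carrier R - Q \<and>
        (\<exists>u\<in>carrier R - Q. u \<otimes>\<^bsub>R\<^esub> (s' \<otimes>\<^bsub>R\<^esub> r) = u \<otimes>\<^bsub>R\<^esub> (s \<otimes>\<^bsub>R\<^esub> r'))}"

text \<open>Sums and products are unions over all representatives; by the lemmas
  \<open>localization_mult\<close> and \<open>localization_add\<close> below, any representatives give the same class.\<close>

definition localization :: "('a, 'b) ring_scheme \<Rightarrow> 'a set \<Rightarrow> ('a \<times> 'a) set ring" where
  "localization R Q =
     \<lparr> carrier = {loc_frac R Q r s | r s. r \<in> carrier R \<and> s \<in> carrier R - Q},
       mult = (\<lambda>A B. \<Union>{loc_frac R Q (r \<otimes>\<^bsub>R\<^esub> r') (s \<otimes>\<^bsub>R\<^esub> s') | r s r' s'.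
                           (r, s) \<in> A \<and> (r', s') \<in> B}),
       one = loc_frac R Q \<one>\<^bsub>R\<^esub> \<one>\<^bsub>R\<^esub>,
       zero = loc_frac R Q \<zero>\<^bsub>R\<^esub> \<one>\<^bsub>R\<^esub>,
       add = (\<lambda>A B. \<Union>{loc_frac R Q ((s' \<otimes>\<^bsub>R\<^esub> r) \<oplus>\<^bsub>R\<^esub> (s \<otimes>\<^bsub>R\<^esub> r')) (s \<otimes>\<^bsub>R\<^esub> s') | r s r' s'.
                          (r, s) \<in> A \<and> (r', s') \<in> B}) \<rparr>"

definition loc_map :: "('a, 'b) ring_scheme \<Rightarrow> 'a set \<Rightarrow> 'a \<Rightarrow> ('a \<times> 'a) set" where
  "loc_map R Q r = loc_frac R Q r \<one>\<^bsub>R\<^esub>"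

context primeideal
begin

lemma compl_one: "\<one> \<in> carrier R - I"
  using I_notcarr one_imp_carrier by auto

lemma compl_mult: "s \<in> carrier R - I \<Longrightarrow> t \<in> carrier R - I \<Longrightarrow> s \<otimes> t \<in> carrier R - I"
  using I_prime by auto

lemma loc_frac_self:
  assumes "r \<in> carrier R" "s \<in> carrier R - I"
  shows "(r, s) \<in> loc_frac R I r s"
  using assms compl_one unfolding loc_frac_def by blast

lemma loc_frac_trans:
  assumes c: "r \<in> carrier R" "r' \<in> carrier R" "s \<in> carrier R - I" "s' \<in> carrier R - I"
    and e: "(r', s') \<in> loc_frac R I r s" and e': "(r'', s'') \<in> loc_frac R I r' s'"
  shows "(r'', s'') \<in> loc_frac R I r s"
proof -
  obtain u where u: "u \<in> carrier R - I" "u \<otimes> (s' \<otimes> r) = u \<otimes> (s \<otimes> r')"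
    using e unfolding loc_frac_def by blast
  obtain v where v: "v \<in> carrier R - I" "v \<otimes> (s'' \<otimes> r') = v \<otimes> (s' \<otimes> r'')"
    and c': "r'' \<in> carrier R" "s'' \<in> carrier R - I"
    using e' unfolding loc_frac_def by blast
  let ?w = "u \<otimes> (v \<otimes> s')"
  have cc: "u \<in> carrier R" "v \<in> carrier R" "s \<in> carrier R" "s' \<in> carrier R" "s'' \<in> carrier R"
    using u v c c' by auto
  have "?w \<otimes> (s'' \<otimes> r) = (v \<otimes> s'') \<otimes> (u \<otimes> (s' \<otimes> r))"
    using cc c c' by algebra
  also have "\<dots> = (u \<otimes> s) \<otimes> (v \<otimes> (s'' \<otimes> r'))"
    unfolding u(2) using cc c c' by algebra
  also have "\<dots> = ?w \<otimes> (s \<otimes> r'')"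
    unfolding v(2) using cc c c' by algebra
  finally have "?w \<otimes> (s'' \<otimes> r) = ?w \<otimes> (s \<otimes> r'')" .
  moreover have "?w \<in> carrier R - I"
    using u(1) v(1) c(4) compl_mult by blast
  ultimately show ?thesis
    using c' unfolding loc_frac_def by blast
qed

lemma loc_frac_eq_iff:
  assumes c: "r \<in> carrier R" "r' \<in> carrier R" "s \<in> carrier R - I" "s' \<in> carrier R - I"
  shows "loc_frac R I r s = loc_frac R I r' s' \<longleftrightarrow>
           (\<exists>u\<in>carrier R - I. u \<otimes> (s' \<otimes> r) = u \<otimes> (s \<otimes> r'))"
proof
  assume "loc_frac R I r s = loc_frac R I r' s'"
  then have "(r', s') \<in> loc_frac R I r s"
    using loc_frac_self[OF c(2,4)] by simp
  then show "\<exists>u\<in>carrier R - I. u \<otimes> (s' \<otimes> r) = u \<otimes> (s \<otimes> r')"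
    unfolding loc_frac_def by blast
next
  assume ex: "\<exists>u\<in>carrier R - I. u \<otimes> (s' \<otimes> r) = u \<otimes> (s \<otimes> r')"
  then have 1: "(r', s') \<in> loc_frac R I r s"
    using c unfolding loc_frac_def by blast
  obtain u where "u \<in> carrier R - I" "u \<otimes> (s' \<otimes> r) = u \<otimes> (s \<otimes> r')"
    using ex by blast
  then have 2: "(r, s) \<in> loc_frac R I r' s'"
    using c unfolding loc_frac_def by (auto intro!: bexI[of _ u])
  show "loc_frac R I r s = loc_frac R I r' s'"
    using loc_frac_trans[OF c(1,2,3,4) 1] loc_frac_trans[OF c(2,1,4,3) 2] by auto
qed

lemma localization_mult:
  assumes c: "r \<in> carrier R" "r' \<in> carrier R" "s \<in> carrier R - I" "s' \<in> carrier R - I"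
  shows "loc_frac R I r s \<otimes>\<^bsub>localization R I\<^esub> loc_frac R I r' s' =
           loc_frac R I (r \<otimes> r') (s \<otimes> s')"
proof -
  have "loc_frac R I (x \<otimes> x') (t \<otimes> t') = loc_frac R I (r \<otimes> r') (s \<otimes> s')"
    if x: "(x, t) \<in> loc_frac R I r s" and x': "(x', t') \<in> loc_frac R I r' s'" for x t x' t'
  proof -
    obtain u where u: "u \<in> carrier R - I" "u \<otimes> (t \<otimes> r) = u \<otimes> (s \<otimes> x)"
      and d: "x \<in> carrier R" "t \<in> carrier R - I"
      using x unfolding loc_frac_def by blast
    obtain v where v: "v \<in> carrier R - I" "v \<otimes> (t' \<otimes> r') = v \<otimes> (s' \<otimes> x')"
      and d': "x' \<in> carrier R" "t' \<in> carrier R - I"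
      using x' unfolding loc_frac_def by blast
    have cc: "u \<in> carrier R" "v \<in> carrier R" "s \<in> carrier R" "s' \<in> carrier R"
      "t \<in> carrier R" "t' \<in> carrier R"
      using u v c d d' by auto
    have "(u \<otimes> v) \<otimes> ((s \<otimes> s') \<otimes> (x \<otimes> x')) = (u \<otimes> (s \<otimes> x)) \<otimes> (v \<otimes> (s' \<otimes> x'))"
      using cc c d d' by algebra
    also have "\<dots> = (u \<otimes> v) \<otimes> ((t \<otimes> t') \<otimes> (r \<otimes> r'))"
      unfolding u(2)[symmetric] v(2)[symmetric] using cc c d d' by algebra
    finally show ?thesis
      using c d d' u(1) v(1) compl_mult by (subst loc_frac_eq_iff) (auto intro!: bexI[of _ "u \<otimes> v"])
  qed
  then have "{loc_frac R I (x \<otimes> x') (t \<otimes> t') | x t x' t'.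
          (x, t) \<in> loc_frac R I r s \<and> (x', t') \<in> loc_frac R I r' s'} = {loc_frac R I (r \<otimes> r') (s \<otimes> s')}"
    using loc_frac_self[OF c(1,3)] loc_frac_self[OF c(2,4)] by blast
  then show ?thesis
    unfolding localization_def by simp
qed

lemma localization_add:
  assumes c: "r \<in> carrier R" "r' \<in> carrier R" "s \<in> carrier R - I" "s' \<in> carrier R - I"
  shows "loc_frac R I r s \<oplus>\<^bsub>localization R I\<^esub> loc_frac R I r' s' =
           loc_frac R I ((s' \<otimes> r) \<oplus> (s \<otimes> r')) (s \<otimes> s')"
proof -
  have "loc_frac R I ((t' \<otimes> x) \<oplus> (t \<otimes> x')) (t \<otimes> t') =
          loc_frac R I ((s' \<otimes> r) \<oplus> (s \<otimes> r')) (s \<otimes> s')"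
    if x: "(x, t) \<in> loc_frac R I r s" and x': "(x', t') \<in> loc_frac R I r' s'" for x t x' t'
  proof -
    obtain u where u: "u \<in> carrier R - I" "u \<otimes> (t \<otimes> r) = u \<otimes> (s \<otimes> x)"
      and d: "x \<in> carrier R" "t \<in> carrier R - I"
      using x unfolding loc_frac_def by blast
    obtain v where v: "v \<in> carrier R - I" "v \<otimes> (t' \<otimes> r') = v \<otimes> (s' \<otimes> x')"
      and d': "x' \<in> carrier R" "t' \<in> carrier R - I"
      using x' unfolding loc_frac_def by blast
    have cc: "u \<in> carrier R" "v \<in> carrier R" "s \<in> carrier R" "s' \<in> carrier R"
      "t \<in> carrier R" "t' \<in> carrier R"
      using u v c d d' by auto
    have "(u \<otimes> v) \<otimes> ((s \<otimes> s') \<otimes> ((t' \<otimes> x) \<oplus> (t \<otimes> x'))) =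
            (v \<otimes> s' \<otimes> t') \<otimes> (u \<otimes> (s \<otimes> x)) \<oplus> (u \<otimes> s \<otimes> t) \<otimes> (v \<otimes> (s' \<otimes> x'))"
      using cc c d d' by algebra
    also have "\<dots> = (u \<otimes> v) \<otimes> ((t \<otimes> t') \<otimes> ((s' \<otimes> r) \<oplus> (s \<otimes> r')))"
      unfolding u(2)[symmetric] v(2)[symmetric] using cc c d d' by algebra
    finally show ?thesis
      using c d d' u(1) v(1) compl_mult by (subst loc_frac_eq_iff) (auto intro!: bexI[of _ "u \<otimes> v"])
  qed
  then have "{loc_frac R I ((t' \<otimes> x) \<oplus> (t \<otimes> x')) (t \<otimes> t') | x t x' t'.
          (x, t) \<in> loc_frac R I r s \<and> (x', t') \<in> loc_frac R I r' s'} = {loc_frac R I ((s' \<otimes> r) \<oplus> (s \<otimes> r')) (s \<otimes> s')}"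
    using loc_frac_self[OF c(1,3)] loc_frac_self[OF c(2,4)] by blast
  then show ?thesis
    unfolding localization_def by simp
qed

end


section \<open>Local and regular rings\<close>

definition local_ring :: "('a, 'b) ring_scheme \<Rightarrow> 'a set \<Rightarrow> bool" where
  "local_ring R M \<longleftrightarrow> cring R \<and> maximalideal M R \<and> (\<forall>N. maximalideal N R \<longrightarrow> N = M)"

text \<open>A Noetherian local ring is regular if its maximal ideal is generated by
  \<open>dim R\<close> many elements.\<close>

definition regular_local_ring :: "('a, 'b) ring_scheme \<Rightarrow> bool" where
  "regular_local_ring R \<longleftrightarrow> noetherian_ring R \<and>
     (\<exists>M. local_ring R M \<and>
        (\<exists>S\<subseteq>carrier R. finite S \<and> M = Idl\<^bsub>R\<^esub> S \<and> enat (card S) = krull_dim R))"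

definition regular_ring :: "('a, 'b) ring_scheme \<Rightarrow> bool" where
  "regular_ring R \<longleftrightarrow> cring R \<and> noetherian_ring R \<and>
     (\<forall>Q. primeideal Q R \<longrightarrow> regular_local_ring (localization R Q))"


section \<open>Positive characteristic\<close>

definition has_char :: "('a, 'b) ring_scheme \<Rightarrow> nat \<Rightarrow> bool" where
  "has_char R p \<longleftrightarrow> (\<forall>n::nat. [n] \<cdot>\<^bsub>R\<^esub> \<one>\<^bsub>R\<^esub> = \<zero>\<^bsub>R\<^esub> \<longleftrightarrow> p dvd n)"

definition reduced_ring :: "('a, 'b) ring_scheme \<Rightarrow> bool" where
  "reduced_ring S \<longleftrightarrow> cring S \<and>
     (\<forall>x\<in>carrier S. \<forall>n::nat. x [^]\<^bsub>S\<^esub> n = \<zero>\<^bsub>S\<^esub> \<longrightarrow> x = \<zero>\<^bsub>S\<^esub>)"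

text \<open>\<open>S\<close> as a module over itself via Frobenius. If \<open>S\<close> is reduced, this is \<open>S\<^sup>1\<^sup>/\<^sup>p\<close>, with the
  element \<open>x\<^sup>1\<^sup>/\<^sup>p\<close> represented by \<open>x\<close>: scalar multiplication reads
  \<open>s \<cdot> x\<^sup>1\<^sup>/\<^sup>p = (s\<^sup>p x)\<^sup>1\<^sup>/\<^sup>p\<close>, and the inclusion of \<open>S\<close> in \<open>S\<^sup>1\<^sup>/\<^sup>p\<close> sends \<open>s = (s\<^sup>p)\<^sup>1\<^sup>/\<^sup>p\<close> to
  the representative \<open>s\<^sup>p\<close>.\<close>

definition frob_module :: "('a, 'b) ring_scheme \<Rightarrow> nat \<Rightarrow> ('a, 'a) module" where
  "frob_module S p =
     \<lparr> carrier = carrier S, mult = monoid.mult S, one = one S, zero = zero S, add = add S,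
       smult = (\<lambda>s x. (s [^]\<^bsub>S\<^esub> p) \<otimes>\<^bsub>S\<^esub> x) \<rparr>"

definition self_module :: "('a, 'b) ring_scheme \<Rightarrow> ('a, 'a) module" where
  "self_module S =
     \<lparr> carrier = carrier S, mult = monoid.mult S, one = one S, zero = zero S, add = add S,
       smult = monoid.mult S \<rparr>"

definition module_homs ::
    "('a, 'b) ring_scheme \<Rightarrow> ('a, 'c, 'd) module_scheme \<Rightarrow> ('a, 'e, 'f) module_scheme \<Rightarrow> ('c \<Rightarrow> 'e) set"
  where "module_homs S M N =
     {\<phi>. \<phi> \<in> carrier M \<rightarrow> carrier N \<and>
       (\<forall>x\<in>carrier M. \<forall>y\<in>carrier M. \<phi> (x \<oplus>\<^bsub>M\<^esub> y) = \<phi> x \<oplus>\<^bsub>N\<^esub> \<phi> y) \<and>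
       (\<forall>s\<in>carrier S. \<forall>x\<in>carrier M. \<phi> (s \<odot>\<^bsub>M\<^esub> x) = s \<odot>\<^bsub>N\<^esub> \<phi> x)}"

definition finite_module :: "('a, 'b) ring_scheme \<Rightarrow> ('a, 'c, 'd) module_scheme \<Rightarrow> bool" where
  "finite_module S M \<longleftrightarrow>
     (\<exists>B. finite B \<and> B \<subseteq> carrier M \<and>
       (\<forall>x\<in>carrier M. \<exists>c\<in>B \<rightarrow> carrier S. x = (\<Oplus>\<^bsub>M\<^esub>b\<in>B. c b \<odot>\<^bsub>M\<^esub> b)))"

definition F_finite :: "('a, 'b) ring_scheme \<Rightarrow> nat \<Rightarrow> bool" where
  "F_finite S p \<longleftrightarrow> finite_module S (frob_module S p)"

definition F_split :: "('a, 'b) ring_scheme \<Rightarrow> nat \<Rightarrow> bool" where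
  "F_split S p \<longleftrightarrow> reduced_ring S \<and>
     (\<exists>\<phi>\<in>module_homs S (frob_module S p) (self_module S). \<forall>s\<in>carrier S. \<phi> (s [^]\<^bsub>S\<^esub> p) = s)"


section \<open>Regular sequences and \<open>F\<close>-Koenig ideals\<close>

definition regular_sequence :: "('a, 'b) ring_scheme \<Rightarrow> 'a list \<Rightarrow> bool" where
  "regular_sequence R fs \<longleftrightarrow> set fs \<subseteq> carrier R \<and> Idl\<^bsub>R\<^esub> (set fs) \<noteq> carrier R \<and>
     (\<forall>i<length fs. \<forall>r\<in>carrier R.
        fs ! i \<otimes>\<^bsub>R\<^esub> r \<in> Idl\<^bsub>R\<^esub> (set (take i fs)) \<longrightarrow> r \<in> Idl\<^bsub>R\<^esub> (set (take i fs)))"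

text \<open>\<open>H\<close> is the set of elements from which the regular sequence may be taken: all of
  \<open>carrier R\<close> in the local case, the homogeneous elements in the graded case.\<close>

definition F_Koenig :: "('a, 'b) ring_scheme \<Rightarrow> nat \<Rightarrow> 'a set \<Rightarrow> 'a set \<Rightarrow> bool" where
  "F_Koenig R p H I \<longleftrightarrow> ideal I R \<and> I \<noteq> {\<zero>\<^bsub>R\<^esub>} \<and> I \<noteq> carrier R \<and>
     (\<exists>fs. set fs \<subseteq> I \<inter> H \<and> enat (length fs) = ideal_height R I \<and> regular_sequence R fs \<and>
           F_split (R Quot (Idl\<^bsub>R\<^esub> (set fs))) p)"


section \<open>Positively graded polynomial rings\<close>

text \<open>\<open>(K[\<X>\<^bsub>I\<^esub>])\<close> (\<^const>\<open>ring.indexed_pset\<close>) is the library's set of formal polynomials over \<open>K\<close>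
  in variables indexed by \<open>I\<close>: coefficient functions on monomials, a monomial being a
  multiset of indices. The variables of \<open>R\<close> are the entries of a list \<open>xs\<close>.\<close>

definition formal_polys :: "('a, 'b) ring_scheme \<Rightarrow> 'a set \<Rightarrow> nat \<Rightarrow> (nat multiset \<Rightarrow> 'a) set" where
  "formal_polys R K n = ring.indexed_pset R {..<n} K"

definition eval_poly :: "('a, 'b) ring_scheme \<Rightarrow> 'a list \<Rightarrow> (nat multiset \<Rightarrow> 'a) \<Rightarrow> 'a" where
  "eval_poly R xs c =
     (\<Oplus>\<^bsub>R\<^esub>\<mu>\<in>{\<mu>. c \<mu> \<noteq> \<zero>\<^bsub>R\<^esub>}. c \<mu> \<otimes>\<^bsub>R\<^esub> (\<Otimes>\<^bsub>R\<^esub>i\<in>{..<length xs}. (xs ! i) [^]\<^bsub>R\<^esub> count \<mu> i))"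

text \<open>\<open>R = K[x\<^sub>1, \<dots>, x\<^sub>n]\<close>, graded by \<open>deg x\<^sub>i = w\<^sub>i > 0\<close> and \<open>deg c = 0\<close> for \<open>c \<in> K\<close>.\<close>

definition graded_poly_ring :: "('a, 'b) ring_scheme \<Rightarrow> 'a set \<Rightarrow> 'a list \<Rightarrow> nat list \<Rightarrow> bool" where
  "graded_poly_ring R K xs w \<longleftrightarrow> cring R \<and> subfield K R \<and> set xs \<subseteq> carrier R \<and>
     bij_betw (eval_poly R xs) (formal_polys R K (length xs)) (carrier R) \<and>
     length w = length xs \<and> (\<forall>d\<in>set w. d > 0)"

definition homogeneous_elements ::
    "('a, 'b) ring_scheme \<Rightarrow> 'a set \<Rightarrow> 'a list \<Rightarrow> nat list \<Rightarrow> 'a set" where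
  "homogeneous_elements R K xs w =
     {eval_poly R xs c | c. c \<in> formal_polys R K (length xs) \<and>
        (\<exists>d. \<forall>\<mu>. c \<mu> \<noteq> \<zero>\<^bsub>R\<^esub> \<longrightarrow> (\<Sum>i\<in>#\<mu>. w ! i) = d)}"

definition homogeneous_ideal ::
    "('a, 'b) ring_scheme \<Rightarrow> 'a set \<Rightarrow> 'a list \<Rightarrow> nat list \<Rightarrow> 'a set \<Rightarrow> bool" where
  "homogeneous_ideal R K xs w I \<longleftrightarrow> (\<exists>S\<subseteq>homogeneous_elements R K xs w. I = Idl\<^bsub>R\<^esub> S)"


section \<open>Filtrations and their \<open>F\<close>-thresholds\<close>

text \<open>\<^const>\<open>ideals_set\<close> is the semiring of ideals, so its powers are powers of ideals
  (with zeroth power the unit ideal).\<close>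

definition ordinary_powers :: "('a, 'b) ring_scheme \<Rightarrow> 'a set \<Rightarrow> nat \<Rightarrow> 'a set" where
  "ordinary_powers R I i = I [^]\<^bsub>ideals_set R\<^esub> i"

definition symbolic_powers :: "('a, 'b) ring_scheme \<Rightarrow> 'a set \<Rightarrow> nat \<Rightarrow> 'a set" where
  "symbolic_powers R I i =
     {x \<in> carrier R. \<forall>Q\<in>ass_primes R I.
        loc_map R Q x \<in> Idl\<^bsub>localization R Q\<^esub> (loc_map R Q ` ordinary_powers R I i)}"

definition frob_power :: "('a, 'b) ring_scheme \<Rightarrow> 'a set \<Rightarrow> nat \<Rightarrow> 'a set" where
  "frob_power R I q = Idl\<^bsub>R\<^esub> ((\<lambda>f. f [^]\<^bsub>R\<^esub> q) ` I)"

definition nu :: "('a, 'b) ring_scheme \<Rightarrow> 'a set \<Rightarrow> (nat \<Rightarrow> 'a set) \<Rightarrow> nat \<Rightarrow> enat" where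
  "nu R M A q = Sup {enat r | r. \<not> A r \<subseteq> frob_power R M q}"

definition threshold_seq ::
    "('a, 'b) ring_scheme \<Rightarrow> nat \<Rightarrow> 'a set \<Rightarrow> (nat \<Rightarrow> 'a set) \<Rightarrow> nat \<Rightarrow> ereal" where
  "threshold_seq R p M A e = ereal_of_enat (nu R M A (p ^ e)) / ereal (real (p ^ e))"

text \<open>Meaningful only if the sequence converges.\<close>

definition F_threshold :: "('a, 'b) ring_scheme \<Rightarrow> nat \<Rightarrow> 'a set \<Rightarrow> (nat \<Rightarrow> 'a set) \<Rightarrow> ereal" where
  "F_threshold R p M A = lim (threshold_seq R p M A)"

end

theory Submission
  imports Defs
begin

text \<open>Let \<open>h\<close> be the height of \<open>\<aa>\<close>, \<open>f\<^sub>1, \<dots>, f\<^sub>h\<close> the given regular sequence, \<open>g\<close> its product and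
  \<open>q = p\<^sup>e\<close>. Both invariants \<open>\<nu>(q)\<close> lie between \<open>h (q - 1)\<close> and \<open>h q\<close>.

  Upper bound: a prime \<open>Q\<close> of height \<open>h\<close> over \<open>\<aa>\<close> is associated to \<open>\<aa>\<close>, and \<open>Q R\<^sub>Q\<close> has \<open>h\<close> generators, so
  for \<open>n > h q\<close> every element of \<open>\<aa>\<^sup>(\<^sup>n\<^sup>)\<close> is multiplied into the Frobenius power \<open>Q\<^sup>[\<^sup>q\<^sup>]\<close> by some element
  outside \<open>Q\<close>. Flatness of Frobenius on \<open>R\<^sub>\<mm>\<close> makes that element a nonzerodivisor modulo \<open>Q\<^sup>[\<^sup>q\<^sup>]\<close>.

  Lower bound: \<open>g\<^sup>q\<^sup>-\<^sup>1 \<in> \<aa>\<^sup>h\<^sup>(\<^sup>q\<^sup>-\<^sup>1\<^sup>)\<close> is not in \<open>\<mm>\<^sup>[\<^sup>q\<^sup>]\<close>, because (Fedder) a splitting of Frobenius on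
  \<open>R/(f)\<close> lifts to a map \<open>\<psi>(g\<^sup>p\<^sup>-\<^sup>1 \<cdot> _)\<close> over \<open>R\<^sub>\<mm>\<close> up to maps with values in \<open>(f)\<close>, so \<open>\<psi>(g\<^sup>p\<^sup>-\<^sup>1)\<close> is a unit.

  Both bounds need the Frobenius module of the regular local ring \<open>R\<^sub>\<mm>\<close> to be free. This follows because
  parameters generate prime ideals in any order, which rests on Krull's principal ideal theorem.\<close>

section \<open>Ideals, saturation and minimal primes\<close>

text \<open>The local and the graded case meet in one property: the ideal is contracted from its
  localization at m (\<open>saturation\<close>). For homogeneous ideals this holds because elements
  outside m have a nonzero constant term. Both bounds can then be argued at R_m and brought back to
  R.

  Freeness is the obstacle. Relations among minimal generators of the Frobenius module have
  coefficients in m; these are pushed into ideals generated by fewer and fewer parameters until only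
  the zero ideal is left. Each step divides by a parameter, a nonzerodivisor modulo the p-th powers
  of the remaining ones. Later only the coordinate functions are used.

  The bound h q comes from counting: a monomial of degree above h (q - 1) in h generators contains
  some q-th power. The upper bound is shown for the larger symbolic powers and the lower one for the
  ordinary powers, so each serves both filtrations; division by q closes the gap.

  The given splitting lives on a quotient of R, not of R_m. It is transported by choosing the
  Frobenius basis of R_m among images of elements of R.\<close>

context ring
begin

lemma ideal_carr: "ideal I R \<Longrightarrow> a \<in> I \<Longrightarrow> a \<in> carrier R"
  by (rule ideal.Icarr)

lemma ideal_sub: "ideal I R \<Longrightarrow> I \<subseteq> carrier R"
  by (auto intro: ideal.Icarr)

lemma ideal_0: "ideal I R \<Longrightarrow> \<zero> \<in> I"
  by (simp add: additive_subgroup.zero_closed ideal.axioms(1))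

lemma ideal_add: "ideal I R \<Longrightarrow> a \<in> I \<Longrightarrow> b \<in> I \<Longrightarrow> a \<oplus> b \<in> I"
  by (simp add: additive_subgroup.a_closed ideal.axioms(1))

lemma ideal_lmult: "ideal I R \<Longrightarrow> a \<in> I \<Longrightarrow> x \<in> carrier R \<Longrightarrow> x \<otimes> a \<in> I"
  by (rule ideal.I_l_closed)

lemma ideal_rmult: "ideal I R \<Longrightarrow> a \<in> I \<Longrightarrow> x \<in> carrier R \<Longrightarrow> a \<otimes> x \<in> I"
  by (rule ideal.I_r_closed)

lemma ideal_neg: "ideal I R \<Longrightarrow> a \<in> I \<Longrightarrow> \<ominus> a \<in> I"
  by (simp add: additive_subgroup.a_inv_closed ideal.axioms(1))

lemma ideal_diff: "ideal I R \<Longrightarrow> a \<in> I \<Longrightarrow> b \<in> I \<Longrightarrow> a \<ominus> b \<in> I"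
  unfolding a_minus_def by (simp add: ideal_add ideal_neg)

lemmas ideal_rules = ideal_carr ideal_0 ideal_add ideal_lmult ideal_rmult ideal_neg ideal_diff

lemma ideal_add_cancel:
  assumes "ideal I R" "a \<oplus> b \<in> I" "b \<in> I" "a \<in> carrier R"
  shows "a \<in> I"
proof -
  have "b \<in> carrier R" using assms ideal_carr by blast
  then have "a = (a \<oplus> b) \<ominus> b" using assms by algebra
  then show ?thesis using ideal_diff[OF assms(1-3)] by simp
qed

end

context cring
begin

lemma cring_idealI:
  assumes sub: "I \<subseteq> carrier R" and z: "\<zero> \<in> I"
    and a: "\<And>a b. a \<in> I \<Longrightarrow> b \<in> I \<Longrightarrow> a \<oplus> b \<in> I"
    and m: "\<And>a x. a \<in> I \<Longrightarrow> x \<in> carrier R \<Longrightarrow> x \<otimes> a \<in> I"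
  shows "ideal I R"
proof (rule idealI[OF ring_axioms])
  show "subgroup I (add_monoid R)"
  proof (rule add.subgroupI)
    show "I \<noteq> {}" using z by auto
    fix x assume x: "x \<in> I"
    then have "\<ominus> x = (\<ominus> \<one>) \<otimes> x" using sub by (simp add: l_minus subset_iff)
    then show "\<ominus> x \<in> I" using m x by simp
  qed (use sub a in auto)
next
  fix b x assume "b \<in> I" "x \<in> carrier R"
  then show "x \<otimes> b \<in> I" "b \<otimes> x \<in> I" using m sub m_comm[of b x] by auto
qed

lemma Idl_insert_iff:
  assumes J: "ideal J R" and x: "x \<in> carrier R"
  shows "z \<in> Idl (insert x J) \<longleftrightarrow> (\<exists>j\<in>J. \<exists>a\<in>carrier R. z = j \<oplus> a \<otimes> x)"
proof
  let ?S = "{z. \<exists>j\<in>J. \<exists>a\<in>carrier R. z = j \<oplus> a \<otimes> x}"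
  have Jc: "\<And>j. j \<in> J \<Longrightarrow> j \<in> carrier R" using J ideal_carr by blast
  have "ideal ?S R"
  proof (rule cring_idealI)
    show "?S \<subseteq> carrier R" using Jc x by auto
    show "\<zero> \<in> ?S" using ideal_0[OF J] x by (auto intro!: bexI[of _ \<zero>])
    fix a b assume "a \<in> ?S" "b \<in> ?S"
    then obtain j u k v where h: "j \<in> J" "u \<in> carrier R" "a = j \<oplus> u \<otimes> x"
       "k \<in> J" "v \<in> carrier R" "b = k \<oplus> v \<otimes> x" by blast
    have "a \<oplus> b = (j \<oplus> k) \<oplus> (u \<oplus> v) \<otimes> x" using h Jc[OF h(1)] Jc[OF h(4)] x
      by algebra
    then show "a \<oplus> b \<in> ?S" using ideal_add[OF J h(1,4)] h by blast
  next
    fix a y assume "a \<in> ?S" and y: "y \<in> carrier R"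
    then obtain j u where h: "j \<in> J" "u \<in> carrier R" "a = j \<oplus> u \<otimes> x" by blast
    have "y \<otimes> a = (y \<otimes> j) \<oplus> (y \<otimes> u) \<otimes> x" using h Jc[OF h(1)] x y by algebra
    then show "y \<otimes> a \<in> ?S" using ideal_lmult[OF J h(1) y] h y by blast
  qed
  moreover have "insert x J \<subseteq> ?S"
  proof
    fix z assume "z \<in> insert x J"
    then show "z \<in> ?S"
    proof
      assume "z = x"
      then have "z = \<zero> \<oplus> \<one> \<otimes> x" using x by simp
      then show ?thesis using ideal_0[OF J] by blast
    next
      assume z: "z \<in> J"
      then have "z = z \<oplus> \<zero> \<otimes> x" using x Jc by simp
      then show ?thesis using z by blast
    qed
  qed
  ultimately have "Idl (insert x J) \<subseteq> ?S" by (rule genideal_minimal)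
  then show "z \<in> Idl (insert x J) \<Longrightarrow> \<exists>j\<in>J. \<exists>a\<in>carrier R. z = j \<oplus> a \<otimes> x" by blast
next
  have s: "insert x J \<subseteq> carrier R" using x ideal_sub[OF J] by simp
  then have i: "ideal (Idl (insert x J)) R" and "insert x J \<subseteq> Idl (insert x J)"
    using genideal_ideal[OF s] genideal_self[OF s] by auto
  then show "\<exists>j\<in>J. \<exists>a\<in>carrier R. z = j \<oplus> a \<otimes> x \<Longrightarrow> z \<in> Idl (insert x J)"
    by (auto intro!: ideal_add[OF i] ideal_lmult[OF i])
qed

lemma Idl_ideal: "ideal J R \<Longrightarrow> Idl J = J"
  using genideal_minimal[of J J] genideal_self[of J] ideal_sub[of J] by auto

lemma Idl_Un_Idl:
  assumes "A \<subseteq> carrier R" "B \<subseteq> carrier R"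
  shows "Idl (Idl A \<union> B) = Idl (A \<union> B)"
proof
  have i: "ideal (Idl (A \<union> B)) R" using assms by (simp add: genideal_ideal)
  have "Idl A \<subseteq> Idl (A \<union> B)" using assms by (intro subset_Idl_subset) auto
  moreover have "B \<subseteq> Idl (A \<union> B)" using assms genideal_self[of "A \<union> B"] by auto
  ultimately show "Idl (Idl A \<union> B) \<subseteq> Idl (A \<union> B)" by (intro genideal_minimal[OF i]) auto
  have "Idl A \<subseteq> carrier R" using assms genideal_ideal ideal_sub by blast
  then show "Idl (A \<union> B) \<subseteq> Idl (Idl A \<union> B)"
    using assms genideal_self[of A] by (intro subset_Idl_subset) auto
qed

lemma Idl_insert_Idl:
  assumes "A \<subseteq> carrier R" "x \<in> carrier R"
  shows "Idl (insert x (Idl A)) = Idl (insert x A)"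
  using Idl_Un_Idl[of A "{x}"] assms by simp

lemma prime_in_iff:
  assumes "primeideal P R" "a \<in> carrier R" "b \<in> carrier R"
  shows "a \<otimes> b \<in> P \<longleftrightarrow> a \<in> P \<or> b \<in> P"
  using assms primeideal.I_prime primeideal.axioms(1) ideal_lmult ideal_rmult by metis

lemma prime_one: "primeideal P R \<Longrightarrow> \<one> \<notin> P"
  using ideal.one_imp_carrier primeideal.I_notcarr primeideal.axioms(1) by metis

lemma prime_pow:
  assumes "primeideal P R" "a \<in> carrier R" "a [^] (n::nat) \<in> P"
  shows "a \<in> P"
  using assms(3) by (induction n) (use assms prime_one prime_in_iff in auto)

text \<open>The contraction to \<open>R\<close> of the extension of \<open>I\<close> to \<open>R\<^sub>P\<close>.\<close>

definition saturation :: "'a set \<Rightarrow> 'a set \<Rightarrow> 'a set" where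
  "saturation P I = {z \<in> carrier R. \<exists>s\<in>carrier R - P. s \<otimes> z \<in> I}"

lemma saturation_ideal:
  assumes P: "primeideal P R" and I: "ideal I R"
  shows "ideal (saturation P I) R"
proof (rule cring_idealI)
  show "\<zero> \<in> saturation P I"
    unfolding saturation_def using prime_one[OF P] ideal_0[OF I] by (auto intro!: bexI[of _ \<one>])
  fix a b assume "a \<in> saturation P I" "b \<in> saturation P I"
  then obtain s t where h: "s \<in> carrier R" "s \<notin> P" "t \<in> carrier R" "t \<notin> P"
    "s \<otimes> a \<in> I" "t \<otimes> b \<in> I" "a \<in> carrier R" "b \<in> carrier R"
    unfolding saturation_def by blast
  have "(s \<otimes> t) \<otimes> (a \<oplus> b) = t \<otimes> (s \<otimes> a) \<oplus> s \<otimes> (t \<otimes> b)" using h by algebra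
  then have "(s \<otimes> t) \<otimes> (a \<oplus> b) \<in> I" using h I by (simp add: ideal_rules)
  moreover have "s \<otimes> t \<in> carrier R - P" using h prime_in_iff[OF P] by simp
  ultimately show "a \<oplus> b \<in> saturation P I" unfolding saturation_def using h by blast
next
  fix a x assume "a \<in> saturation P I" and x: "x \<in> carrier R"
  then obtain s where h: "s \<in> carrier R" "s \<notin> P" "s \<otimes> a \<in> I" "a \<in> carrier R"
    unfolding saturation_def by blast
  have "s \<otimes> (x \<otimes> a) = x \<otimes> (s \<otimes> a)" using h x by algebra
  then have "s \<otimes> (x \<otimes> a) \<in> I" using h I x by (simp add: ideal_rules)
  then show "x \<otimes> a \<in> saturation P I" unfolding saturation_def using h x by blast
qed (auto simp: saturation_def)

lemma saturation_mono: "I \<subseteq> J \<Longrightarrow> saturation P I \<subseteq> saturation P J"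
  unfolding saturation_def by blast

lemma saturation_superset:
  assumes "primeideal P R" "ideal I R"
  shows "I \<subseteq> saturation P I"
proof
  fix z assume "z \<in> I"
  then have "\<one> \<otimes> z \<in> I" "z \<in> carrier R" using assms by (auto simp: ideal_carr)
  then show "z \<in> saturation P I" unfolding saturation_def using prime_one[OF assms(1)] by blast
qed

lemma saturation_mult:
  assumes P: "primeideal P R"
    and "s \<in> carrier R" "s \<notin> P" "z \<in> carrier R" "s \<otimes> z \<in> saturation P I"
  shows "z \<in> saturation P I"
proof -
  obtain t where t: "t \<in> carrier R" "t \<notin> P" "t \<otimes> (s \<otimes> z) \<in> I"
    using assms(5) unfolding saturation_def by blast
  then have "(t \<otimes> s) \<otimes> z \<in> I" using assms by (simp add: m_assoc)
  moreover have "t \<otimes> s \<in> carrier R - P" using t assms prime_in_iff[OF P] by simp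
  ultimately show ?thesis unfolding saturation_def using assms by blast
qed

lemma saturation_prime:
  assumes P: "primeideal P R" and Q: "primeideal Q R" and "P \<subseteq> Q"
  shows "saturation Q P = P"
  using assms saturation_superset[OF Q primeideal.axioms(1)[OF P]]
  unfolding saturation_def by (auto simp: prime_in_iff[OF P])

end

section \<open>Minimal primes of ideals in Noetherian rings\<close>

locale noetherian_cring = cring R + noetherian_ring R for R (structure)
begin

text \<open>In a Noetherian ring a nonempty chain of ideals contains its own union, so Zorn's lemma
  applies to any nonempty family of ideals.\<close>

lemma exists_maximal_member:
  assumes "C \<noteq> {}" "\<And>I. I \<in> C \<Longrightarrow> ideal I R"
  obtains M where "M \<in> C" "\<And>I. I \<in> C \<Longrightarrow> M \<subseteq> I \<Longrightarrow> I = M"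
proof -
  have "\<exists>M\<in>C. \<forall>I\<in>C. M \<subseteq> I \<longrightarrow> I = M"
  proof (rule subset_Zorn_nonempty[OF assms(1)])
    fix \<C> assume c: "\<C> \<noteq> {}" "subset.chain C \<C>"
    have "C \<subseteq> {I. ideal I R}" using assms(2) by auto
    then have "subset.chain {I. ideal I R} \<C>"
      using c(2) unfolding pred_on.chain_def by auto
    then have "\<Union>\<C> \<in> \<C>" by (rule ideal_chain_is_trivial[OF c(1)])
    then show "\<Union>\<C> \<in> C" using c(2) unfolding pred_on.chain_def by blast
  qed
  then show thesis using that by blast
qed

lemma noetherian_induct [consumes 1, case_names step]:
  assumes "ideal J R"
    and step: "\<And>J. ideal J R \<Longrightarrow> (\<And>I. ideal I R \<Longrightarrow> J \<subset> I \<Longrightarrow> P I) \<Longrightarrow> P J"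
  shows "P J"
proof (rule ccontr)
  assume "\<not> P J"
  then have "{I. ideal I R \<and> \<not> P I} \<noteq> {}" using assms(1) by blast
  then obtain M where M: "ideal M R" "\<not> P M" and mx: "\<And>I. ideal I R \<Longrightarrow> \<not> P I \<Longrightarrow> M \<subseteq> I \<Longrightarrow> I = M"
    by (rule exists_maximal_member) auto
  have "P M" using mx by (intro step[OF M(1)]) blast
  then show False using M by simp
qed

text \<open>An ideal \<open>Q\<close> maximal among those over \<open>I\<close> that miss
  \<open>S\<close> is prime: for \<open>a\<close> and \<open>b\<close> outside \<open>Q\<close>,
  both Q + (a) and Q + (b) meet \<open>S\<close>. Multiplying two such elements gives an element of
  \<open>S\<close>, which would lie in \<open>Q\<close> if \<open>a \<otimes> b\<close> did.\<close>

lemma prime_avoiding: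
  assumes I: "ideal I R" and one: "\<one> \<in> S" and S: "S \<subseteq> carrier R"
    and mult: "\<And>a b. a \<in> S \<Longrightarrow> b \<in> S \<Longrightarrow> a \<otimes> b \<in> S" and disj: "I \<inter> S = {}"
  obtains Q where "primeideal Q R" "I \<subseteq> Q" "Q \<inter> S = {}"
proof -
  let ?C = "{J. ideal J R \<and> I \<subseteq> J \<and> J \<inter> S = {}}"
  have "?C \<noteq> {}" using I disj by blast
  then obtain Q where Q: "ideal Q R" "I \<subseteq> Q" "Q \<inter> S = {}"
    and mx: "\<And>J. ideal J R \<Longrightarrow> I \<subseteq> J \<Longrightarrow> J \<inter> S = {} \<Longrightarrow> Q \<subseteq> J \<Longrightarrow> J = Q"
    by (rule exists_maximal_member) auto
  have "primeideal Q R"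
  proof (rule primeidealI[OF Q(1) is_cring])
    show "carrier R \<noteq> Q" using Q(3) one S by auto
    fix a b assume ab: "a \<in> carrier R" "b \<in> carrier R" "a \<otimes> b \<in> Q"
    have key: "\<exists>q\<in>Q. \<exists>u\<in>carrier R. q \<oplus> u \<otimes> c \<in> S" if c: "c \<in> carrier R" "c \<notin> Q" for c
    proof -
      have i: "ideal (Idl (insert c Q)) R" "insert c Q \<subseteq> Idl (insert c Q)"
        using c ideal_sub[OF Q(1)] genideal_self[of "insert c Q"] by (simp_all add: genideal_ideal)
      then have "Idl (insert c Q) \<noteq> Q" using c by auto
      then have "Idl (insert c Q) \<inter> S \<noteq> {}" using mx[OF i(1)] Q(2) i(2) by blast
      then obtain z where "z \<in> Idl (insert c Q)" "z \<in> S" by blast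
      then show ?thesis using Idl_insert_iff[OF Q(1) c(1)] by metis
    qed
    show "a \<in> Q \<or> b \<in> Q"
    proof (rule ccontr)
      assume "\<not> (a \<in> Q \<or> b \<in> Q)"
      then obtain q u r v where h: "q \<in> Q" "u \<in> carrier R" "q \<oplus> u \<otimes> a \<in> S"
        "r \<in> Q" "v \<in> carrier R" "r \<oplus> v \<otimes> b \<in> S" using key ab by meson
      have c: "q \<in> carrier R" "r \<in> carrier R" using h ideal_carr[OF Q(1)] by auto
      have "(q \<oplus> u \<otimes> a) \<otimes> (r \<oplus> v \<otimes> b) = (r \<oplus> v \<otimes> b) \<otimes> q \<oplus> ((u \<otimes> a) \<otimes> r \<oplus> (u \<otimes> v) \<otimes> (a \<otimes> b))"
        using h c ab by algebra
      also have "\<dots> \<in> Q" using h c ab by (auto intro!: ideal_add[OF Q(1)] ideal_lmult[OF Q(1) ab(3)] intro: ideal_lmult[OF Q(1)])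
      finally show False using mult[OF h(3,6)] Q(3) by blast
    qed
  qed
  then show thesis using that Q by blast
qed

definition minimal_prime :: "'a set \<Rightarrow> 'a set \<Rightarrow> bool" where
  "minimal_prime J P \<longleftrightarrow> primeideal P R \<and> J \<subseteq> P \<and> (\<forall>Q. primeideal Q R \<longrightarrow> J \<subseteq> Q \<longrightarrow> Q \<subseteq> P \<longrightarrow> Q = P)"

text \<open>Locally at \<open>P\<close>, the image of \<open>P\<close> is the only prime modulo
  \<open>J\<close>, so its elements are nilpotent there. If none of the products
  \<open>s \<otimes> y [^] n\<close> were in \<open>J\<close>, some prime over \<open>J\<close>
  would avoid all of them; it would lie inside \<open>P\<close>, be equal to \<open>P\<close> by
  minimality, and yet miss \<open>y\<close>.\<close>

lemma minimal_prime_nilpotent: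
  assumes J: "ideal J R" and P: "minimal_prime J P" and y: "y \<in> P"
  obtains s n where "s \<in> carrier R" "s \<notin> P" "s \<otimes> y [^] (n::nat) \<in> J"
proof -
  have Pp: "primeideal P R" and yc: "y \<in> carrier R"
    using P y ideal_carr primeideal.axioms(1) unfolding minimal_prime_def by blast+
  let ?S = "{s \<otimes> y [^] n | s n. s \<in> carrier R - P \<and> n \<in> (UNIV::nat set)}"
  have "J \<inter> ?S \<noteq> {}"
  proof
    assume d: "J \<inter> ?S = {}"
    have in_S: "s \<in> ?S" if "s \<in> carrier R" "s \<notin> P" for s
      using that by (auto intro!: exI[of _ s] exI[of _ "0::nat"])
    have yS: "y \<in> ?S" using yc prime_one[OF Pp] by (auto intro!: exI[of _ \<one>] exI[of _ "1::nat"])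
    obtain Q where Q: "primeideal Q R" "J \<subseteq> Q" "Q \<inter> ?S = {}"
    proof (rule prime_avoiding[OF J _ _ _ d])
      show "\<one> \<in> ?S" using in_S prime_one[OF Pp] by simp
      show "?S \<subseteq> carrier R" using yc by auto
      fix a b assume "a \<in> ?S" "b \<in> ?S"
      then obtain s n t m where h: "a = s \<otimes> y [^] n" "b = t \<otimes> y [^] m"
        "s \<in> carrier R - P" "t \<in> carrier R - P" and "n \<in> (UNIV::nat set)" "m \<in> (UNIV::nat set)"
        by blast
      have "a \<otimes> b = (s \<otimes> t) \<otimes> y [^] (n + m)" using h yc
        by (simp add: nat_pow_mult[symmetric] m_ac)
      moreover have "s \<otimes> t \<in> carrier R - P" using h prime_in_iff[OF Pp] by auto
      ultimately show "a \<otimes> b \<in> ?S" by blast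
    qed auto
    have "Q \<subseteq> P" using Q in_S ideal_carr[OF primeideal.axioms(1)[OF Q(1)]] by blast
    then have "Q = P" using P Q unfolding minimal_prime_def by blast
    then show False using Q(3) yS y by blast
  qed
  then show thesis using that by blast
qed

text \<open>The witness \<open>x\<close> has an annihilator (J : x) that is maximal among those
  contained in \<open>P\<close>. Restricting to annihilators inside \<open>P\<close> aims at the
  prescribed prime; that all of \<open>P\<close> is reached comes from the local nilpotence of its
  elements.\<close>

lemma minimal_prime_associated:
  assumes J: "ideal J R" and P: "minimal_prime J P"
  obtains x where "x \<in> carrier R" "P = {r \<in> carrier R. r \<otimes> x \<in> J}"
proof -
  have Pp: "primeideal P R" and JP: "J \<subseteq> P" using P unfolding minimal_prime_def by auto
  let ?c = "\<lambda>x. {r \<in> carrier R. r \<otimes> x \<in> J}"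
  have ci: "ideal (?c x) R" if "x \<in> carrier R" for x
    using that J by (intro cring_idealI) (auto simp: ideal_rules l_distr m_assoc)
  let ?C = "{?c x | x. x \<in> carrier R \<and> ?c x \<subseteq> P}"
  have "?c \<one> \<in> ?C" using JP by (auto intro!: exI[of _ \<one>])
  then have "?C \<noteq> {}" by blast
  then obtain M where "M \<in> ?C" and mx: "\<And>I. I \<in> ?C \<Longrightarrow> M \<subseteq> I \<Longrightarrow> I = M"
    by (rule exists_maximal_member) (use ci in auto)
  then obtain x where x: "x \<in> carrier R" "?c x \<subseteq> P" and M: "M = ?c x" by blast
  have same: "?c (t \<otimes> x) = ?c x" if t: "t \<in> carrier R" "?c (t \<otimes> x) \<subseteq> P" for t
  proof -
    have "?c x \<subseteq> ?c (t \<otimes> x)"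
    proof
      fix r assume r: "r \<in> ?c x"
      then have "r \<otimes> (t \<otimes> x) = t \<otimes> (r \<otimes> x)" using t x by (simp add: m_ac)
      then show "r \<in> ?c (t \<otimes> x)" using r t J by (simp add: ideal_rules)
    qed
    moreover have "?c (t \<otimes> x) \<in> ?C" using t x by blast
    ultimately show ?thesis using mx M by blast
  qed
  have "P \<subseteq> ?c x"
  proof
    fix y assume y: "y \<in> P"
    have yc: "y \<in> carrier R" using y Pp ideal_carr primeideal.axioms(1) by blast
    obtain s n where s: "s \<in> carrier R" "s \<notin> P" "s \<otimes> y [^] (n::nat) \<in> J"
      by (rule minimal_prime_nilpotent[OF J P y])
    \<comment> \<open>The least such exponent is positive, and its predecessor still has an
      annihilator inside \<open>P\<close>, equal to (J : x) by maximality. Hence some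
      \<open>t\<close> outside \<open>P\<close> has t y in (J : x). Now (J : t x) is again inside
      \<open>P\<close>, so equal to (J : x), and it contains \<open>y\<close>.\<close>
    let ?Q = "\<lambda>k. \<not> ?c (y [^] (k::nat) \<otimes> x) \<subseteq> P"
    have "s \<otimes> (y [^] n \<otimes> x) = (s \<otimes> y [^] n) \<otimes> x" using s yc x by (simp add: m_assoc)
    then have "s \<otimes> (y [^] n \<otimes> x) \<in> J" using s x J by (simp add: ideal_rules)
    then have "?Q n" using s by blast
    define k where "k = (LEAST k. ?Q k)"
    have k: "?Q k" "\<And>j. j < k \<Longrightarrow> \<not> ?Q j"
      unfolding k_def using LeastI[of ?Q, OF \<open>?Q n\<close>] not_less_Least[of _ ?Q] by blast+
    have "k \<noteq> 0" using k(1) x by auto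
    then obtain j where j: "k = Suc j" using not0_implies_Suc by blast
    have cj: "?c (y [^] j \<otimes> x) = ?c x" using k(2)[of j] j yc by (intro same) auto
    obtain t where t: "t \<in> carrier R" "t \<notin> P" "t \<otimes> (y [^] k \<otimes> x) \<in> J"
      using k(1) by blast
    have "t \<otimes> (y [^] k \<otimes> x) = (t \<otimes> y) \<otimes> (y [^] j \<otimes> x)" using t yc x j by (simp add: m_ac)
    then have "t \<otimes> y \<in> ?c x" using t yc cj by auto
    then have ty: "y \<otimes> (t \<otimes> x) \<in> J" using t yc x by (simp add: m_ac)
    have "?c (t \<otimes> x) \<subseteq> P"
    proof
      fix r assume r: "r \<in> ?c (t \<otimes> x)"
      then have "r \<otimes> t \<in> ?c x" using t x by (simp add: m_assoc)
      then show "r \<in> P" using x(2) t r prime_in_iff[OF Pp] by auto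
    qed
    then show "y \<in> ?c x" using same[OF t(1)] ty yc by blast
  qed
  then show thesis using that x by blast
qed

text \<open>If \<open>J\<close> is not prime, with \<open>a \<otimes> b\<close> in \<open>J\<close>
  and neither factor in it, every prime over \<open>J\<close> lies over J + (a) or over J + (b), and
  Noetherian induction covers these two ideals.\<close>

lemma finite_primes_below:
  assumes "ideal J R"
  obtains F where "finite F" "\<And>P. P \<in> F \<Longrightarrow> primeideal P R \<and> J \<subseteq> P"
    "\<And>Q. primeideal Q R \<Longrightarrow> J \<subseteq> Q \<Longrightarrow> \<exists>P\<in>F. P \<subseteq> Q"
proof -
  have "\<exists>F. finite F \<and> (\<forall>P\<in>F. primeideal P R \<and> J \<subseteq> P) \<and>
     (\<forall>Q. primeideal Q R \<longrightarrow> J \<subseteq> Q \<longrightarrow> (\<exists>P\<in>F. P \<subseteq> Q))"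
    using assms
  proof (induction rule: noetherian_induct)
    case (step J)
    show ?case
    proof (cases "primeideal J R")
      case True then show ?thesis by (intro exI[of _ "{J}"]) auto
    next
      case False
      then consider "carrier R = J" | a b where "a \<in> carrier R" "b \<in> carrier R" "a \<otimes> b \<in> J" "a \<notin> J" "b \<notin> J"
        using ideal.primeidealCD[OF step(1) is_cring] by blast
      then show ?thesis
      proof cases
        case 1 then show ?thesis
          by (intro exI[of _ "{}"]) (auto dest: primeideal.I_notcarr primeideal.axioms(1) ideal_carr)
      next
        case 2
        have big: "ideal (Idl (insert c J)) R" "J \<subset> Idl (insert c J)" if "c \<in> carrier R" "c \<notin> J" for c
          using that ideal_sub[OF step(1)] genideal_self[of "insert c J"] by (auto simp: genideal_ideal)
        obtain F where F: "finite F" "\<forall>P\<in>F. primeideal P R \<and> Idl (insert a J) \<subseteq> P"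
             "\<forall>Q. primeideal Q R \<longrightarrow> Idl (insert a J) \<subseteq> Q \<longrightarrow> (\<exists>P\<in>F. P \<subseteq> Q)"
          using step(2)[OF big[OF 2(1,4)]] by blast
        obtain G where G: "finite G" "\<forall>P\<in>G. primeideal P R \<and> Idl (insert b J) \<subseteq> P"
             "\<forall>Q. primeideal Q R \<longrightarrow> Idl (insert b J) \<subseteq> Q \<longrightarrow> (\<exists>P\<in>G. P \<subseteq> Q)"
          using step(2)[OF big[OF 2(2,5)]] by blast
        have "\<exists>P\<in>F\<union>G. P \<subseteq> Q" if Q: "primeideal Q R" "J \<subseteq> Q" for Q
        proof -
          have "a \<in> Q \<or> b \<in> Q" using 2 Q prime_in_iff[OF Q(1)] by blast
          then consider "Idl (insert a J) \<subseteq> Q" | "Idl (insert b J) \<subseteq> Q"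
            using Q genideal_minimal[OF primeideal.axioms(1)[OF Q(1)]] by blast
          then show ?thesis
          proof cases
            case 1 then show ?thesis using F(3) Q(1) by (metis UnI1)
          next
            case 2 then show ?thesis using G(3) Q(1) by (metis UnI2)
          qed
        qed
        moreover have "\<forall>P\<in>F\<union>G. primeideal P R \<and> J \<subseteq> P" using F(2) G(2) big(2)[OF 2(1,4)] big(2)[OF 2(2,5)] by (metis Un_iff psubsetE subset_trans)
        ultimately show ?thesis using F(1) G(1) by (intro exI[of _ "F \<union> G"]) auto
      qed
    qed
  qed
  then show thesis using that by blast
qed

end

section \<open>Krull height and regular local rings\<close>

context noetherian_cring
begin

lemma saturation_least:
  assumes K: "ideal K R" and sat: "\<And>s z. s \<in> carrier R \<Longrightarrow> s \<notin> P \<Longrightarrow> z \<in> carrier R \<Longrightarrow> s \<otimes> z \<in> K \<Longrightarrow> z \<in> K"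
    and "A \<subseteq> K"
  shows "saturation P (Idl A) \<subseteq> K"
  using genideal_minimal[OF K assms(3)] sat unfolding saturation_def by blast

text \<open>This is the descending chain condition in the localization of R/J at a minimal prime, an
  Artinian ring, told without lengths. The induction enlarges \<open>J\<close> by an element
  \<open>g\<close> with (J : g) = \<open>M\<close>, that is, by one simple factor of the localized
  quotient.\<close>

lemma saturated_chain_stabilizes:
  assumes M: "minimal_prime J\<^sub>0 M" and J: "ideal J R" "J\<^sub>0 \<subseteq> J"
    and E: "\<And>n::nat. ideal (E n) R" "\<And>n. J \<subseteq> E n" "\<And>n. E (Suc n) \<subseteq> E n"
    and sat: "\<And>n s z. s \<in> carrier R \<Longrightarrow> s \<notin> M \<Longrightarrow> z \<in> carrier R \<Longrightarrow> s \<otimes> z \<in> E n \<Longrightarrow> z \<in> E n"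
  shows "\<exists>N. \<forall>n\<ge>N. E n = E N"
  using J E sat
proof (induction arbitrary: E rule: noetherian_induct)
  case (step J E)
  note J = step(1) and IH = step(2) and J0 = step(3) and E = step(4-6) and sat = step(7)
  have Mp: "primeideal M R" using M unfolding minimal_prime_def by blast
  have anti: "n \<le> k \<Longrightarrow> E k \<subseteq> E n" for n k
    using E(3) by (rule lift_Suc_antimono_le)
  show ?case
  proof (cases "J \<subseteq> M")
    case False
    then obtain s where s: "s \<in> J" "s \<notin> M" by blast
    then have sc: "s \<in> carrier R" using J ideal_carr by blast
    have "E n = carrier R" for n
    proof -
      have "s \<otimes> \<one> \<in> E n" using s E(2) sc by auto
      then have "\<one> \<in> E n" using sat[OF sc s(2)] by blast
      then show ?thesis using ideal.one_imp_carrier[OF E(1)] by blast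
    qed
    then show ?thesis by simp
  next
    case True
    then have "minimal_prime J M" using M J0 unfolding minimal_prime_def by (meson subset_trans)
    then obtain g where g: "g \<in> carrier R" "M = {r \<in> carrier R. r \<otimes> g \<in> J}"
      by (rule minimal_prime_associated[OF J])
    have gJ: "g \<notin> J" using prime_one[OF Mp] g by auto
    let ?J = "Idl (insert g J)"
    have Ji: "ideal ?J R" using g ideal_sub[OF J] by (simp add: genideal_ideal)
    have ins: "insert g J \<subseteq> ?J" using g ideal_sub[OF J] by (intro genideal_self) auto
    then have JJ: "J \<subset> ?J" using gJ by blast
    show ?thesis
    proof (cases "\<forall>n. g \<in> E n")
      case True
      have "?J \<subseteq> E n" for n using True E(2) by (intro genideal_minimal[OF E(1)]) auto
      then show ?thesis using J0 JJ E(1,3) sat by (intro IH[OF Ji JJ]) auto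
    next
      case False
      then obtain n0 where n0: "g \<notin> E n0" by blast
      \<comment> \<open>Adding \<open>g\<close> makes the chain contain \<open>?J\<close>, and
        saturating restores the closure condition, so the induction hypothesis covers
        \<open>?F\<close>. Whether \<open>E n\<close> itself stabilizes then depends only on the
        multiples of \<open>g\<close> in it.\<close>
      let ?F = "\<lambda>n. saturation M (Idl (insert g (E n)))"
      have c: "insert g (E n) \<subseteq> carrier R" for n using g ideal_sub[OF E(1)] by blast
      have Ii: "ideal (Idl (insert g (E n))) R" for n using c by (rule genideal_ideal)
      have "\<exists>N. \<forall>n\<ge>N. ?F n = ?F N"
      proof (rule IH[OF Ji JJ])
        show "J\<^sub>0 \<subseteq> ?J" using J0 JJ by blast
        show "ideal (?F n) R" for n by (rule saturation_ideal[OF Mp Ii])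
        show "?J \<subseteq> ?F n" for n
        proof -
          have "?J \<subseteq> Idl (insert g (E n))" using E(2)[of n] by (intro subset_Idl_subset[OF c]) auto
          then show ?thesis using saturation_superset[OF Mp Ii] by blast
        qed
        show "?F (Suc n) \<subseteq> ?F n" for n
          using E(3)[of n] by (intro saturation_mono subset_Idl_subset[OF c]) auto
        show "\<And>n s z. s \<in> carrier R \<Longrightarrow> s \<notin> M \<Longrightarrow> z \<in> carrier R \<Longrightarrow> s \<otimes> z \<in> ?F n \<Longrightarrow> z \<in> ?F n"
          by (rule saturation_mult[OF Mp])
      qed
      then obtain N where N: "\<forall>n\<ge>N. ?F n = ?F N" by blast
      define L where "L = max n0 N"
      have step: "E n \<subseteq> E (Suc n)" if n: "n \<ge> L" for n
      proof
        fix z assume z: "z \<in> E n"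
        have zc: "z \<in> carrier R" using z ideal_carr[OF E(1)] by blast
        have gn: "g \<notin> E n" using anti[of n0 n] n0 n unfolding L_def by auto
        have zF: "z \<in> ?F n" using z genideal_self[OF c] saturation_superset[OF Mp Ii] by blast
        have "N \<le> n" "N \<le> Suc n" using n unfolding L_def by auto
        then have e: "?F (Suc n) = ?F n" by (intro trans[OF N[rule_format] N[rule_format, symmetric]])
        have "z \<in> ?F (Suc n)" unfolding e by (rule zF)
        then obtain s where s: "s \<in> carrier R" "s \<notin> M" "s \<otimes> z \<in> Idl (insert g (E (Suc n)))"
          unfolding saturation_def by blast
        obtain e a where e: "e \<in> E (Suc n)" "a \<in> carrier R" "s \<otimes> z = e \<oplus> a \<otimes> g"
          using s(3) unfolding Idl_insert_iff[OF E(1) g(1)] by blast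
        have ec: "e \<in> carrier R" using e ideal_carr[OF E(1)] by blast
        have "a \<otimes> g = s \<otimes> z \<ominus> e" using e(3) ec e(2) g s zc by algebra
        then have "a \<otimes> g \<in> E n"
          using ideal_diff[OF E(1) ideal_lmult[OF E(1) z s(1)]] e(1) E(3) by auto
        \<comment> \<open>The multiples of \<open>g\<close> modulo \<open>J\<close> form a copy of
          R/M, a field after localizing at \<open>M\<close>: a coefficient outside \<open>M\<close>
          would put \<open>g\<close> itself into \<open>E n\<close>.\<close>
        then have "a \<in> M" using sat[OF e(2) _ g(1)] gn by blast
        then have "a \<otimes> g \<in> E (Suc n)" using g E(2) by blast
        then have "s \<otimes> z \<in> E (Suc n)" using e ideal_add[OF E(1)] by simp
        then show "z \<in> E (Suc n)" using sat[OF s(1,2) zc] by blast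
      qed
      have "E n = E L" if "n \<ge> L" for n
        using that
      proof (induction rule: dec_induct)
        case (step n)
        then show ?case using E(3)[of n] \<open>\<And>n. n \<ge> L \<Longrightarrow> E n \<subseteq> E (Suc n)\<close>[of n] by auto
      qed simp
      then show ?thesis by blast
    qed
  qed
qed

text \<open>The hypothesis says that locally at \<open>P\<close> the ideal \<open>N\<close> is
  contained in N' + x N. The argument uses the maximal condition in place of a determinant: among
  the ideals generated over N' by one element of \<open>N\<close> outside its saturation, a maximal
  one is compared with the ideal of the element \<open>w\<close> from the hypothesis.\<close>

lemma nakayama:
  assumes P: "primeideal P R" and x: "x \<in> P" and N: "ideal N R" and N': "ideal N' R"
    and h: "\<And>z. z \<in> N \<Longrightarrow> \<exists>s\<in>carrier R - P. \<exists>n\<in>N'. \<exists>w\<in>N. s \<otimes> z = n \<oplus> x \<otimes> w"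
  shows "N \<subseteq> saturation P N'"
proof (rule ccontr)
  let ?T = "saturation P N'"
  let ?I = "\<lambda>z. saturation P (Idl (insert z ?T))"
  have T: "ideal ?T R" by (rule saturation_ideal[OF P N'])
  have xc: "x \<in> carrier R" using x P primeideal.axioms(1) ideal_carr by blast
  have c: "insert z ?T \<subseteq> carrier R" if "z \<in> carrier R" for z
    using that ideal_sub[OF T] by blast
  have Ii: "ideal (?I z) R" if "z \<in> carrier R" for z
    using c[OF that] by (intro saturation_ideal[OF P] genideal_ideal)
  have sub: "insert z ?T \<subseteq> ?I z" if "z \<in> carrier R" for z
    using genideal_self[OF c[OF that]] saturation_superset[OF P genideal_ideal[OF c[OF that]]] by blast
  have le: "?I z \<subseteq> ?I w" if "z \<in> carrier R" "w \<in> carrier R" "z \<in> ?I w" for z w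
    using that sub[OF that(2)] saturation_mult[OF P] by (intro saturation_least Ii) auto
  assume "\<not> N \<subseteq> ?T"
  then have "{?I z | z. z \<in> N \<and> z \<notin> ?T} \<noteq> {}" by blast
  then obtain M where "M \<in> {?I z | z. z \<in> N \<and> z \<notin> ?T}"
    and mx: "\<And>I. I \<in> {?I z | z. z \<in> N \<and> z \<notin> ?T} \<Longrightarrow> M \<subseteq> I \<Longrightarrow> I = M"
    by (rule exists_maximal_member) (use Ii ideal_carr[OF N] in auto)
  then obtain z where z: "z \<in> N" "z \<notin> ?T" and M: "M = ?I z" by blast
  obtain s n w where h: "s \<in> carrier R" "s \<notin> P" "n \<in> N'" "w \<in> N" "s \<otimes> z = n \<oplus> x \<otimes> w"
    using h[OF z(1)] by blast
  have zc: "z \<in> carrier R" and wc: "w \<in> carrier R" using z h ideal_carr[OF N] by auto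
  have xw: "x \<otimes> w \<in> carrier R" using xc wc by simp
  have nT: "n \<in> ?T" using h(3) saturation_superset[OF P N'] by blast
  have z1: "z \<in> ?I (x \<otimes> w)"
  proof (rule saturation_mult[OF P h(1,2) zc])
    show "s \<otimes> z \<in> ?I (x \<otimes> w)"
      unfolding h(5) using sub[OF xw] nT by (intro ideal_add[OF Ii[OF xw]]) auto
  qed
  have z2: "x \<otimes> w \<in> ?I w" using sub[OF wc] xc by (intro ideal_lmult[OF Ii[OF wc]]) auto
  have wT: "w \<notin> ?T"
  proof
    assume "w \<in> ?T"
    then have "s \<otimes> z \<in> ?T" unfolding h(5) using nT xc T by (simp add: ideal_add ideal_lmult)
    then show False using saturation_mult[OF P h(1,2) zc] z(2) by blast
  qed
  have i1: "?I z \<subseteq> ?I (x \<otimes> w)" by (rule le[OF zc xw z1])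
  have i2: "?I (x \<otimes> w) \<subseteq> ?I w" by (rule le[OF xw wc z2])
  \<comment> \<open>By maximality \<open>w\<close> and \<open>x \<otimes> w\<close> generate the
    same ideal over \<open>?T\<close>. This gives (t - a x) w in \<open>?T\<close> for some
    \<open>t\<close> outside \<open>P\<close>, and t - a x is outside \<open>P\<close> as well, so
    \<open>w\<close> would be in \<open>?T\<close>.\<close>
  have "?I w \<in> {?I z | z. z \<in> N \<and> z \<notin> ?T}" using wT h(4) by blast
  then have "?I w = ?I z" using mx i1 i2 unfolding M by blast
  then have "w \<in> ?I (x \<otimes> w)" using i1 sub[OF wc] by blast
  then obtain t where t: "t \<in> carrier R" "t \<notin> P" "t \<otimes> w \<in> Idl (insert (x \<otimes> w) ?T)"
    unfolding saturation_def[of P "Idl (insert (x \<otimes> w) ?T)"] by blast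
  then obtain j a where a: "j \<in> ?T" "a \<in> carrier R" "t \<otimes> w = j \<oplus> a \<otimes> (x \<otimes> w)"
    unfolding Idl_insert_iff[OF T xw] by blast
  have jc: "j \<in> carrier R" using a ideal_carr[OF T] by blast
  have "(t \<ominus> a \<otimes> x) \<otimes> w = t \<otimes> w \<ominus> a \<otimes> (x \<otimes> w)" using t(1) a(2) xc wc by algebra
  also have "\<dots> = j" unfolding a(3) using jc a(2) xc wc by algebra
  finally have 1: "(t \<ominus> a \<otimes> x) \<otimes> w \<in> ?T" using a(1) by simp
  have Pi: "ideal P R" using P primeideal.axioms(1) by blast
  have "t \<ominus> a \<otimes> x \<notin> P"
  proof
    assume "t \<ominus> a \<otimes> x \<in> P"
    then have "t \<ominus> a \<otimes> x \<oplus> a \<otimes> x \<in> P" using x a by (intro ideal_add[OF Pi] ideal_lmult[OF Pi]) auto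
    moreover have "t \<ominus> a \<otimes> x \<oplus> a \<otimes> x = t" using t(1) a(2) xc by algebra
    ultimately show False using t(2) by simp
  qed
  then have "w \<in> ?T" using saturation_mult[OF P _ _ wc 1] t a xc by simp
  then show False using wT by blast
qed

text \<open>In the last case \<open>x\<close> lies outside \<open>P\<^sub>1\<close> and \<open>P\<^sub>2\<close> is minimal over \<open>P\<^sub>0 + (x)\<close>. For \<open>y\<close> in
  \<open>P\<^sub>1 - P\<^sub>0\<close>, the contractions \<open>D n\<close> of \<open>P\<^sub>0 + (y\<^sup>n)\<close> from the localization at \<open>P\<^sub>1\<close> then stabilize
  by the descending chain condition modulo \<open>x\<close> and Nakayama's lemma, which forces \<open>y\<^sup>n \<in> P\<^sub>0\<close>.\<close>

lemma krull_principal_ideal: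
  assumes P: "primeideal P\<^sub>0 R" "primeideal P\<^sub>1 R" "primeideal P\<^sub>2 R" "P\<^sub>0 \<subset> P\<^sub>1" "P\<^sub>1 \<subset> P\<^sub>2" and x: "x \<in> P\<^sub>2"
  obtains Q where "primeideal Q R" "x \<in> Q" "P\<^sub>0 \<subset> Q" "Q \<subset> P\<^sub>2"
proof (cases "x \<in> P\<^sub>0")
  case True then show thesis using that[of P\<^sub>1] P by blast
next
  case x0: False
  have i: "ideal P\<^sub>0 R" "ideal P\<^sub>1 R" "ideal P\<^sub>2 R" using P primeideal.axioms(1) by auto
  have xc: "x \<in> carrier R" using x ideal_carr[OF i(3)] by blast
  let ?J = "Idl (insert x P\<^sub>0)"
  have Jc: "insert x P\<^sub>0 \<subseteq> carrier R" using xc ideal_sub[OF i(1)] by blast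
  note Ji = genideal_ideal[OF Jc] and Js = genideal_self[OF Jc]
  have JP2: "?J \<subseteq> P\<^sub>2" using x P by (intro genideal_minimal[OF i(3)]) auto
  show thesis
  proof (cases "minimal_prime ?J P\<^sub>2")
    case False
    then obtain Q where "primeideal Q R" "?J \<subseteq> Q" "Q \<subset> P\<^sub>2"
      using JP2 P unfolding minimal_prime_def by blast
    then show thesis using that[of Q] Js x0 by blast
  next
    case min: True
    have x1: "x \<notin> P\<^sub>1"
    proof
      assume "x \<in> P\<^sub>1"
      then have "?J \<subseteq> P\<^sub>1" using P by (intro genideal_minimal[OF i(2)]) auto
      then show False using min P unfolding minimal_prime_def by blast
    qed
    obtain y where y: "y \<in> P\<^sub>1" "y \<notin> P\<^sub>0" using P by blast
    have yc: "y \<in> carrier R" using y ideal_carr[OF i(2)] by blast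
    define D where "D = (\<lambda>n::nat. saturation P\<^sub>1 (Idl (insert (y [^] n) P\<^sub>0)))"
    have c: "insert (y [^] n) P\<^sub>0 \<subseteq> carrier R" for n :: nat using yc ideal_sub[OF i(1)] by auto
    have Di: "ideal (D n) R" for n unfolding D_def by (intro saturation_ideal[OF P(2)] genideal_ideal[OF c])
    have Dsub: "insert (y [^] n) P\<^sub>0 \<subseteq> D n" for n
      unfolding D_def using genideal_self[OF c] saturation_superset[OF P(2) genideal_ideal[OF c]] by blast
    have Dsat: "z \<in> D n" if "s \<in> carrier R" "s \<notin> P\<^sub>1" "z \<in> carrier R" "s \<otimes> z \<in> D n" for s z n
      using that unfolding D_def by (rule saturation_mult[OF P(2)])
    have Dmono: "D (Suc n) \<subseteq> D n" for n
    proof -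
      have "y [^] Suc n \<in> D n" using Dsub[of n] yc ideal_rmult[OF Di] by simp
      then show ?thesis unfolding D_def[THEN fun_cong, of "Suc n"]
        using Dsub Dsat by (intro saturation_least[OF Di]) auto
    qed
    define E where "E = (\<lambda>n. saturation P\<^sub>2 (Idl (insert x (D n))))"
    have c2: "insert x (D n) \<subseteq> carrier R" for n using xc ideal_sub[OF Di] by blast
    have "\<exists>N. \<forall>n\<ge>N. E n = E N"
    proof (rule saturated_chain_stabilizes[OF min Ji subset_refl])
      show "ideal (E n) R" for n unfolding E_def by (intro saturation_ideal[OF P(3)] genideal_ideal[OF c2])
      show "?J \<subseteq> E n" for n
      proof -
        have "?J \<subseteq> Idl (insert x (D n))" using Dsub[of n] by (intro subset_Idl_subset[OF c2]) auto
        then show ?thesis unfolding E_def using saturation_superset[OF P(3) genideal_ideal[OF c2]] by blast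
      qed
      show "E (Suc n) \<subseteq> E n" for n
        unfolding E_def using Dmono[of n] by (intro saturation_mono subset_Idl_subset[OF c2]) auto
      show "z \<in> E n" if "s \<in> carrier R" "s \<notin> P\<^sub>2" "z \<in> carrier R" "s \<otimes> z \<in> E n" for s z n
        using that unfolding E_def by (rule saturation_mult[OF P(3)])
    qed
    then obtain N where N: "E (Suc N) = E N" by (metis le_SucI order_refl)
    have "D N \<subseteq> saturation P\<^sub>2 (D (Suc N))"
    proof (rule nakayama[OF P(3) x Di Di])
      fix z assume z: "z \<in> D N"
      then have "z \<in> E N" unfolding E_def
        using genideal_self[OF c2] saturation_superset[OF P(3) genideal_ideal[OF c2]] by blast
      then have "z \<in> E (Suc N)" using N by simp
      then obtain s where s: "s \<in> carrier R" "s \<notin> P\<^sub>2" "s \<otimes> z \<in> Idl (insert x (D (Suc N)))"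
        unfolding E_def saturation_def[of P\<^sub>2] by blast
      then obtain d w where w: "d \<in> D (Suc N)" "w \<in> carrier R" "s \<otimes> z = d \<oplus> w \<otimes> x"
        unfolding Idl_insert_iff[OF Di xc] by blast
      have dc: "d \<in> carrier R" and zc: "z \<in> carrier R" using w z ideal_carr[OF Di] by auto
      have "x \<otimes> w = s \<otimes> z \<ominus> d" unfolding w(3) using dc w(2) xc by algebra
      also have "\<dots> \<in> D N" using w(1) Dmono by (intro ideal_diff[OF Di] ideal_lmult[OF Di z s(1)]) blast
      finally have "w \<in> D N" using Dsat[OF xc x1 w(2)] by blast
      then show "\<exists>s\<in>carrier R - P\<^sub>2. \<exists>n\<in>D (Suc N). \<exists>w\<in>D N. s \<otimes> z = n \<oplus> x \<otimes> w"
        using s w xc m_comm[of w x] by auto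
    qed
    moreover have "y [^] N \<in> D N" using Dsub by blast
    ultimately obtain s where s: "s \<in> carrier R" "s \<notin> P\<^sub>2" "s \<otimes> y [^] N \<in> D (Suc N)"
      unfolding saturation_def by blast
    then have "y [^] N \<in> D (Suc N)" using Dsat[OF s(1) _ _ s(3)] P yc by auto
    then obtain t where t: "t \<in> carrier R" "t \<notin> P\<^sub>1" "t \<otimes> y [^] N \<in> Idl (insert (y [^] Suc N) P\<^sub>0)"
      unfolding D_def saturation_def by blast
    then obtain j a where a: "j \<in> P\<^sub>0" "a \<in> carrier R" "t \<otimes> y [^] N = j \<oplus> a \<otimes> y [^] Suc N"
      using Idl_insert_iff[OF i(1), of "y [^] Suc N"] yc by auto
    have jc: "j \<in> carrier R" using a ideal_carr[OF i(1)] by blast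
    have yN: "y [^] N \<in> carrier R" using yc by simp
    have "(t \<ominus> a \<otimes> y) \<otimes> y [^] N = t \<otimes> y [^] N \<ominus> a \<otimes> (y [^] N \<otimes> y)" using t(1) a(2) yc yN by algebra
    also have "\<dots> = j" unfolding a(3) using jc a(2) yc yN by (simp, algebra)
    finally have "(t \<ominus> a \<otimes> y) \<otimes> y [^] N \<in> P\<^sub>0" using a(1) by simp
    then have "t \<ominus> a \<otimes> y \<in> P\<^sub>0"
      using prime_in_iff[OF P(1)] prime_pow[OF P(1) yc] y(2) t a yc by auto
    then have "t \<ominus> a \<otimes> y \<oplus> a \<otimes> y \<in> P\<^sub>1"
      using y(1) a P by (intro ideal_add[OF i(2)] ideal_lmult[OF i(2)]) auto
    moreover have "t \<ominus> a \<otimes> y \<oplus> a \<otimes> y = t" using t(1) a(2) yc by algebra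
    ultimately show thesis using t(2) by simp
  qed
qed

end

section \<open>Chains of primes and Krull's height theorem\<close>

lemma prime_chain_less:
  assumes "prime_chain R n q" "i < j" "j \<le> n"
  shows "q i \<subset> q j"
  using assms(2,3)
proof (induction j)
  case (Suc j)
  have "q j \<subset> q (Suc j)" using assms(1) Suc unfolding prime_chain_def by simp
  moreover have "i = j \<or> q i \<subset> q j" using Suc by (cases "i = j") auto
  ultimately show ?case by blast
qed simp

text \<open>For prime \<open>M\<close> this says that the localization of R/J at \<open>M\<close>
  has dimension at least \<open>n\<close>. Expressed by chains in R, it needs neither the quotient
  nor the localization.\<close>

definition chain_between :: "('a, 'b) ring_scheme \<Rightarrow> 'a set \<Rightarrow> nat \<Rightarrow> 'a set \<Rightarrow> bool" where
  "chain_between R J n M \<longleftrightarrow> (\<exists>q. prime_chain R n q \<and> J \<subseteq> q 0 \<and> q n = M)"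

lemma chain_between_Suc_proper:
  assumes "chain_between R J (Suc n) M"
  obtains P where "primeideal P R" "J \<subseteq> P" "P \<subset> M"
  using assms prime_chain_less[of R "Suc n" _ 0 "Suc n"]
  unfolding chain_between_def prime_chain_def by (metis le0 lessI order_refl zero_less_Suc)

context noetherian_cring
begin

text \<open>One application of \<open>krull_principal_ideal\<close> to the three top members moves
  \<open>x\<close> one place down the chain. At the bottom the smallest member is dropped, which is
  the only loss of length.\<close>

lemma chain_through:
  assumes "prime_chain R (Suc n) q" "x \<in> q (Suc n)"
  shows "\<exists>q'. prime_chain R n q' \<and> q' n = q (Suc n) \<and> insert x (q 0) \<subseteq> q' 0"
  using assms
proof (induction n arbitrary: q)
  case 0
  then show ?case by (intro exI[of _ "\<lambda>_. q (Suc 0)"]) (auto simp: prime_chain_def)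
next
  case (Suc n)
  have q: "primeideal (q n) R" "primeideal (q (Suc n)) R" "primeideal (q (Suc (Suc n))) R"
    "q n \<subset> q (Suc n)" "q (Suc n) \<subset> q (Suc (Suc n))"
    using Suc.prems(1) unfolding prime_chain_def by auto
  obtain P where P: "primeideal P R" "x \<in> P" "q n \<subset> P" "P \<subset> q (Suc (Suc n))"
    by (rule krull_principal_ideal[OF q Suc.prems(2)])
  have "prime_chain R (Suc n) (q(Suc n := P))"
    using Suc.prems(1) P unfolding prime_chain_def by (auto simp: less_Suc_eq)
  from Suc.IH[OF this] obtain q' where q': "prime_chain R n q'" "q' n = P" "insert x (q 0) \<subseteq> q' 0"
    using P(2) by auto
  define r where "r = q'(Suc n := q (Suc (Suc n)))"
  have "prime_chain R (Suc n) r"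
    using q' P q unfolding r_def prime_chain_def by (auto simp: less_Suc_eq le_Suc_eq)
  moreover have "r (Suc n) = q (Suc (Suc n))" "insert x (q 0) \<subseteq> r 0" using q'(3) unfolding r_def by auto
  ultimately show ?case by blast
qed

lemma chain_between_insert:
  assumes "chain_between R J (Suc n) M" "x \<in> M"
  shows "chain_between R (Idl (insert x J)) n M"
proof -
  obtain q where q: "prime_chain R (Suc n) q" "J \<subseteq> q 0" "q (Suc n) = M"
    using assms(1) unfolding chain_between_def by blast
  then obtain q' where q': "prime_chain R n q'" "q' n = M" "insert x (q 0) \<subseteq> q' 0"
    using chain_through[OF q(1), of x] assms(2) by blast
  have "ideal (q' 0) R" using q'(1) primeideal.axioms(1) unfolding prime_chain_def by blast
  then have "Idl (insert x J) \<subseteq> q' 0" using q' q by (intro genideal_minimal) auto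
  then show ?thesis using q' unfolding chain_between_def by blast
qed

lemma chain_between_Un:
  assumes "finite Y" "J \<subseteq> carrier R" "Y \<subseteq> M" "M \<subseteq> carrier R" "chain_between R J (card Y + n) M"
  shows "chain_between R (Idl (J \<union> Y)) n M"
  using assms(1,3,5)
proof (induction Y arbitrary: n rule: finite_induct)
  case empty
  then obtain q where q: "prime_chain R n q" "J \<subseteq> q 0" "q n = M" unfolding chain_between_def by auto
  then have "ideal (q 0) R" using primeideal.axioms(1) unfolding prime_chain_def by blast
  then have "Idl J \<subseteq> q 0" using q by (intro genideal_minimal)
  then show ?case using q unfolding chain_between_def by auto
next
  case (insert x Y)
  have "chain_between R (Idl (J \<union> Y)) (Suc n) M"
    using insert by (intro insert.IH) auto
  then have "chain_between R (Idl (insert x (Idl (J \<union> Y)))) n M"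
    using insert by (intro chain_between_insert) auto
  moreover have "Idl (insert x (Idl (J \<union> Y))) = Idl (insert x (J \<union> Y))"
    using insert assms by (intro Idl_insert_Idl) auto
  ultimately show ?case by simp
qed

text \<open>Adjoining the elements of \<open>Y\<close> to \<open>J\<close> one by one costs at most
  one step of the chain each. With a longer chain a strict step would remain between a prime over
  \<open>M\<close> and \<open>M\<close> itself.\<close>

lemma krull_height:
  assumes "finite Y" "J \<subseteq> carrier R" "Y \<subseteq> carrier R" "M = Idl (J \<union> Y)" "chain_between R J n M"
  shows "n \<le> card Y"
proof (rule ccontr)
  assume "\<not> n \<le> card Y"
  then obtain k where k: "n = card Y + Suc k" using less_imp_Suc_add[of "card Y" n] by auto
  have JY: "J \<union> Y \<subseteq> carrier R" using assms by auto
  have "chain_between R M (Suc k) M" unfolding assms(4)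
    using assms k genideal_self[OF JY] ideal_sub[OF genideal_ideal[OF JY]]
    by (intro chain_between_Un) auto
  then show False by (rule chain_between_Suc_proper) blast
qed

end

section \<open>Local rings and regular systems of parameters\<close>

locale noetherian_local = noetherian_cring +
  fixes \<mm>
  assumes local: "local_ring R \<mm>"
begin

lemma maximal: "maximalideal \<mm> R"
  using local unfolding local_ring_def by blast

lemma prime_max: "primeideal \<mm> R"
  by (rule maximalideal_prime[OF maximal])

lemma ideal_max: "ideal \<mm> R"
  using prime_max primeideal.axioms(1) by blast

lemma proper_subset_max:
  assumes I: "ideal I R" "I \<noteq> carrier R"
  shows "I \<subseteq> \<mm>"
proof -
  have "{J. ideal J R \<and> I \<subseteq> J \<and> J \<noteq> carrier R} \<noteq> {}" using I by blast
  then obtain M where M: "ideal M R" "I \<subseteq> M" "M \<noteq> carrier R"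
    and mx: "\<And>J. ideal J R \<Longrightarrow> I \<subseteq> J \<Longrightarrow> J \<noteq> carrier R \<Longrightarrow> M \<subseteq> J \<Longrightarrow> J = M"
    by (rule exists_maximal_member) auto
  have "maximalideal M R"
    using M mx by (intro maximalidealI) (auto, metis subset_trans subsetD)
  then have "M = \<mm>" using local unfolding local_ring_def by blast
  then show ?thesis using M by blast
qed

lemma unit_if_notin_max:
  assumes "u \<in> carrier R" "u \<notin> \<mm>"
  shows "u \<in> Units R"
proof -
  have i: "ideal (PIdl u) R" "u \<in> PIdl u" using assms cgenideal_ideal cgenideal_self by auto
  then have "PIdl u = carrier R" using proper_subset_max assms by blast
  then have "\<one> \<in> PIdl u" by simp
  then obtain v where "v \<in> carrier R" "v \<otimes> u = \<one>" unfolding cgenideal_def by auto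
  then show ?thesis using assms m_comm[of u v] unfolding Units_def by auto
qed

lemma saturation_max:
  assumes I: "ideal I R"
  shows "saturation \<mm> I = I"
proof
  show "saturation \<mm> I \<subseteq> I"
  proof
    fix z assume "z \<in> saturation \<mm> I"
    then obtain s where s: "s \<in> carrier R" "s \<notin> \<mm>" "s \<otimes> z \<in> I" "z \<in> carrier R"
      unfolding saturation_def by blast
    then have u: "s \<in> Units R" using unit_if_notin_max by blast
    have "z = inv s \<otimes> (s \<otimes> z)" using u s by (simp add: m_assoc[symmetric])
    then show "z \<in> I" using ideal_lmult[OF I s(3), of "inv s"] u by simp
  qed
qed (rule saturation_superset[OF prime_max I])

lemma local_nakayama:
  assumes x: "x \<in> \<mm>" and N: "ideal N R" and J: "ideal J R"
    and h: "\<And>z. z \<in> N \<Longrightarrow> \<exists>j\<in>J. \<exists>w\<in>N. z = j \<oplus> x \<otimes> w"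
  shows "N \<subseteq> J"
proof -
  have "N \<subseteq> saturation \<mm> J"
  proof (rule nakayama[OF prime_max x N J])
    fix z assume z: "z \<in> N"
    then have "\<one> \<otimes> z = z" using ideal_carr[OF N] by simp
    then show "\<exists>s\<in>carrier R - \<mm>. \<exists>n\<in>J. \<exists>w\<in>N. s \<otimes> z = n \<oplus> x \<otimes> w"
      using h[OF z] prime_one[OF prime_max] by (metis DiffI one_closed)
  qed
  then show ?thesis using saturation_max[OF J] by simp
qed

text \<open>Since \<open>x\<close> is not in \<open>Q\<close>, the multiple of \<open>x\<close> in
  an expansion j + a x of an element of \<open>Q\<close> has its coefficient \<open>a\<close> in
  \<open>Q\<close>. Hence Q = J + x Q, and Nakayama's lemma applies.\<close>

lemma prime_below_principal:
  assumes J: "ideal J R" and Q: "primeideal Q R" and JQ: "J \<subseteq> Q" "Q \<subseteq> Idl (insert x J)"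
    and x: "x \<in> \<mm>" "x \<notin> Q"
  shows "Q = J"
proof -
  have xc: "x \<in> carrier R" using x ideal_carr[OF ideal_max] by blast
  have Qi: "ideal Q R" using Q primeideal.axioms(1) by blast
  have "Q \<subseteq> J"
  proof (rule local_nakayama[OF x(1) Qi J])
    fix z assume z: "z \<in> Q"
    then obtain j a where a: "j \<in> J" "a \<in> carrier R" "z = j \<oplus> a \<otimes> x"
      using JQ Idl_insert_iff[OF J xc] by blast
    have jc: "j \<in> carrier R" using a ideal_carr[OF J] by blast
    have "a \<otimes> x = z \<ominus> j" unfolding a(3) using a jc xc by algebra
    moreover have "z \<ominus> j \<in> Q" using ideal_diff[OF Qi z] a(1) JQ(1) by blast
    ultimately have "a \<otimes> x \<in> Q" by simp
    then have "a \<in> Q" using prime_in_iff[OF Q a(2) xc] x by blast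
    then show "\<exists>j\<in>J. \<exists>w\<in>Q. z = j \<oplus> x \<otimes> w" using a xc m_comm[of a x] by auto
  qed
  then show ?thesis using JQ by blast
qed

text \<open>If none of the prime ideals \<open>J + (x + y\<^sup>n\<^sup>+\<^sup>1)\<close> strictly contains a prime ideal over \<open>J\<close>, then they
  are minimal over \<open>J\<close>, so two of them agree; they then contain both \<open>x\<close> and \<open>y\<close>,
  against the bound on lengths of chains.\<close>

lemma prime_if_chain:
  assumes "ideal J R" "finite Y" "Y \<subseteq> carrier R" "\<mm> = Idl (J \<union> Y)" "chain_between R J (card Y) \<mm>"
  shows "primeideal J R"
  using assms
proof (induction "card Y" arbitrary: J Y rule: less_induct)
  case less
  note J = less.prems(1) and Yf = less.prems(2) and Yc = less.prems(3) and m = less.prems(4)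
    and ch = less.prems(5)
  have JYc: "J \<union> Y \<subseteq> carrier R" using ideal_sub[OF J] Yc by blast
  then have Jm: "J \<subseteq> \<mm>" and Ym: "Y \<subseteq> \<mm>" using genideal_self[OF JYc] m by auto
  consider "Y = {}" | x where "Y = {x}" | x y where "x \<in> Y" "y \<in> Y" "x \<noteq> y" by blast
  then show ?case
  proof cases
    case 1
    then show ?thesis using m Idl_ideal[OF J] prime_max by simp
  next
    case (2 x)
    obtain P where P: "primeideal P R" "J \<subseteq> P" "P \<subset> \<mm>"
      using chain_between_Suc_proper[of R J 0 \<mm>] ch 2 by auto
    have Pi: "ideal P R" using P primeideal.axioms(1) by blast
    have m': "\<mm> = Idl (insert x J)" using m 2 by simp
    have "x \<notin> P" using genideal_minimal[OF Pi, of "insert x J"] P m' by blast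
    then have "P = J" using P m' 2 Ym by (intro prime_below_principal[OF J]) auto
    then show ?thesis using P by simp
  next
    case (3 x y)
    define Z where "Z = Y - {x, y}"
    have Y: "Y = insert x (insert y Z)" and Zf: "finite Z" using 3 Yf unfolding Z_def by auto
    have cY: "card Y = Suc (Suc (card Z))"
      unfolding Y using 3(3) Zf by (simp add: card_insert_if) (simp add: Z_def)
    have xc: "x \<in> carrier R" and yc: "y \<in> carrier R" and Zc: "Z \<subseteq> carrier R" using Y Yc by auto
    have xm: "x \<in> \<mm>" and ym: "y \<in> \<mm>" using Y Ym by auto
    define u where "u = (\<lambda>n::nat. x \<oplus> y [^] Suc n)"
    have uc: "u n \<in> carrier R" for n unfolding u_def using xc yc by simp
    have um: "u n \<in> \<mm>" for n unfolding u_def using xm ym yc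
      by (auto intro!: ideal_add[OF ideal_max] ideal_lmult[OF ideal_max])
    define L where "L = (\<lambda>n. Idl (insert (u n) J))"
    have Lc: "insert (u n) J \<subseteq> carrier R" for n using uc ideal_sub[OF J] by blast
    have Li: "ideal (L n) R" for n unfolding L_def by (rule genideal_ideal[OF Lc])
    have Ls: "insert (u n) J \<subseteq> L n" for n unfolding L_def by (rule genideal_self[OF Lc])
    have Lm: "L n \<subseteq> \<mm>" for n unfolding L_def using um Jm by (intro genideal_minimal[OF ideal_max]) auto
    have gen: "\<mm> = Idl (L n \<union> insert y Z)" for n
    proof
      have c: "L n \<union> insert y Z \<subseteq> carrier R" using ideal_sub[OF Li] yc Zc by blast
      note i = genideal_ideal[OF c] and s = genideal_self[OF c]
      have "y [^] Suc n \<in> Idl (L n \<union> insert y Z)" using s yc ideal_lmult[OF i] by simp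
      moreover have "u n \<in> Idl (L n \<union> insert y Z)" using s Ls by blast
      ultimately have "u n \<ominus> y [^] Suc n \<in> Idl (L n \<union> insert y Z)" by (rule ideal_diff[OF i, rotated])
      moreover have "u n \<ominus> y [^] Suc n = x" unfolding u_def
        using xc nat_pow_closed[OF yc, of "Suc n"] by algebra
      ultimately show "\<mm> \<subseteq> Idl (L n \<union> insert y Z)"
        unfolding m Y using s Ls[of n] by (intro genideal_minimal[OF i]) auto
      show "Idl (L n \<union> insert y Z) \<subseteq> \<mm>"
        using Lm Ym Y by (intro genideal_minimal[OF ideal_max]) auto
    qed
    have cyZ: "card (insert y Z) = Suc (card Z)" using Zf unfolding Z_def by simp
    have chL: "chain_between R (L n) (Suc (card Z)) \<mm>" for n
      unfolding L_def using ch um unfolding cY by (intro chain_between_insert)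
    have Lp: "primeideal (L n) R" for n
      using less.hyps[of "insert y Z" "L n"] cyZ cY Li Zf yc Zc gen chL by auto
    show ?thesis
    proof (cases "\<forall>n. minimal_prime J (L n)")
      case False
      then obtain n Q where Q: "primeideal Q R" "J \<subseteq> Q" "Q \<subseteq> L n" "Q \<noteq> L n"
        using Lp Ls unfolding minimal_prime_def by blast
      have "u n \<notin> Q"
      proof
        assume "u n \<in> Q"
        then have "L n \<subseteq> Q" unfolding L_def using Q primeideal.axioms(1)
          by (intro genideal_minimal) auto
        then show False using Q by blast
      qed
      then have "Q = J" using Q um unfolding L_def by (intro prime_below_principal[OF J]) auto
      then show ?thesis using Q by simp
    next
      case True
      obtain F where F: "finite F" "\<And>P. P \<in> F \<Longrightarrow> primeideal P R \<and> J \<subseteq> P"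
        "\<And>Q. primeideal Q R \<Longrightarrow> J \<subseteq> Q \<Longrightarrow> \<exists>P\<in>F. P \<subseteq> Q" by (rule finite_primes_below[OF J]) blast
      have "L n \<in> F" for n
      proof -
        obtain P where P: "P \<in> F" "P \<subseteq> L n" using F(3)[OF Lp] Ls by blast
        then have "P = L n" using True F(2)[OF P(1)] unfolding minimal_prime_def by blast
        then show ?thesis using P by simp
      qed
      then have "range L \<subseteq> F" by blast
      then have "\<not> inj L" using F(1) finite_subset[of "range L" F] finite_imageD[of L UNIV] by auto
      then obtain a b where ab: "a < b" "L a = L b" unfolding inj_def by (metis linorder_neqE_nat)
      define k where "k = b - Suc a"
      have b: "Suc b = Suc a + Suc k" using ab unfolding k_def by simp
      have "u a \<ominus> u b \<in> L a" using Ls ab by (intro ideal_diff[OF Li]) auto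
      have ya: "y [^] Suc a \<in> carrier R" "y [^] Suc k \<in> carrier R" using yc by auto
      \<comment> \<open>The second factor lies outside \<open>\<mm>\<close>, so the prime
        \<open>L a\<close> contains a power of \<open>y\<close>, hence \<open>y\<close>, which can
        then be dropped from the generators of \<open>\<mm>\<close> over \<open>L a\<close>.\<close>
      have "u a \<ominus> u b = y [^] Suc a \<otimes> (\<one> \<ominus> y [^] Suc k)"
        unfolding u_def b nat_pow_mult[OF yc, symmetric] using xc ya by algebra
      then have in_La: "y [^] Suc a \<otimes> (\<one> \<ominus> y [^] Suc k) \<in> L a" using \<open>u a \<ominus> u b \<in> L a\<close> by simp
      have "\<one> \<ominus> y [^] Suc k \<notin> \<mm>"
      proof
        assume h: "\<one> \<ominus> y [^] Suc k \<in> \<mm>"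
        have "y [^] Suc k \<in> \<mm>" using ym yc ideal_lmult[OF ideal_max] by simp
        then have "\<one> \<ominus> y [^] Suc k \<oplus> y [^] Suc k \<in> \<mm>" using h ideal_add[OF ideal_max] by blast
        moreover have "\<one> \<ominus> y [^] Suc k \<oplus> y [^] Suc k = \<one>" using ya by algebra
        ultimately show False using prime_one[OF prime_max] by simp
      qed
      then have "\<one> \<ominus> y [^] Suc k \<notin> L a" using Lm by blast
      then have "y [^] Suc a \<in> L a"
        using in_La prime_in_iff[OF Lp ya(1), of "\<one> \<ominus> y [^] Suc k"] ya by auto
      then have yL: "y \<in> L a" using prime_pow[OF Lp yc] by blast
      have "L a \<union> insert y Z = L a \<union> Z" using yL by blast
      then have "\<mm> = Idl (L a \<union> Z)" using gen[of a] by simp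
      then have "Suc (card Z) \<le> card Z"
        using chL[of a] Zf Zc ideal_sub[OF Li] by (intro krull_height) auto
      then show ?thesis by simp
    qed
  qed
qed

text \<open>Passing to \<open>Idl T\<close> costs at most one step of the chain for each element of
  \<open>T\<close>. As many steps are left as there are generators left in \<open>Y - T\<close>,
  which is the situation of \<open>prime_if_chain\<close>.\<close>

lemma regular_subset_prime:
  assumes Y: "finite Y" "Y \<subseteq> carrier R" "\<mm> = Idl Y" "chain_between R {} (card Y) \<mm>" and T: "T \<subseteq> Y"
  shows "primeideal (Idl T) R"
proof -
  have fT: "finite T" "finite (Y - T)" using Y T finite_subset by auto
  have card: "card Y = card T + card (Y - T)"
    using Y(1) T by (metis card_Diff_subset card_mono fT(1) le_add_diff_inverse)
  have Tc: "T \<subseteq> carrier R" and Ym: "Y \<subseteq> \<mm>" using Y T genideal_self[OF Y(2)] by auto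
  have gen: "\<mm> = Idl (Idl T \<union> (Y - T))"
    using Idl_Un_Idl[of T "Y - T"] Y T by (auto simp: Un_absorb1)
  have "chain_between R (Idl ({} \<union> T)) (card (Y - T)) \<mm>"
    using Y T card Ym ideal_sub[OF ideal_max] fT by (intro chain_between_Un) auto
  then show ?thesis
    using gen Y fT genideal_ideal[OF Tc] by (intro prime_if_chain[of "Idl T" "Y - T"]) auto
qed

text \<open>Otherwise \<open>x\<close> could be omitted, and over \<open>Idl T\<close> the maximal
  ideal would have fewer generators than the length of a chain that is still available.\<close>

lemma regular_notin:
  assumes Y: "finite Y" "Y \<subseteq> carrier R" "\<mm> = Idl Y" "chain_between R {} (card Y) \<mm>"
    and T: "T \<subseteq> Y" "x \<in> Y" "x \<notin> T"
  shows "x \<notin> Idl T"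
proof
  assume x: "x \<in> Idl T"
  let ?Z = "Y - T - {x}"
  have fT: "finite T" "finite ?Z" using Y T finite_subset by auto
  have "Y = T \<union> insert x ?Z" "T \<inter> insert x ?Z = {}" using T by auto
  then have card: "card Y = card T + Suc (card ?Z)"
    using card_Un_disjoint[of T "insert x ?Z"] card_insert_disjoint[of ?Z x] fT by simp
  have Tc: "T \<subseteq> carrier R" and Ym: "Y \<subseteq> \<mm>" using Y T genideal_self[OF Y(2)] by auto
  have ch: "chain_between R (Idl ({} \<union> T)) (Suc (card ?Z)) \<mm>"
    using Y T card Ym ideal_sub[OF ideal_max] fT by (intro chain_between_Un) auto
  have e: "Idl T \<union> insert x ?Z = Idl T \<union> ?Z" using x by blast
  have "T \<union> insert x ?Z = Y" using T by auto
  then have "\<mm> = Idl (Idl T \<union> ?Z)"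
    using Idl_Un_Idl[of T "insert x ?Z"] Y(2,3) Tc T unfolding e by auto
  then have "Suc (card ?Z) \<le> card ?Z"
    using ch fT Y ideal_sub[OF genideal_ideal[OF Tc]] by (intro krull_height[of ?Z "Idl T" \<mm>]) auto
  then show False by simp
qed

end

section \<open>The Frobenius endomorphism\<close>

context cring
begin

lemma binomial_ring:
  assumes a: "a \<in> carrier R" and b: "b \<in> carrier R"
  shows "(a \<oplus> b) [^] (n::nat) = (\<Oplus>k\<in>{..n}. [(n choose k)] \<cdot> (a [^] k \<otimes> b [^] (n - k)))"
proof (induction n)
  case 0
  then show ?case using a b by simp
next
  case (Suc n)
  let ?f = "\<lambda>n k. [(n choose k)] \<cdot> (a [^] k \<otimes> b [^] (n - k))"
  let ?g = "\<lambda>k. [(n choose k)] \<cdot> (a [^] k \<otimes> b [^] (Suc n - k))"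
  have fc: "?f n k \<in> carrier R" for n k using a b by simp
  have gc: "?g k \<in> carrier R" for k using a b by simp
  have A: "a \<otimes> (\<Oplus>k\<in>{..n}. ?f n k) = (\<Oplus>k\<in>{..n}. [(n choose k)] \<cdot> (a [^] Suc k \<otimes> b [^] (n - k)))"
  proof -
    have "a \<otimes> (\<Oplus>k\<in>{..n}. ?f n k) = (\<Oplus>k\<in>{..n}. a \<otimes> ?f n k)"
      using a b by (intro finsum_rdistr) auto
    also have "\<dots> = (\<Oplus>k\<in>{..n}. [(n choose k)] \<cdot> (a [^] Suc k \<otimes> b [^] (n - k)))"
      using a b by (intro finsum_cong') (auto simp: add_pow_rdistr m_ac)
    finally show ?thesis .
  qed
  have B: "b \<otimes> (\<Oplus>k\<in>{..n}. ?f n k) = (\<Oplus>k\<in>{..n}. ?g k)"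
  proof -
    have "b \<otimes> (\<Oplus>k\<in>{..n}. ?f n k) = (\<Oplus>k\<in>{..n}. b \<otimes> ?f n k)"
      using a b by (intro finsum_rdistr) auto
    also have "\<dots> = (\<Oplus>k\<in>{..n}. ?g k)"
      using a b by (intro finsum_cong') (auto simp: add_pow_rdistr m_ac Suc_diff_le)
    finally show ?thesis .
  qed
  have C: "(\<Oplus>k\<in>{..n}. ?g k) = (\<Oplus>k\<in>{..n}. ?g (Suc k)) \<oplus> b [^] Suc n"
  proof -
    have "(\<Oplus>k\<in>{..Suc n}. ?g k) = ?g (Suc n) \<oplus> (\<Oplus>k\<in>{..n}. ?g k)"
      using gc by (intro finsum_Suc) auto
    also have "?g (Suc n) = \<zero>" by (simp add: binomial_eq_0)
    finally have "(\<Oplus>k\<in>{..Suc n}. ?g k) = (\<Oplus>k\<in>{..n}. ?g k)" using gc by simp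
    moreover have "(\<Oplus>k\<in>{..Suc n}. ?g k) = (\<Oplus>k\<in>{..n}. ?g (Suc k)) \<oplus> ?g 0"
      using gc by (intro finsum_Suc2) auto
    ultimately show ?thesis using b by simp
  qed
  have "(\<Oplus>k\<in>{..Suc n}. ?f (Suc n) k) = (\<Oplus>k\<in>{..n}. ?f (Suc n) (Suc k)) \<oplus> ?f (Suc n) 0"
    using fc by (intro finsum_Suc2) auto
  also have "(\<Oplus>k\<in>{..n}. ?f (Suc n) (Suc k)) =
      (\<Oplus>k\<in>{..n}. [(n choose k)] \<cdot> (a [^] Suc k \<otimes> b [^] (n - k)) \<oplus> ?g (Suc k))"
    using a b by (intro finsum_cong') (auto simp: add.nat_pow_mult)
  also have "\<dots> = (\<Oplus>k\<in>{..n}. [(n choose k)] \<cdot> (a [^] Suc k \<otimes> b [^] (n - k))) \<oplus> (\<Oplus>k\<in>{..n}. ?g (Suc k))"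
    using a b by (intro finsum_addf) auto
  also have "\<dots> \<oplus> ?f (Suc n) 0 = a \<otimes> (\<Oplus>k\<in>{..n}. ?f n k) \<oplus> b \<otimes> (\<Oplus>k\<in>{..n}. ?f n k)"
    unfolding A B C using a b by (simp add: a_assoc)
  also have "\<dots> = (a \<oplus> b) [^] Suc n"
    using a b Suc fc by (simp add: l_distr[symmetric] m_comm)
  finally show ?case by simp
qed

definition nonzerodivisor_mod :: "'a set \<Rightarrow> 'a \<Rightarrow> bool" where
  "nonzerodivisor_mod J w \<longleftrightarrow> (\<forall>z\<in>carrier R. w \<otimes> z \<in> J \<longrightarrow> z \<in> J)"

lemma nonzerodivisor_modD:
  "nonzerodivisor_mod J w \<Longrightarrow> z \<in> carrier R \<Longrightarrow> w \<otimes> z \<in> J \<Longrightarrow> z \<in> J"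
  unfolding nonzerodivisor_mod_def by blast

text \<open>If w z is in J + (x^(n+1)), then z = i + v x with \<open>i\<close> in \<open>J\<close>,
  because \<open>w\<close> is a nonzerodivisor modulo J + (x). Cancelling one factor
  \<open>x\<close> modulo \<open>J\<close> leaves w v in J + (x^n), to which the induction
  hypothesis applies.\<close>

lemma nonzerodivisor_mod_power:
  assumes J: "ideal J R" and x: "x \<in> carrier R" and w: "w \<in> carrier R"
    and nx: "nonzerodivisor_mod J x" and nw: "nonzerodivisor_mod (Idl (insert x J)) w"
  shows "nonzerodivisor_mod (Idl (insert (x [^] (n::nat)) J)) w"
proof (induction n)
  case 0
  have "\<one> \<in> Idl (insert \<one> J)" using genideal_self[of "insert \<one> J"] ideal_sub[OF J] by auto
  then have "Idl (insert \<one> J) = carrier R"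
    using ideal.one_imp_carrier[OF genideal_ideal[of "insert \<one> J"]] ideal_sub[OF J] by auto
  then show ?case by (simp add: nonzerodivisor_mod_def)
next
  case (Suc n)
  note iff = Idl_insert_iff[OF J]
  have xn: "x [^] n \<in> carrier R" "x [^] Suc n \<in> carrier R" using x by auto
  show ?case unfolding nonzerodivisor_mod_def
  proof (intro ballI impI)
    fix z assume z: "z \<in> carrier R" and "w \<otimes> z \<in> Idl (insert (x [^] Suc n) J)"
    then obtain j c where h: "j \<in> J" "c \<in> carrier R" "w \<otimes> z = j \<oplus> c \<otimes> x [^] Suc n"
      unfolding iff[OF xn(2)] by blast
    have jc: "j \<in> carrier R" using h ideal_carr[OF J] by blast
    have "w \<otimes> z = j \<oplus> (c \<otimes> x [^] n) \<otimes> x" unfolding h(3) using h(2) x by (simp add: m_assoc)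
    then have "w \<otimes> z \<in> Idl (insert x J)" unfolding iff[OF x] using h x by blast
    then have "z \<in> Idl (insert x J)" using nonzerodivisor_modD[OF nw z] by blast
    then obtain i v where v: "i \<in> J" "v \<in> carrier R" "z = i \<oplus> v \<otimes> x" unfolding iff[OF x] by blast
    have ic: "i \<in> carrier R" using v ideal_carr[OF J] by blast
    have "x \<otimes> (w \<otimes> v \<ominus> c \<otimes> x [^] n) = (w \<otimes> z \<ominus> c \<otimes> (x [^] n \<otimes> x)) \<ominus> w \<otimes> i"
      unfolding v(3) using x w v(2) ic h(2) xn(1) by algebra
    also have "\<dots> = j \<ominus> w \<otimes> i"
      unfolding h(3) using x w ic h(2) xn(1) jc by (simp, algebra)
    also have "\<dots> \<in> J" using h v w by (intro ideal_diff[OF J] ideal_lmult[OF J])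
    finally have "w \<otimes> v \<ominus> c \<otimes> x [^] n \<in> J" using nonzerodivisor_modD[OF nx] x w v h by auto
    moreover have "w \<otimes> v = (w \<otimes> v \<ominus> c \<otimes> x [^] n) \<oplus> c \<otimes> x [^] n"
      using w v(2) h(2) xn(1) by algebra
    ultimately have "w \<otimes> v \<in> Idl (insert (x [^] n) J)" unfolding iff[OF xn(1)] using h(2) by blast
    then have "v \<in> Idl (insert (x [^] n) J)" using nonzerodivisor_modD[OF Suc.IH v(2)] by blast
    then obtain k d where k: "k \<in> J" "d \<in> carrier R" "v = k \<oplus> d \<otimes> x [^] n" unfolding iff[OF xn(1)] by blast
    have kc: "k \<in> carrier R" using k ideal_carr[OF J] by blast
    have "z = (i \<oplus> k \<otimes> x) \<oplus> d \<otimes> x [^] Suc n"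
      unfolding v(3) k(3) using ic kc k(2) x xn(1) by (simp, algebra)
    moreover have "i \<oplus> k \<otimes> x \<in> J" using v k x by (intro ideal_add[OF J] ideal_rmult[OF J])
    ultimately show "z \<in> Idl (insert (x [^] Suc n) J)" unfolding iff[OF xn(2)] using k(2) by blast
  qed
qed

lemma nonzerodivisor_mod_pow:
  assumes x: "x \<in> carrier R" and nx: "nonzerodivisor_mod J x"
  shows "nonzerodivisor_mod J (x [^] (n::nat))"
proof (induction n)
  case (Suc n)
  show ?case unfolding nonzerodivisor_mod_def
  proof (intro ballI impI)
    fix z assume z: "z \<in> carrier R" "x [^] Suc n \<otimes> z \<in> J"
    then have "x \<otimes> (x [^] n \<otimes> z) \<in> J" using x by (simp add: m_ac)
    then have "x [^] n \<otimes> z \<in> J" using nonzerodivisor_modD[OF nx] x z by simp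
    then show "z \<in> J" using nonzerodivisor_modD[OF Suc z(1)] by blast
  qed
qed (auto simp: nonzerodivisor_mod_def)

end

text \<open>Only p 1 = 0 is asked of the characteristic, a condition that passes to localizations
  through the ring homomorphism.\<close>

locale frobenius_ring = cring +
  fixes p :: nat
  assumes prime_p: "Factorial_Ring.prime p" and char_p: "[p] \<cdot> \<one> = \<zero>"
begin

lemma p_gt_1: "p > 1"
  using prime_p by (rule prime_gt_1_nat)

lemma p_multiple_zero:
  assumes "x \<in> carrier R" "p dvd n"
  shows "[n] \<cdot> x = \<zero>"
proof -
  obtain k where k: "n = p * k" using assms(2) by blast
  have "[p] \<cdot> x = ([p] \<cdot> \<one>) \<otimes> x" using assms(1) by (simp add: add_pow_ldistr)
  then have "[p] \<cdot> x = \<zero>" using char_p assms(1) by simp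
  then have "[k] \<cdot> ([p] \<cdot> x) = \<zero>" by simp
  then show ?thesis unfolding k using assms(1) by (simp add: add.nat_pow_pow mult.commute)
qed

lemma add_pow_p:
  assumes a: "a \<in> carrier R" and b: "b \<in> carrier R"
  shows "(a \<oplus> b) [^] p = a [^] p \<oplus> b [^] p"
proof -
  \<comment> \<open>With \<open>p\<close> written as \<open>Suc (Suc m)\<close> the two extreme
    terms of the binomial sum can be split off; the others have a binomial coefficient divisible by
    \<open>p\<close>.\<close>
  define m where "m = p - 2"
  have p: "p = Suc (Suc m)" using p_gt_1 unfolding m_def by simp
  let ?f = "\<lambda>k. [(p choose k)] \<cdot> (a [^] k \<otimes> b [^] (p - k))"
  have fc: "?f k \<in> carrier R" for k using a b by simp
  have z: "?f (Suc k) = \<zero>" if "k \<le> m" for k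
  proof (rule p_multiple_zero)
    show "p dvd (p choose Suc k)" using that p by (intro dvd_choose_prime prime_p) auto
  qed (use a b in simp)
  have "(\<Oplus>k\<in>{..Suc (Suc m)}. ?f k) = ?f (Suc (Suc m)) \<oplus> (\<Oplus>k\<in>{..Suc m}. ?f k)"
    using fc by (intro finsum_Suc) auto
  also have "(\<Oplus>k\<in>{..Suc m}. ?f k) = (\<Oplus>k\<in>{..m}. ?f (Suc k)) \<oplus> ?f 0"
    using fc by (intro finsum_Suc2) auto
  also have "(\<Oplus>k\<in>{..m}. ?f (Suc k)) = (\<Oplus>k\<in>{..m}. \<zero>)"
    using z by (intro finsum_cong') auto
  also have "\<dots> = \<zero>" by (rule finsum_zero)
  finally have "(\<Oplus>k\<in>{..p}. ?f k) = a [^] p \<oplus> b [^] p" unfolding p[symmetric] using a b by simp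
  then show ?thesis using binomial_ring[OF a b] by simp
qed

lemma zero_pow_p: "\<zero> [^] p = \<zero>"
  using p_gt_1 by (simp add: nat_pow_zero)

lemma minus_pow_p:
  assumes a: "a \<in> carrier R" and b: "b \<in> carrier R"
  shows "(a \<ominus> b) [^] p = a [^] p \<ominus> b [^] p"
proof -
  have "(a \<ominus> b) \<oplus> b = a" using a b by algebra
  then have "a [^] p = (a \<ominus> b) [^] p \<oplus> b [^] p" using add_pow_p[of "a \<ominus> b" b] a b by simp
  then show ?thesis using a b by (simp add: minus_eq a_assoc r_neg)
qed

lemma add_pow_q:
  assumes "a \<in> carrier R" "b \<in> carrier R"
  shows "(a \<oplus> b) [^] (p ^ e) = a [^] (p ^ e) \<oplus> b [^] (p ^ e)"
proof (induction e)
  case (Suc e)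
  then show ?case using assms add_pow_p by (simp add: nat_pow_pow[symmetric] mult.commute[of p])
qed (use assms in simp)

lemma pow_q_preimage_ideal:
  assumes J: "ideal J R"
  shows "ideal {a \<in> carrier R. a [^] (p ^ e) \<in> J} R"
proof (rule cring_idealI)
  have "p ^ e \<noteq> 0" using p_gt_1 by simp
  then show "\<zero> \<in> {a \<in> carrier R. a [^] (p ^ e) \<in> J}" using ideal_0[OF J] by (simp add: nat_pow_zero)
qed (use J in \<open>auto simp: add_pow_q nat_pow_distrib ideal_rules\<close>)

lemma frob_power_ideal:
  assumes "I \<subseteq> carrier R"
  shows "ideal (frob_power R I n) R"
  unfolding frob_power_def using assms by (intro genideal_ideal) auto

text \<open>By additivity of Frobenius the elements whose q-th power lies in a given ideal form an
  ideal themselves, so it suffices to look at the generators \<open>T\<close>.\<close>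

lemma frob_power_Idl:
  assumes T: "T \<subseteq> carrier R"
  shows "frob_power R (Idl T) (p ^ e) = Idl ((\<lambda>f. f [^] (p ^ e)) ` T)"
proof
  have c: "(\<lambda>f. f [^] (p ^ e)) ` T \<subseteq> carrier R" using T by auto
  note i = genideal_ideal[OF c] and s = genideal_self[OF c]
  have "Idl T \<subseteq> {a \<in> carrier R. a [^] (p ^ e) \<in> Idl ((\<lambda>f. f [^] (p ^ e)) ` T)}"
    using T s by (intro genideal_minimal[OF pow_q_preimage_ideal[OF i]]) auto
  then show "frob_power R (Idl T) (p ^ e) \<subseteq> Idl ((\<lambda>f. f [^] (p ^ e)) ` T)"
    unfolding frob_power_def by (intro genideal_minimal[OF i]) auto
  have "Idl T \<subseteq> carrier R" by (rule ideal_sub[OF genideal_ideal[OF T]])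
  then show "Idl ((\<lambda>f. f [^] (p ^ e)) ` T) \<subseteq> frob_power R (Idl T) (p ^ e)"
    unfolding frob_power_def using genideal_self[OF T] by (intro subset_Idl_subset) auto
qed

lemma frob_power_Suc:
  assumes I: "ideal I R"
  shows "frob_power R I (p ^ Suc e) = frob_power R (frob_power R I (p ^ e)) p"
proof -
  have c: "(\<lambda>f. f [^] (p ^ e)) ` I \<subseteq> carrier R" using ideal_sub[OF I] by auto
  have "frob_power R (frob_power R I (p ^ e)) (p ^ 1) = Idl ((\<lambda>f. f [^] (p ^ 1)) ` (\<lambda>f. f [^] (p ^ e)) ` I)"
    unfolding frob_power_def[of R I] by (rule frob_power_Idl[OF c])
  also have "(\<lambda>f. f [^] (p ^ 1)) ` (\<lambda>f. f [^] (p ^ e)) ` I = (\<lambda>f. f [^] (p ^ Suc e)) ` I"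
    unfolding image_image using ideal_carr[OF I] by (intro image_cong) (auto simp: nat_pow_pow mult.commute)
  finally show ?thesis unfolding frob_power_def by simp
qed

lemma frob_power_mono:
  assumes "I \<subseteq> J" "J \<subseteq> carrier R"
  shows "frob_power R I n \<subseteq> frob_power R J n"
  unfolding frob_power_def using assms by (intro subset_Idl_subset) auto

text \<open>The linear combination of \<open>B\<close> with coefficients \<open>c\<close> in the
  module \<open>frob_module R p\<close>, written with the operations of the ring alone.\<close>

definition frob_sum :: "'a set \<Rightarrow> ('a \<Rightarrow> 'a) \<Rightarrow> 'a" where
  "frob_sum B c = (\<Oplus>b\<in>B. c b [^] p \<otimes> b)"

lemma frob_sum_closed [simp]:
  "B \<subseteq> carrier R \<Longrightarrow> c \<in> B \<rightarrow> carrier R \<Longrightarrow> frob_sum B c \<in> carrier R"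
  unfolding frob_sum_def by (intro finsum_closed) auto

lemma frob_sum_cong:
  "B \<subseteq> carrier R \<Longrightarrow> d \<in> B \<rightarrow> carrier R \<Longrightarrow> (\<And>b. b \<in> B \<Longrightarrow> c b = d b) \<Longrightarrow> frob_sum B c = frob_sum B d"
  unfolding frob_sum_def by (intro finsum_cong') auto

lemma frob_sum_add:
  assumes "B \<subseteq> carrier R" "c \<in> B \<rightarrow> carrier R" "d \<in> B \<rightarrow> carrier R"
  shows "frob_sum B (\<lambda>b. c b \<oplus> d b) = frob_sum B c \<oplus> frob_sum B d"
proof -
  have "frob_sum B (\<lambda>b. c b \<oplus> d b) = (\<Oplus>b\<in>B. c b [^] p \<otimes> b \<oplus> d b [^] p \<otimes> b)"
    unfolding frob_sum_def using assms
    by (intro finsum_cong') (auto simp: add_pow_p l_distr Pi_iff subset_iff)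
  also have "\<dots> = frob_sum B c \<oplus> frob_sum B d"
    unfolding frob_sum_def using assms by (intro finsum_addf) (auto simp: Pi_iff subset_iff)
  finally show ?thesis .
qed

lemma frob_sum_smult:
  assumes "B \<subseteq> carrier R" "c \<in> B \<rightarrow> carrier R" "a \<in> carrier R" "finite B"
  shows "frob_sum B (\<lambda>b. a \<otimes> c b) = a [^] p \<otimes> frob_sum B c"
proof -
  have "a [^] p \<otimes> frob_sum B c = (\<Oplus>b\<in>B. a [^] p \<otimes> (c b [^] p \<otimes> b))"
    unfolding frob_sum_def using assms by (intro finsum_rdistr) auto
  also have "\<dots> = frob_sum B (\<lambda>b. a \<otimes> c b)"
    unfolding frob_sum_def using assms
    by (intro finsum_cong') (auto simp: nat_pow_distrib m_assoc Pi_iff subset_iff)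
  finally show ?thesis by simp
qed

lemma frob_sum_zero: "B \<subseteq> carrier R \<Longrightarrow> frob_sum B (\<lambda>_. \<zero>) = \<zero>"
  unfolding frob_sum_def using finsum_cong'[of B B "\<lambda>_. \<zero>" "\<lambda>b. \<zero> [^] p \<otimes> b"]
  by (auto simp: zero_pow_p finsum_zero subset_iff)

lemma frob_sum_in_ideal:
  assumes J: "ideal J R" and B: "finite B" "B \<subseteq> carrier R" and c: "\<And>b. b \<in> B \<Longrightarrow> c b \<in> carrier R \<and> c b [^] p \<in> J"
  shows "frob_sum B c \<in> J"
  using B c unfolding frob_sum_def
proof (induction B rule: finite_induct)
  case (insert b B)
  then have "(\<lambda>b. c b [^] p \<otimes> b) \<in> B \<rightarrow> carrier R" "c b [^] p \<otimes> b \<in> J"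
    by (auto intro: ideal_rmult[OF J])
  then show ?case using insert by (auto simp: ideal_add[OF J])
qed (simp add: ideal_0[OF J])

definition frob_generates :: "'a set \<Rightarrow> bool" where
  "frob_generates B \<longleftrightarrow> finite B \<and> B \<subseteq> carrier R \<and> (\<forall>x\<in>carrier R. \<exists>c\<in>B \<rightarrow> carrier R. x = frob_sum B c)"

text \<open>Inside the Frobenius module, the ideal generated by the p-th powers of \<open>I\<close>
  is \<open>I\<close> times the whole module. So its elements are combinations of any generating set
  with coefficients in \<open>I\<close>.\<close>

lemma frob_power_expansion:
  assumes B: "frob_generates B" and I: "ideal I R" and x: "x \<in> frob_power R I p"
  obtains d where "d \<in> B \<rightarrow> I" "x = frob_sum B d"
proof -
  have fB: "finite B" and Bc: "B \<subseteq> carrier R" using B unfolding frob_generates_def by auto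
  have Ic: "I \<subseteq> carrier R" by (rule ideal_sub[OF I])
  have dc: "d \<in> B \<rightarrow> I \<Longrightarrow> d \<in> B \<rightarrow> carrier R" for d using Ic by auto
  let ?S = "{frob_sum B d | d. d \<in> B \<rightarrow> I}"
  have S0: "\<zero> \<in> ?S" using frob_sum_zero[OF Bc] ideal_0[OF I] by (force intro!: exI[of _ "\<lambda>_. \<zero>"])
  have Sadd: "u \<oplus> v \<in> ?S" if "u \<in> ?S" "v \<in> ?S" for u v
  proof -
    obtain d e where "d \<in> B \<rightarrow> I" "u = frob_sum B d" "e \<in> B \<rightarrow> I" "v = frob_sum B e"
      using \<open>u \<in> ?S\<close> \<open>v \<in> ?S\<close> by blast
    then have "u \<oplus> v = frob_sum B (\<lambda>b. d b \<oplus> e b)" "(\<lambda>b. d b \<oplus> e b) \<in> B \<rightarrow> I"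
      using frob_sum_add[OF Bc dc dc] ideal_add[OF I] by (auto simp: Pi_iff)
    then show ?thesis by blast
  qed
  have Spow: "a [^] p \<otimes> z \<in> ?S" if a: "a \<in> I" and z: "z \<in> carrier R" for a z
  proof -
    obtain e where e: "e \<in> B \<rightarrow> carrier R" "z = frob_sum B e" using B z unfolding frob_generates_def by blast
    have "a [^] p \<otimes> z = frob_sum B (\<lambda>b. a \<otimes> e b)"
      unfolding e(2) using frob_sum_smult[OF Bc e(1) _ fB] a Ic by auto
    moreover have "(\<lambda>b. a \<otimes> e b) \<in> B \<rightarrow> I" using a e(1) ideal_rmult[OF I] by auto
    ultimately show ?thesis by blast
  qed
  have Ssum: "(\<Oplus>b\<in>D. f b) \<in> ?S" if "finite D" "\<And>b. b \<in> D \<Longrightarrow> f b \<in> ?S \<and> f b \<in> carrier R" for D :: "'a set" and f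
    using that
  proof (induction D rule: finite_induct)
    case (insert b D)
    then have "f \<in> D \<rightarrow> carrier R" "f b \<in> carrier R" "f b \<in> ?S" by auto
    then have "(\<Oplus>b\<in>insert b D. f b) = f b \<oplus> (\<Oplus>b\<in>D. f b)" using insert by simp
    then show ?case using Sadd[OF \<open>f b \<in> ?S\<close> insert.IH] insert.prems by simp
  qed (use S0 in simp)
  have "ideal ?S R"
  proof (rule cring_idealI[OF _ S0 Sadd])
    show "?S \<subseteq> carrier R" using frob_sum_closed[OF Bc dc] by auto
    fix u r assume "u \<in> ?S" and r: "r \<in> carrier R"
    then obtain d where d: "d \<in> B \<rightarrow> I" "u = frob_sum B d" by blast
    \<comment> \<open>The factor \<open>r\<close> need not be a p-th power and so cannot go into the
      coefficients. It is moved to the generators, and every product of \<open>r\<close> with a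
      generator is expanded anew.\<close>
    have "r \<otimes> u = (\<Oplus>b\<in>B. r \<otimes> (d b [^] p \<otimes> b))"
      unfolding d(2) frob_sum_def using fB Bc dc[OF d(1)] r by (intro finsum_rdistr) auto
    also have "\<dots> = (\<Oplus>b\<in>B. d b [^] p \<otimes> (r \<otimes> b))"
      using Bc dc[OF d(1)] r by (intro finsum_cong') (auto simp: m_ac Pi_iff subset_iff)
    also have "\<dots> \<in> ?S"
    proof (rule Ssum[OF fB], rule conjI)
      fix b assume b: "b \<in> B"
      then have 1: "d b \<in> I" "r \<otimes> b \<in> carrier R" using d(1) Bc r by auto
      then show "d b [^] p \<otimes> (r \<otimes> b) \<in> ?S" by (rule Spow)
      show "d b [^] p \<otimes> (r \<otimes> b) \<in> carrier R" using 1 Ic by auto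
    qed
    finally show "r \<otimes> u \<in> ?S" .
  qed
  moreover have "(\<lambda>f. f [^] p) ` I \<subseteq> ?S"
  proof safe
    fix a assume a: "a \<in> I"
    then have "a [^] p \<otimes> \<one> = a [^] p" using Ic by auto
    then show "\<exists>d. a [^] p = frob_sum B d \<and> d \<in> B \<rightarrow> I" using Spow[OF a one_closed] by auto
  qed
  ultimately have "frob_power R I p \<subseteq> ?S" unfolding frob_power_def by (rule genideal_minimal)
  then show thesis using that x by blast
qed

end

section \<open>Freeness of the Frobenius module of a regular local ring\<close>

context ring
begin

text \<open>The \<open>R\<close>-linear maps from \<open>R\<close>, viewed as a module via Frobenius, to \<open>R\<close>.\<close>

definition p_linear :: "nat \<Rightarrow> ('a \<Rightarrow> 'a) \<Rightarrow> bool" where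
  "p_linear p \<psi> \<longleftrightarrow> \<psi> \<in> carrier R \<rightarrow> carrier R \<and>
     (\<forall>x\<in>carrier R. \<forall>y\<in>carrier R. \<psi> (x \<oplus> y) = \<psi> x \<oplus> \<psi> y) \<and>
     (\<forall>s\<in>carrier R. \<forall>x\<in>carrier R. \<psi> (s [^] p \<otimes> x) = s \<otimes> \<psi> x)"

lemma p_linear_closed: "p_linear p \<psi> \<Longrightarrow> x \<in> carrier R \<Longrightarrow> \<psi> x \<in> carrier R"
  and p_linear_add: "p_linear p \<psi> \<Longrightarrow> x \<in> carrier R \<Longrightarrow> y \<in> carrier R \<Longrightarrow> \<psi> (x \<oplus> y) = \<psi> x \<oplus> \<psi> y"
  and p_linear_smult: "p_linear p \<psi> \<Longrightarrow> s \<in> carrier R \<Longrightarrow> x \<in> carrier R \<Longrightarrow> \<psi> (s [^] p \<otimes> x) = s \<otimes> \<psi> x"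
  unfolding p_linear_def by blast+

end

locale frobenius_local = noetherian_local + frobenius_ring +
  fixes Y
  assumes finite_params: "finite Y" and params_carrier: "Y \<subseteq> carrier R" and params_gen: "\<mm> = Idl Y"
    and params_chain: "chain_between R {} (card Y) \<mm>"
begin

lemmas params_prime = regular_subset_prime[OF finite_params params_carrier params_gen params_chain]
lemmas params_notin = regular_notin[OF finite_params params_carrier params_gen params_chain]

lemma params_nonzerodivisor:
  assumes "T \<subseteq> Y" "w \<in> carrier R" "w \<notin> Idl T"
  shows "nonzerodivisor_mod (Idl T) w"
  using params_prime[OF assms(1)] assms(2,3) prime_in_iff unfolding nonzerodivisor_mod_def by blast

text \<open>Any subset of the parameters generates a prime ideal, so the claim is clear without
  powers. Each \<open>x\<close> in \<open>U\<close> is then traded for its n-th power by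
  \<open>nonzerodivisor_mod_power\<close>, which also asks that \<open>x\<close> be a nonzerodivisor
  modulo the rest; \<open>params_notin\<close> supplies that.\<close>

lemma nonzerodivisor_mod_powers:
  assumes "finite U" "U \<subseteq> Y" "T \<subseteq> Y" "U \<inter> T = {}" "w \<in> carrier R" "w \<notin> Idl (U \<union> T)"
  shows "nonzerodivisor_mod (Idl ((\<lambda>y. y [^] (n::nat)) ` U \<union> T)) w"
  using assms
proof (induction U arbitrary: T w rule: finite_induct)
  case empty
  then show ?case using params_nonzerodivisor by simp
next
  case (insert x U)
  let ?A = "(\<lambda>y. y [^] n) ` U \<union> T"
  have xc: "x \<in> carrier R" and c: "?A \<subseteq> carrier R" using insert.prems params_carrier by auto
  have "nonzerodivisor_mod (Idl ?A) x"
    using insert xc by (intro insert.IH params_notin) auto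
  moreover have "nonzerodivisor_mod (Idl (insert x (Idl ?A))) w"
  proof -
    have "nonzerodivisor_mod (Idl ((\<lambda>y. y [^] n) ` U \<union> insert x T)) w"
      using insert by (intro insert.IH) auto
    then show ?thesis using Idl_insert_Idl[OF c xc] by simp
  qed
  ultimately have "nonzerodivisor_mod (Idl (insert (x [^] n) (Idl ?A))) w"
    using insert.prems(4) by (intro nonzerodivisor_mod_power genideal_ideal c xc) auto
  moreover have "Idl (insert (x [^] n) (Idl ?A)) = Idl (insert (x [^] n) ?A)"
    using xc by (intro Idl_insert_Idl c) auto
  ultimately show ?case by simp
qed

lemma minimal_generators_coeffs_in_max:
  assumes B: "frob_generates B" and mn: "\<And>B'. B' \<subset> B \<Longrightarrow> \<not> frob_generates B'"
    and c: "c \<in> B \<rightarrow> carrier R" and rel: "frob_sum B c \<in> frob_power R \<mm> p" and b: "b \<in> B"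
  shows "c b \<in> \<mm>"
proof (rule ccontr)
  assume nb: "c b \<notin> \<mm>"
  have fB: "finite B" and Bc: "B \<subseteq> carrier R" using B unfolding frob_generates_def by auto
  obtain d where d: "d \<in> B \<rightarrow> \<mm>" "frob_sum B c = frob_sum B d"
    by (rule frob_power_expansion[OF B ideal_max rel])
  have dc: "d \<in> B \<rightarrow> carrier R" using d(1) ideal_carr[OF ideal_max] by auto
  define e where "e = (\<lambda>x. c x \<ominus> d x)"
  have ec: "e \<in> B \<rightarrow> carrier R" using c dc unfolding e_def by auto
  have "frob_sum B c = frob_sum B (\<lambda>x. e x \<oplus> d x)"
  proof (rule frob_sum_cong[OF Bc])
    show "(\<lambda>x. e x \<oplus> d x) \<in> B \<rightarrow> carrier R" using ec dc by (auto simp: Pi_iff)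
    fix x assume "x \<in> B"
    then have "c x \<in> carrier R" "d x \<in> carrier R" using c dc by auto
    then show "c x = e x \<oplus> d x" unfolding e_def by algebra
  qed
  also have "\<dots> = frob_sum B e \<oplus> frob_sum B d" by (rule frob_sum_add[OF Bc ec dc])
  finally have e0: "frob_sum B e = \<zero>" using d(2) frob_sum_closed[OF Bc ec] frob_sum_closed[OF Bc dc] by simp
  have eb: "e b \<in> carrier R" using ec b by auto
  have "e b \<notin> \<mm>"
  proof
    assume "e b \<in> \<mm>"
    then have "e b \<oplus> d b \<in> \<mm>" using d(1) b ideal_add[OF ideal_max] by auto
    moreover have "c b \<in> carrier R" "d b \<in> carrier R" using c dc b by auto
    then have "e b \<oplus> d b = c b" unfolding e_def by algebra
    ultimately show False using nb by simp
  qed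
  then have u: "e b \<in> Units R" using unit_if_notin_max eb by blast
  let ?v = "inv (e b)"
  have v: "?v \<in> carrier R" "?v \<otimes> e b = \<one>" using u by auto
  \<comment> \<open>The relation is normalized so that the coefficient at \<open>b\<close> becomes
    -1; the other values of \<open>g\<close> then express \<open>b\<close> by the remaining
    generators.\<close>
  define g where "g = (\<lambda>x. \<ominus> (?v \<otimes> e x))"
  have gc: "g \<in> B \<rightarrow> carrier R" using v ec unfolding g_def by auto
  let ?B = "B - {b}"
  have fB': "finite ?B" and Bc': "?B \<subseteq> carrier R" using fB Bc by auto
  have split: "frob_sum B h = h b [^] p \<otimes> b \<oplus> frob_sum ?B h" if "h \<in> B \<rightarrow> carrier R" for h
  proof -
    have "B = insert b ?B" using b by blast
    then have "frob_sum B h = (\<Oplus>x\<in>insert b ?B. h x [^] p \<otimes> x)" unfolding frob_sum_def by simp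
    also have "\<dots> = h b [^] p \<otimes> b \<oplus> frob_sum ?B h"
      unfolding frob_sum_def using fB Bc b that by (intro finsum_insert) (auto simp: Pi_iff subset_iff)
    finally show ?thesis .
  qed
  have bg: "b = frob_sum ?B g"
  proof -
    have "frob_sum B (\<lambda>x. \<ominus> ?v \<otimes> e x) = (\<ominus> ?v) [^] p \<otimes> frob_sum B e"
      using v by (intro frob_sum_smult Bc ec fB) auto
    also have "frob_sum B (\<lambda>x. \<ominus> ?v \<otimes> e x) = frob_sum B g"
      using gc v ec unfolding g_def by (intro frob_sum_cong[OF Bc]) (auto simp: l_minus Pi_iff)
    finally have "frob_sum B g = \<zero>" unfolding e0 using v by simp
    then have z: "g b [^] p \<otimes> b \<oplus> frob_sum ?B g = \<zero>" using split[OF gc] by simp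
    have "g b = \<zero> \<ominus> \<one>" unfolding g_def v(2) by (simp add: minus_eq)
    then have "g b [^] p = \<zero> [^] p \<ominus> \<one> [^] p" using minus_pow_p[of \<zero> \<one>] by simp
    then have "g b [^] p = \<ominus> \<one>" by (simp add: zero_pow_p minus_eq)
    then have "\<ominus> b \<oplus> frob_sum ?B g = \<zero>" using z b Bc by (auto simp: l_minus)
    moreover have sc: "frob_sum ?B g \<in> carrier R" "b \<in> carrier R" using frob_sum_closed[OF Bc'] gc b Bc by auto
    moreover have "frob_sum ?B g = b \<oplus> (\<ominus> b \<oplus> frob_sum ?B g)" using sc by algebra
    ultimately show ?thesis by simp
  qed
  have "frob_generates ?B" unfolding frob_generates_def
  proof (intro conjI ballI fB' Bc')
    fix x assume "x \<in> carrier R"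
    then obtain h where h: "h \<in> B \<rightarrow> carrier R" "x = frob_sum B h" using B unfolding frob_generates_def by blast
    have hb: "h b \<in> carrier R" using h b by auto
    have gc': "g \<in> ?B \<rightarrow> carrier R" and hc': "h \<in> ?B \<rightarrow> carrier R" using gc h by auto
    have hg: "(\<lambda>x. h b \<otimes> g x) \<in> ?B \<rightarrow> carrier R" using gc' hb by (auto simp: Pi_iff)
    have "x = h b [^] p \<otimes> frob_sum ?B g \<oplus> frob_sum ?B h" using h(2) split[OF h(1)] bg by simp
    also have "\<dots> = frob_sum ?B (\<lambda>x. h b \<otimes> g x) \<oplus> frob_sum ?B h"
      using frob_sum_smult[OF Bc' gc' hb fB'] by simp
    also have "\<dots> = frob_sum ?B (\<lambda>x. h b \<otimes> g x \<oplus> h x)"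
      using frob_sum_add[OF Bc' hg hc'] by simp
    finally show "\<exists>c\<in>?B \<rightarrow> carrier R. x = frob_sum ?B c" using hg hc' by (intro bexI[of _ "\<lambda>x. h b \<otimes> g x \<oplus> h x"]) (auto simp: Pi_iff)
  qed
  then show False using mn b by blast
qed

text \<open>Each parameter added to \<open>U\<close> shrinks the ideal modulo which a relation is
  taken, and with it the ideal known to contain the coefficients. \<open>U\<close> empty is the case
  of the maximal ideal; for \<open>U = Y\<close> only the zero ideal remains, which is linear
  independence.\<close>

lemma minimal_generators_independent:
  assumes B: "frob_generates B" and mn: "\<And>B'. B' \<subset> B \<Longrightarrow> \<not> frob_generates B'"
    and "U \<subseteq> Y" "c \<in> B \<rightarrow> carrier R" "frob_sum B c \<in> frob_power R (Idl (Y - U)) p" "b \<in> B"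
  shows "c b \<in> Idl (Y - U)"
proof -
  have fB: "finite B" and Bc: "B \<subseteq> carrier R" using B unfolding frob_generates_def by auto
  have "finite U" using assms(3) finite_params finite_subset by blast
  then show ?thesis using assms(3-6)
  proof (induction U arbitrary: c b rule: finite_induct)
    case empty
    then show ?case using minimal_generators_coeffs_in_max[OF B mn] params_gen by simp
  next
    case (insert x U)
    define T where "T = Y - insert x U"
    have YU: "Y - U = insert x T" using insert.prems(1) insert.hyps unfolding T_def by blast
    have TY: "T \<subseteq> Y" and Tc: "T \<subseteq> carrier R" and xc: "x \<in> carrier R" and xY: "x \<in> Y" and xT: "x \<notin> T"
      using insert.prems(1) params_carrier unfolding T_def by auto
    have fT: "finite T" using TY finite_params finite_subset by blast
    let ?J = "Idl T" and ?F = "frob_power R (Idl T) p"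
    have Ji: "ideal ?J R" by (rule genideal_ideal[OF Tc])
    have Fi: "ideal ?F R" by (rule frob_power_ideal[OF ideal_sub[OF Ji]])
    have YUi: "Idl (Y - U) = Idl (insert x ?J)" unfolding YU using Idl_insert_Idl[OF Tc xc] by simp
    have Fsub: "?F \<subseteq> frob_power R (Idl (Y - U)) p"
      unfolding YU using Tc xc subset_Idl_subset[of "insert x T" T]
      by (intro frob_power_mono ideal_sub[OF genideal_ideal]) auto
    have nzd: "nonzerodivisor_mod ?F (x [^] p)"
    proof -
      have "nonzerodivisor_mod (Idl ((\<lambda>y. y [^] p) ` T \<union> {})) x"
        using params_notin[OF TY xY xT] xc by (intro nonzerodivisor_mod_powers fT TY) auto
      moreover have "?F = Idl ((\<lambda>y. y [^] p) ` T)" using frob_power_Idl[OF Tc, of 1] by simp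
      ultimately show ?thesis using nonzerodivisor_mod_pow[OF xc] by simp
    qed
    \<comment> \<open>The coefficients at the fixed \<open>b\<close> form an ideal. By induction
      each coefficient is j + a x with \<open>j\<close> in \<open>?J\<close>. The part with
      \<open>j\<close> drops out modulo \<open>?F\<close>, and cancelling x^p shows that the
      \<open>a\<close> are again coefficients of a relation. Thus \<open>?N\<close> is contained in
      J + x N, and Nakayama's lemma gives the claim.\<close>
    let ?N = "{c b | c. c \<in> B \<rightarrow> carrier R \<and> frob_sum B c \<in> ?F}"
    have Ni: "ideal ?N R"
    proof (rule cring_idealI)
      show "?N \<subseteq> carrier R" using insert.prems(4) by auto
      show "\<zero> \<in> ?N" using frob_sum_zero[OF Bc] ideal_0[OF Fi] by (auto intro!: exI[of _ "\<lambda>_. \<zero>"])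
    next
      fix a a' assume "a \<in> ?N" "a' \<in> ?N"
      then obtain c c' where h: "c \<in> B \<rightarrow> carrier R" "frob_sum B c \<in> ?F" "a = c b"
        "c' \<in> B \<rightarrow> carrier R" "frob_sum B c' \<in> ?F" "a' = c' b" by blast
      have "(\<lambda>b. c b \<oplus> c' b) \<in> B \<rightarrow> carrier R" using h by (auto simp: Pi_iff)
      moreover have "frob_sum B (\<lambda>b. c b \<oplus> c' b) \<in> ?F"
        unfolding frob_sum_add[OF Bc h(1,4)] using h ideal_add[OF Fi] by blast
      ultimately show "a \<oplus> a' \<in> ?N" unfolding h(3,6) by (intro CollectI exI[of _ "\<lambda>b. c b \<oplus> c' b"]) auto
    next
      fix a r assume "a \<in> ?N" and r: "r \<in> carrier R"
      then obtain c where h: "c \<in> B \<rightarrow> carrier R" "frob_sum B c \<in> ?F" "a = c b" by blast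
      have "(\<lambda>b. r \<otimes> c b) \<in> B \<rightarrow> carrier R" using h r by (auto simp: Pi_iff)
      moreover have "frob_sum B (\<lambda>b. r \<otimes> c b) \<in> ?F"
        unfolding frob_sum_smult[OF Bc h(1) r fB] using h r ideal_lmult[OF Fi] by simp
      ultimately show "r \<otimes> a \<in> ?N" unfolding h(3) by (intro CollectI exI[of _ "\<lambda>b. r \<otimes> c b"]) auto
    qed
    have "?N \<subseteq> ?J"
    proof (rule local_nakayama[OF _ Ni Ji])
      show "x \<in> \<mm>" unfolding params_gen using xY genideal_self[OF params_carrier] by blast
      fix z assume "z \<in> ?N"
      then obtain c where c: "c \<in> B \<rightarrow> carrier R" "frob_sum B c \<in> ?F" "z = c b" by blast
      have "\<forall>b'\<in>B. \<exists>j a. j \<in> ?J \<and> a \<in> carrier R \<and> c b' = j \<oplus> a \<otimes> x"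
      proof
        fix b' assume "b' \<in> B"
        then have "c b' \<in> Idl (Y - U)" using insert.IH[of c b'] insert.prems(1) c Fsub by blast
        then show "\<exists>j a. j \<in> ?J \<and> a \<in> carrier R \<and> c b' = j \<oplus> a \<otimes> x"
          unfolding YUi Idl_insert_iff[OF Ji xc] by blast
      qed
      then obtain j a where ja: "\<forall>b'\<in>B. j b' \<in> ?J \<and> a b' \<in> carrier R \<and> c b' = j b' \<oplus> a b' \<otimes> x" by metis
      have jc: "j \<in> B \<rightarrow> carrier R" and ac: "a \<in> B \<rightarrow> carrier R" using ja ideal_carr[OF Ji] by auto
      have xa: "(\<lambda>b. x \<otimes> a b) \<in> B \<rightarrow> carrier R" using ac xc by (auto simp: Pi_iff)
      have "frob_sum B c = frob_sum B (\<lambda>b. x \<otimes> a b \<oplus> j b)"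
        using ja jc ac xa xc by (intro frob_sum_cong[OF Bc]) (auto simp: Pi_iff m_comm a_comm)
      also have "\<dots> = x [^] p \<otimes> frob_sum B a \<oplus> frob_sum B j"
        unfolding frob_sum_add[OF Bc xa jc] frob_sum_smult[OF Bc ac xc fB] ..
      finally have sum: "x [^] p \<otimes> frob_sum B a \<oplus> frob_sum B j \<in> ?F" using c(2) by simp
      have jF: "frob_sum B j \<in> ?F"
      proof (rule frob_sum_in_ideal[OF Fi fB Bc])
        fix b assume b: "b \<in> B"
        have "(\<lambda>f. f [^] p) ` ?J \<subseteq> carrier R" using ideal_carr[OF Ji] by auto
        then show "j b \<in> carrier R \<and> j b [^] p \<in> ?F"
          using ja b jc genideal_self unfolding frob_power_def by blast
      qed
      have "x [^] p \<otimes> frob_sum B a \<in> ?F"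
        using xc frob_sum_closed[OF Bc ac] by (intro ideal_add_cancel[OF Fi sum jF]) simp
      then have "frob_sum B a \<in> ?F" using nonzerodivisor_modD[OF nzd] frob_sum_closed[OF Bc ac] by blast
      then have "a b \<in> ?N" using ac by blast
      then show "\<exists>j\<in>?J. \<exists>w\<in>?N. z = j \<oplus> x \<otimes> w"
        using ja insert.prems(4) c(3) xc m_comm[of "a b" x] by (intro bexI[of _ "j b"] bexI[of _ "a b"]) auto
    qed
    moreover have "c b \<in> ?N" using insert.prems(2,3) unfolding T_def by blast
    ultimately show ?case unfolding T_def by blast
  qed
qed

text \<open>A generating set that is minimal under inclusion is linearly independent, so
  coefficients are unique and the coordinate functions are p-linear. Choosing it inside the given
  set keeps control of where its elements come from.\<close>

lemma frobenius_dual_basis: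
  assumes "frob_generates B\<^sub>0"
  obtains B \<pi> where "B \<subseteq> B\<^sub>0" "finite B" "\<And>b. b \<in> B \<Longrightarrow> p_linear p (\<pi> b)"
    "\<And>x. x \<in> carrier R \<Longrightarrow> x = frob_sum B (\<lambda>b. \<pi> b x)"
proof -
  have "finite {B. B \<subseteq> B\<^sub>0 \<and> frob_generates B}" using assms unfolding frob_generates_def by auto
  moreover have "{B. B \<subseteq> B\<^sub>0 \<and> frob_generates B} \<noteq> {}" using assms by blast
  ultimately obtain B where "B \<in> {B. B \<subseteq> B\<^sub>0 \<and> frob_generates B}"
    and mn': "\<And>B'. B' \<in> {B. B \<subseteq> B\<^sub>0 \<and> frob_generates B} \<Longrightarrow> B' \<subseteq> B \<Longrightarrow> B = B'"
    by (rule finite_has_minimal[THEN bexE]) blast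
  then have BB: "B \<subseteq> B\<^sub>0" and B: "frob_generates B" and mn: "\<And>B'. B' \<subset> B \<Longrightarrow> \<not> frob_generates B'" by blast+
  have fB: "finite B" and Bc: "B \<subseteq> carrier R" using B unfolding frob_generates_def by auto
  have zero: "c b = \<zero>" if c: "c \<in> B \<rightarrow> carrier R" "frob_sum B c = \<zero>" and b: "b \<in> B" for c b
  proof -
    \<comment> \<open>Here \<open>U\<close> is all of \<open>Y\<close>, and the empty set generates
      the zero ideal.\<close>
    have "c b \<in> Idl (Y - Y)"
      using that ideal_0[OF frob_power_ideal[OF ideal_sub[OF genideal_ideal[of "Y - Y"]]]]
      by (intro minimal_generators_independent[OF B mn]) auto
    then show ?thesis using genideal_minimal[OF zeroideal, of "{}"] by auto
  qed
  have unique: "c b = d b" if c: "c \<in> B \<rightarrow> carrier R" and d: "d \<in> B \<rightarrow> carrier R"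
    and e: "frob_sum B c = frob_sum B d" and b: "b \<in> B" for c d b
  proof -
    let ?e = "\<lambda>b. c b \<ominus> d b"
    have ec: "?e \<in> B \<rightarrow> carrier R" using c d by (auto simp: Pi_iff)
    have "frob_sum B c = frob_sum B (\<lambda>b. ?e b \<oplus> d b)"
    proof (rule frob_sum_cong[OF Bc])
      show "(\<lambda>b. ?e b \<oplus> d b) \<in> B \<rightarrow> carrier R" using ec d by (auto simp: Pi_iff)
      fix x assume "x \<in> B"
      then have "c x \<in> carrier R" "d x \<in> carrier R" using c d by auto
      then show "c x = ?e x \<oplus> d x" by algebra
    qed
    also have "\<dots> = frob_sum B ?e \<oplus> frob_sum B d" by (rule frob_sum_add[OF Bc ec d])
    finally have "frob_sum B ?e = \<zero>" using e frob_sum_closed[OF Bc ec] frob_sum_closed[OF Bc d] by simp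
    then have "?e b = \<zero>" by (rule zero[OF ec _ b])
    then show ?thesis using c d b by (auto simp: Pi_iff)
  qed
  have "\<forall>x. \<exists>c. x \<in> carrier R \<longrightarrow> c \<in> B \<rightarrow> carrier R \<and> x = frob_sum B c"
    using B unfolding frob_generates_def by blast
  then obtain C where "\<forall>x. x \<in> carrier R \<longrightarrow> C x \<in> B \<rightarrow> carrier R \<and> x = frob_sum B (C x)"
    by (rule choice[THEN exE])
  then have C: "\<And>x. x \<in> carrier R \<Longrightarrow> C x \<in> B \<rightarrow> carrier R" "\<And>x. x \<in> carrier R \<Longrightarrow> x = frob_sum B (C x)"
    by blast+
  have "p_linear p (\<lambda>x. C x b)" if b: "b \<in> B" for b
    unfolding p_linear_def
  proof (intro conjI ballI)
    show "(\<lambda>x. C x b) \<in> carrier R \<rightarrow> carrier R" using C(1) b by auto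
    fix x y assume x: "x \<in> carrier R" and y: "y \<in> carrier R"
    show "C (x \<oplus> y) b = C x b \<oplus> C y b"
    proof (rule unique[OF C(1) _ _ b, of _ "\<lambda>b. C x b \<oplus> C y b"])
      show "frob_sum B (C (x \<oplus> y)) = frob_sum B (\<lambda>b. C x b \<oplus> C y b)"
        using frob_sum_add[OF Bc C(1)[OF x] C(1)[OF y]] C(2) x y by (metis a_closed)
    qed (use x y C(1) in \<open>auto simp: Pi_iff\<close>)
    show "C (x [^] p \<otimes> y) b = x \<otimes> C y b"
    proof (rule unique[OF C(1) _ _ b, of _ "\<lambda>b. x \<otimes> C y b"])
      show "frob_sum B (C (x [^] p \<otimes> y)) = frob_sum B (\<lambda>b. x \<otimes> C y b)"
        using frob_sum_smult[OF Bc C(1)[OF y] x fB] C(2) x y by (metis m_closed nat_pow_closed)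
    qed (use x y C(1) in \<open>auto simp: Pi_iff\<close>)
  qed
  then show thesis using that[of B "\<lambda>b x. C x b"] BB fB C(2) by blast
qed

end

section \<open>Fedder's criterion\<close>

context cring
begin

lemma p_linear_zero: "p_linear p \<psi> \<Longrightarrow> \<psi> \<zero> = \<zero>"
  using p_linear_closed[of p \<psi> \<zero>] p_linear_add[of p \<psi> \<zero> \<zero>] by simp

lemma p_linear_comp_mult:
  assumes "p_linear p \<psi>" "a \<in> carrier R"
  shows "p_linear p (\<lambda>x. \<psi> (a \<otimes> x))"
  unfolding p_linear_def
proof (intro conjI ballI)
  fix x y assume x: "x \<in> carrier R" and y: "y \<in> carrier R"
  show "\<psi> (a \<otimes> (x \<oplus> y)) = \<psi> (a \<otimes> x) \<oplus> \<psi> (a \<otimes> y)"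
    using p_linear_add[OF assms(1), of "a \<otimes> x" "a \<otimes> y"] assms(2) x y by (simp add: r_distr)
  have "a \<otimes> (x [^] p \<otimes> y) = x [^] p \<otimes> (a \<otimes> y)" using assms(2) x y by (simp add: m_lcomm)
  then show "\<psi> (a \<otimes> (x [^] p \<otimes> y)) = x \<otimes> \<psi> (a \<otimes> y)"
    using p_linear_smult[OF assms(1) x, of "a \<otimes> y"] assms(2) y by simp
qed (use assms p_linear_closed in auto)

lemma p_linear_diff:
  assumes f: "p_linear p \<phi>" and g: "p_linear p \<psi>"
  shows "p_linear p (\<lambda>x. \<phi> x \<ominus> \<psi> x)"
  unfolding p_linear_def
proof (intro conjI ballI)
  fix x y assume x: "x \<in> carrier R" and y: "y \<in> carrier R"
  have c: "\<phi> x \<in> carrier R" "\<phi> y \<in> carrier R" "\<psi> x \<in> carrier R" "\<psi> y \<in> carrier R"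
    using f g x y p_linear_closed by auto
  show "\<phi> (x \<oplus> y) \<ominus> \<psi> (x \<oplus> y) = \<phi> x \<ominus> \<psi> x \<oplus> (\<phi> y \<ominus> \<psi> y)"
    unfolding p_linear_add[OF f x y] p_linear_add[OF g x y] using c by algebra
  show "\<phi> (x [^] p \<otimes> y) \<ominus> \<psi> (x [^] p \<otimes> y) = x \<otimes> (\<phi> y \<ominus> \<psi> y)"
    unfolding p_linear_smult[OF f x y] p_linear_smult[OF g x y] using c x by algebra
qed (use f g p_linear_closed in auto)

text \<open>The map is additive but respects multiplication by p-th powers only. Quantifying over
  all multiples \<open>r \<otimes> x\<close> turns the condition on \<open>x\<close> into an ideal,
  which contains the p-th powers of \<open>I\<close>.\<close>

lemma p_linear_frob_power:
  assumes f: "p_linear p \<psi>" and I: "ideal I R" and x: "x \<in> frob_power R I p"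
  shows "\<psi> x \<in> I"
proof -
  let ?S = "{x \<in> carrier R. \<forall>r\<in>carrier R. \<psi> (r \<otimes> x) \<in> I}"
  have "ideal ?S R"
  proof (rule cring_idealI)
    show "\<zero> \<in> ?S" using p_linear_zero[OF f] ideal_0[OF I] by auto
    fix a b assume ab: "a \<in> ?S" "b \<in> ?S"
    have "\<psi> (r \<otimes> (a \<oplus> b)) \<in> I" if r: "r \<in> carrier R" for r
    proof -
      have "\<psi> (r \<otimes> (a \<oplus> b)) = \<psi> (r \<otimes> a) \<oplus> \<psi> (r \<otimes> b)"
        using p_linear_add[OF f, of "r \<otimes> a" "r \<otimes> b"] ab r by (simp add: r_distr)
      then show ?thesis using ab r ideal_add[OF I] by simp
    qed
    then show "a \<oplus> b \<in> ?S" using ab by auto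
  next
    fix a y assume "a \<in> ?S" "y \<in> carrier R"
    then show "y \<otimes> a \<in> ?S" by (auto simp: m_assoc[symmetric])
  qed auto
  moreover have "(\<lambda>a. a [^] p) ` I \<subseteq> ?S"
  proof safe
    fix a assume a: "a \<in> I"
    then have ac: "a \<in> carrier R" using ideal_carr[OF I] by blast
    then show "a [^] p \<in> carrier R" by simp
    fix r assume r: "r \<in> carrier R"
    have "\<psi> (r \<otimes> a [^] p) = a \<otimes> \<psi> r" using p_linear_smult[OF f ac r] ac r by (simp add: m_comm)
    then show "\<psi> (r \<otimes> a [^] p) \<in> I" using ideal_rmult[OF I a] p_linear_closed[OF f r] by simp
  qed
  ultimately have "frob_power R I p \<subseteq> ?S" unfolding frob_power_def by (rule genideal_minimal)
  then have "x \<in> carrier R" "\<psi> (\<one> \<otimes> x) \<in> I" using x by blast+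
  then show ?thesis by simp
qed

text \<open>The ideal generated so far is carried along as an argument, so that reordering a
  sequence is an induction on lists with varying \<open>J\<close>.\<close>

primrec regular_mod :: "'a set \<Rightarrow> 'a list \<Rightarrow> bool" where
  "regular_mod J [] \<longleftrightarrow> True"
| "regular_mod J (x # xs) \<longleftrightarrow> nonzerodivisor_mod J x \<and> regular_mod (Idl (insert x J)) xs"

lemma regular_modI:
  assumes "set (ys @ xs) \<subseteq> carrier R"
    and "\<And>i. i < length xs \<Longrightarrow> nonzerodivisor_mod (Idl (set (ys @ take i xs))) (xs ! i)"
  shows "regular_mod (Idl (set ys)) xs"
  using assms
proof (induction xs arbitrary: ys)
  case (Cons x xs)
  have "regular_mod (Idl (set (ys @ [x]))) xs"
  proof (rule Cons.IH)
    show "set ((ys @ [x]) @ xs) \<subseteq> carrier R" using Cons.prems by auto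
    fix i assume "i < length xs"
    then show "nonzerodivisor_mod (Idl (set ((ys @ [x]) @ take i xs))) (xs ! i)"
      using Cons.prems(2)[of "Suc i"] by simp
  qed
  moreover have "Idl (insert x (Idl (set ys))) = Idl (set (ys @ [x]))"
    using Cons.prems by (simp add: Idl_insert_Idl)
  ultimately show ?case using Cons.prems(2)[of 0] by simp
qed simp

lemma regular_mod_append:
  assumes "J \<subseteq> carrier R" "set as \<subseteq> carrier R" "regular_mod (Idl J) (as @ y # bs)"
  shows "nonzerodivisor_mod (Idl (J \<union> set as)) y"
  using assms
proof (induction as arbitrary: J)
  case (Cons a as)
  have "nonzerodivisor_mod (Idl (insert a J \<union> set as)) y"
    using Cons.prems Idl_insert_Idl[of J a] by (intro Cons.IH) auto
  then show ?case by simp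
qed simp

end

section \<open>Permuting regular sequences in a local ring\<close>

context noetherian_local
begin

text \<open>Locality enters for \<open>y\<close>: a factor that \<open>y\<close> multiplies into
  \<open>J\<close> is of the form j + x w, where \<open>y\<close> multiplies \<open>w\<close> into
  \<open>J\<close> again, so Nakayama's lemma applies. That \<open>x\<close> stays regular modulo J
  + (y) is a direct cancellation.\<close>

lemma regular_mod_swap:
  assumes J: "ideal J R" and x: "x \<in> \<mm>" and y: "y \<in> \<mm>" and r: "regular_mod J (x # y # zs)"
  shows "regular_mod J (y # x # zs)"
proof -
  have xc: "x \<in> carrier R" and yc: "y \<in> carrier R" using x y ideal_carr[OF ideal_max] by auto
  have nx: "nonzerodivisor_mod J x" and ny: "nonzerodivisor_mod (Idl (insert x J)) y"
    and rz: "regular_mod (Idl (insert y (Idl (insert x J)))) zs" using r by auto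
  note ix = Idl_insert_iff[OF J xc] and iy = Idl_insert_iff[OF J yc]
  let ?N = "{z \<in> carrier R. y \<otimes> z \<in> J}"
  have Ni: "ideal ?N R"
    using yc J by (intro cring_idealI) (auto simp: ideal_rules r_distr m_lcomm)
  have "?N \<subseteq> J"
  proof (rule local_nakayama[OF x Ni J])
    fix z assume z: "z \<in> ?N"
    have "y \<otimes> z \<oplus> \<zero> \<otimes> x \<in> Idl (insert x J)" unfolding ix using z by blast
    then have "y \<otimes> z \<in> Idl (insert x J)" using z xc yc by simp
    then have "z \<in> Idl (insert x J)" using nonzerodivisor_modD[OF ny] z by blast
    then obtain j w where w: "j \<in> J" "w \<in> carrier R" "z = j \<oplus> w \<otimes> x" unfolding ix by blast
    have jc: "j \<in> carrier R" using w ideal_carr[OF J] by blast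
    have "x \<otimes> (y \<otimes> w) = y \<otimes> z \<ominus> y \<otimes> j" unfolding w(3) using jc w(2) xc yc by algebra
    also have "\<dots> \<in> J" using z w(1) yc by (auto intro!: ideal_diff[OF J] intro: ideal_lmult[OF J])
    finally have "y \<otimes> w \<in> J" using nonzerodivisor_modD[OF nx] w yc by auto
    then show "\<exists>j\<in>J. \<exists>w\<in>?N. z = j \<oplus> x \<otimes> w" using w m_comm[OF w(2) xc] by auto
  qed
  then have "nonzerodivisor_mod J y" unfolding nonzerodivisor_mod_def by blast
  moreover have "nonzerodivisor_mod (Idl (insert y J)) x" unfolding nonzerodivisor_mod_def
  proof (intro ballI impI)
    fix z assume z: "z \<in> carrier R" "x \<otimes> z \<in> Idl (insert y J)"
    then obtain j w where w: "j \<in> J" "w \<in> carrier R" "x \<otimes> z = j \<oplus> w \<otimes> y" unfolding iy by blast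
    have jc: "j \<in> carrier R" using w ideal_carr[OF J] by blast
    have "y \<otimes> w = \<ominus> j \<oplus> z \<otimes> x" using w(2,3) jc xc yc z(1) by algebra
    then have "y \<otimes> w \<in> Idl (insert x J)" unfolding ix using w(1) z(1) ideal_neg[OF J] by blast
    then have "w \<in> Idl (insert x J)" using nonzerodivisor_modD[OF ny w(2)] by blast
    then obtain k v where v: "k \<in> J" "v \<in> carrier R" "w = k \<oplus> v \<otimes> x" unfolding ix by blast
    have kc: "k \<in> carrier R" using v ideal_carr[OF J] by blast
    have "x \<otimes> (z \<ominus> y \<otimes> v) = x \<otimes> z \<ominus> x \<otimes> (y \<otimes> v)" using xc yc z(1) v(2) by algebra
    also have "\<dots> = j \<oplus> k \<otimes> y" unfolding w(3) v(3) using jc kc xc yc v(2) by algebra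
    also have "\<dots> \<in> J" using w v yc by (intro ideal_add[OF J] ideal_rmult[OF J])
    finally have 1: "z \<ominus> y \<otimes> v \<in> J" using nonzerodivisor_modD[OF nx] z yc v by auto
    have "z = (z \<ominus> y \<otimes> v) \<oplus> v \<otimes> y" using z(1) yc v(2) by algebra
    then show "z \<in> Idl (insert y J)" unfolding iy using 1 v(2) by blast
  qed
  moreover have "Idl (insert y (Idl (insert x J))) = Idl (insert x (Idl (insert y J)))"
    using xc yc ideal_sub[OF J] by (simp add: Idl_insert_Idl insert_commute)
  ultimately show ?thesis using rz by simp
qed

lemma regular_mod_to_front:
  assumes "ideal J R" "set xs \<subseteq> \<mm>" "y \<in> \<mm>" "regular_mod J (xs @ y # zs)"
  shows "regular_mod J (y # xs @ zs)"
  using assms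
proof (induction xs arbitrary: J)
  case (Cons x xs)
  have "ideal (Idl (insert x J)) R"
    using Cons.prems(1,2) ideal_sub[OF Cons.prems(1)] ideal_sub[OF ideal_max] by (intro genideal_ideal) auto
  then have "regular_mod (Idl (insert x J)) (y # xs @ zs)" using Cons by (intro Cons.IH) auto
  then have "regular_mod J (x # y # xs @ zs)" using Cons.prems by simp
  then show ?case using regular_mod_swap[OF Cons.prems(1), of x y "xs @ zs"] Cons.prems(2,3) by simp
qed simp

lemma regular_mod_permute:
  assumes "ideal J R" "set xs \<subseteq> \<mm>" "regular_mod J xs" "mset xs = mset ys"
  shows "regular_mod J ys"
  using assms
proof (induction ys arbitrary: J xs)
  case (Cons y ys)
  have "y \<in> set xs" using Cons.prems(4) by (metis list.set_intros(1) mset_eq_setD)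
  then obtain as bs where xs: "xs = as @ y # bs" by (meson split_list)
  have r: "regular_mod J (y # as @ bs)" using Cons.prems xs by (intro regular_mod_to_front) auto
  have "ideal (Idl (insert y J)) R"
    using Cons.prems(1,2) xs ideal_sub[OF Cons.prems(1)] ideal_sub[OF ideal_max] by (intro genideal_ideal) auto
  then have "regular_mod (Idl (insert y J)) ys"
    using r Cons.prems xs by (intro Cons.IH[of _ "as @ bs"]) auto
  then show ?case using r by simp
qed simp

text \<open>By permutability the elements indexed by \<open>T\<close> can be placed first, followed
  by the one with index \<open>i\<close>.\<close>

lemma regular_nonzerodivisor:
  assumes fs: "set fs \<subseteq> \<mm>" and r: "regular_mod (Idl {}) fs"
    and T: "T \<subseteq> {..<length fs}" and i: "i < length fs" "i \<notin> T"
  shows "nonzerodivisor_mod (Idl ((!) fs ` T)) (fs ! i)"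
proof -
  let ?l = "sorted_list_of_set T @ i # sorted_list_of_set ({..<length fs} - T - {i})"
  have fT: "finite T" using T finite_subset by blast
  have "mset ?l = mset_set T + mset_set {i} + mset_set ({..<length fs} - T - {i})"
    using fT by (simp flip: sorted_list_of_mset_set)
  also have "\<dots> = mset_set (T \<union> {i} \<union> ({..<length fs} - T - {i}))"
    using fT i by (subst mset_set_Union[symmetric], auto)+
  also have "T \<union> {i} \<union> ({..<length fs} - T - {i}) = {..<length fs}" using T i by auto
  finally have "mset ?l = mset [0..<length fs]" by (simp add: lessThan_atLeast0)
  then have "mset (map ((!) fs) ?l) = mset (map ((!) fs) [0..<length fs])" by (simp only: mset_map)
  then have e: "mset fs = mset (map ((!) fs) ?l)" by (simp only: map_nth)
  have "regular_mod (Idl {}) (map ((!) fs) ?l)"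
    using genideal_ideal[of "{}"] by (intro regular_mod_permute[OF _ fs r e]) auto
  then have "nonzerodivisor_mod (Idl ({} \<union> set (map ((!) fs) (sorted_list_of_set T)))) (fs ! i)"
    using fs T ideal_sub[OF ideal_max] fT
    by (intro regular_mod_append[where bs = "map ((!) fs) (sorted_list_of_set ({..<length fs} - T - {i}))"])
       (auto simp: subset_iff)
  then show ?thesis using fT by simp
qed

end

locale frobenius_dual_basis = frobenius_ring +
  fixes B \<pi>
  assumes finite_basis: "finite B" and basis_carrier: "B \<subseteq> carrier R"
    and dual_p_linear: "\<And>b. b \<in> B \<Longrightarrow> p_linear p (\<pi> b)"
    and expansion: "\<And>x. x \<in> carrier R \<Longrightarrow> x = frob_sum B (\<lambda>b. \<pi> b x)"
begin

lemma dual_closed: "b \<in> B \<Longrightarrow> x \<in> carrier R \<Longrightarrow> \<pi> b x \<in> carrier R"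
  using dual_p_linear p_linear_closed by blast

text \<open>Converse to \<open>p_linear_frob_power\<close>: membership in a Frobenius power can be
  tested on the coordinates.\<close>

lemma in_frob_powerI:
  assumes I: "I \<subseteq> carrier R" and x: "x \<in> carrier R" and h: "\<And>b. b \<in> B \<Longrightarrow> \<pi> b x \<in> I"
  shows "x \<in> frob_power R I p"
proof -
  have "(\<lambda>f. f [^] p) ` I \<subseteq> carrier R" using I by auto
  note s = genideal_self[OF this, folded frob_power_def]
  have "frob_sum B (\<lambda>b. \<pi> b x) \<in> frob_power R I p"
    using s h I by (intro frob_sum_in_ideal[OF frob_power_ideal[OF I] finite_basis basis_carrier]) auto
  then show ?thesis using expansion[OF x] by simp
qed

text \<open>This is the use of flatness of Frobenius. If s z lies in the Frobenius power, so does
  s^p z. Its coordinates are \<open>s\<close> times those of \<open>z\<close> and lie in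
  \<open>I\<close>; cancelling \<open>s\<close> there puts the coordinates of \<open>z\<close> in
  \<open>I\<close>.\<close>

lemma nonzerodivisor_mod_frob_power_p:
  assumes I: "ideal I R" and s: "s \<in> carrier R" and n: "nonzerodivisor_mod I s"
  shows "nonzerodivisor_mod (frob_power R I p) s"
  unfolding nonzerodivisor_mod_def
proof (intro ballI impI)
  fix z assume z: "z \<in> carrier R" "s \<otimes> z \<in> frob_power R I p"
  note Fi = frob_power_ideal[OF ideal_sub[OF I]]
  obtain k where k: "p = Suc k" using p_gt_1 by (cases p) auto
  have "s [^] p \<otimes> z = s [^] k \<otimes> (s \<otimes> z)" unfolding k using s z by (simp add: m_assoc)
  then have "s [^] p \<otimes> z \<in> frob_power R I p" using z s ideal_lmult[OF Fi] by simp
  then have "\<pi> b (s [^] p \<otimes> z) \<in> I" if "b \<in> B" for b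
    using p_linear_frob_power[OF dual_p_linear[OF that] I] by blast
  then have "s \<otimes> \<pi> b z \<in> I" if "b \<in> B" for b
    using that p_linear_smult[OF dual_p_linear s z(1)] by metis
  then show "z \<in> frob_power R I p"
    using nonzerodivisor_modD[OF n] dual_closed z by (intro in_frob_powerI ideal_sub[OF I]) auto
qed

lemma nonzerodivisor_mod_frob_power:
  assumes I: "ideal I R" and s: "s \<in> carrier R" and n: "nonzerodivisor_mod I s"
  shows "nonzerodivisor_mod (frob_power R I (p ^ e)) s"
proof (induction e)
  case 0
  have "(\<lambda>f. f [^] (1::nat)) ` I = I" using ideal_carr[OF I] by (auto simp: image_iff)
  then show ?case using n Idl_ideal[OF I] unfolding frob_power_def by simp
next
  case (Suc e)
  then show ?case unfolding frob_power_Suc[OF I]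
    by (intro nonzerodivisor_mod_frob_power_p frob_power_ideal ideal_sub[OF I] s)
qed

lemma p_linear_expand:
  assumes f: "p_linear p \<psi>" and x: "x \<in> carrier R"
  shows "\<psi> x = (\<Oplus>b\<in>B. \<pi> b x \<otimes> \<psi> b)"
proof -
  have "\<psi> (\<Oplus>b\<in>D. c b [^] p \<otimes> b) = (\<Oplus>b\<in>D. c b \<otimes> \<psi> b)"
    if "finite D" "D \<subseteq> B" "c \<in> B \<rightarrow> carrier R" for D c
    using that
  proof (induction D rule: finite_induct)
    case (insert b D)
    then have c: "b \<in> carrier R" "c b \<in> carrier R" "(\<lambda>b. c b [^] p \<otimes> b) \<in> D \<rightarrow> carrier R"
      "(\<lambda>b. c b \<otimes> \<psi> b) \<in> D \<rightarrow> carrier R"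
      using basis_carrier p_linear_closed[OF f] by (auto simp: subset_iff Pi_iff)
    then show ?case
      using insert p_linear_add[OF f, of "c b [^] p \<otimes> b" "\<Oplus>b\<in>D. c b [^] p \<otimes> b"]
        p_linear_smult[OF f, of "c b" b] p_linear_closed[OF f, of b] finsum_closed[of "\<lambda>b. c b [^] p \<otimes> b" D]
      by simp
  qed (simp add: p_linear_zero[OF f])
  from this[of B "\<lambda>b. \<pi> b x"] have "\<psi> (frob_sum B (\<lambda>b. \<pi> b x)) = (\<Oplus>b\<in>B. \<pi> b x \<otimes> \<psi> b)"
    unfolding frob_sum_def using finite_basis dual_closed x by auto
  then show ?thesis using expansion[OF x] by simp
qed

text \<open>\<open>v b\<close> is the coefficient belonging to \<open>b\<close>. As \<open>B\<close>
  may be dependent, the resulting map need not take the value \<open>v b\<close> at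
  \<open>b\<close>.\<close>

lemma p_linear_of_values:
  assumes v: "v \<in> B \<rightarrow> carrier R"
  shows "p_linear p (\<lambda>x. \<Oplus>b\<in>B. \<pi> b x \<otimes> v b)"
  unfolding p_linear_def
proof (intro conjI ballI)
  show "(\<lambda>x. \<Oplus>b\<in>B. \<pi> b x \<otimes> v b) \<in> carrier R \<rightarrow> carrier R"
    using v dual_closed by (auto intro!: finsum_closed simp: Pi_iff)
  fix x y assume x: "x \<in> carrier R" and y: "y \<in> carrier R"
  have "(\<Oplus>b\<in>B. \<pi> b (x \<oplus> y) \<otimes> v b) = (\<Oplus>b\<in>B. \<pi> b x \<otimes> v b \<oplus> \<pi> b y \<otimes> v b)"
    using v x y dual_closed p_linear_add[OF dual_p_linear x y]
    by (intro finsum_cong') (auto simp: Pi_iff l_distr)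
  also have "\<dots> = (\<Oplus>b\<in>B. \<pi> b x \<otimes> v b) \<oplus> (\<Oplus>b\<in>B. \<pi> b y \<otimes> v b)"
    using v x y dual_closed by (intro finsum_addf) (auto simp: Pi_iff)
  finally show "(\<Oplus>b\<in>B. \<pi> b (x \<oplus> y) \<otimes> v b) = (\<Oplus>b\<in>B. \<pi> b x \<otimes> v b) \<oplus> (\<Oplus>b\<in>B. \<pi> b y \<otimes> v b)" .
  have "x \<otimes> (\<Oplus>b\<in>B. \<pi> b y \<otimes> v b) = (\<Oplus>b\<in>B. x \<otimes> (\<pi> b y \<otimes> v b))"
    using v x y dual_closed finite_basis by (intro finsum_rdistr) (auto simp: Pi_iff)
  also have "\<dots> = (\<Oplus>b\<in>B. \<pi> b (x [^] p \<otimes> y) \<otimes> v b)"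
    using v x y dual_closed p_linear_smult[OF dual_p_linear x y]
    by (intro finsum_cong') (auto simp: Pi_iff m_assoc)
  finally show "(\<Oplus>b\<in>B. \<pi> b (x [^] p \<otimes> y) \<otimes> v b) = x \<otimes> (\<Oplus>b\<in>B. \<pi> b y \<otimes> v b)" by simp
qed

text \<open>Projectivity of the Frobenius module: it is enough to divide the finitely many values
  \<open>\<eta> b\<close> by \<open>a\<close> modulo \<open>J\<close>, since \<open>\<eta>\<close>
  is determined by them through the expansion.\<close>

lemma p_linear_div:
  assumes f: "p_linear p \<eta>" and J: "ideal J R" and a: "a \<in> carrier R"
    and h: "\<And>x. x \<in> carrier R \<Longrightarrow> \<eta> x \<in> Idl (insert a J)"
  obtains \<beta> where "p_linear p \<beta>" "\<And>x. x \<in> carrier R \<Longrightarrow> \<eta> x \<ominus> a \<otimes> \<beta> x \<in> J"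
proof -
  have "\<forall>b\<in>B. \<exists>j v. j \<in> J \<and> v \<in> carrier R \<and> \<eta> b = j \<oplus> v \<otimes> a"
    using h basis_carrier unfolding Idl_insert_iff[OF J a] by blast
  then obtain j v where jv: "\<forall>b\<in>B. j b \<in> J \<and> v b \<in> carrier R \<and> \<eta> b = j b \<oplus> v b \<otimes> a" by metis
  have jc: "\<And>b. b \<in> B \<Longrightarrow> j b \<in> carrier R" using jv ideal_carr[OF J] by blast
  let ?\<beta> = "\<lambda>x. \<Oplus>b\<in>B. \<pi> b x \<otimes> v b"
  have bl: "p_linear p ?\<beta>" using jv by (intro p_linear_of_values) auto
  have "\<eta> x \<ominus> a \<otimes> ?\<beta> x \<in> J" if x: "x \<in> carrier R" for x
  proof -
    have sum_in: "(\<Oplus>b\<in>D. \<pi> b x \<otimes> j b) \<in> J" if "finite D" "D \<subseteq> B" for D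
      using that
    proof (induction D rule: finite_induct)
      case (insert b D)
      have "(\<Oplus>b\<in>insert b D. \<pi> b x \<otimes> j b) = \<pi> b x \<otimes> j b \<oplus> (\<Oplus>b\<in>D. \<pi> b x \<otimes> j b)"
        using insert dual_closed x jc by (intro finsum_insert) auto
      then show ?case using insert jv dual_closed x by (auto intro!: ideal_add[OF J] ideal_lmult[OF J])
    qed (simp add: ideal_0[OF J])
    have c1: "(\<lambda>b. \<pi> b x \<otimes> j b) \<in> B \<rightarrow> carrier R" "(\<lambda>b. \<pi> b x \<otimes> v b) \<in> B \<rightarrow> carrier R"
      using jc jv dual_closed x by auto
    have "\<eta> x = (\<Oplus>b\<in>B. \<pi> b x \<otimes> \<eta> b)" by (rule p_linear_expand[OF f x])
    also have "\<dots> = (\<Oplus>b\<in>B. \<pi> b x \<otimes> j b \<oplus> a \<otimes> (\<pi> b x \<otimes> v b))"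
    proof (rule finsum_cong')
      fix b assume b: "b \<in> B"
      then have c: "\<pi> b x \<in> carrier R" "j b \<in> carrier R" "v b \<in> carrier R" using jv jc dual_closed x by auto
      have "\<eta> b = j b \<oplus> v b \<otimes> a" using jv b by blast
      then show "\<pi> b x \<otimes> \<eta> b = \<pi> b x \<otimes> j b \<oplus> a \<otimes> (\<pi> b x \<otimes> v b)" using c a by algebra
    qed (use c1 a in auto)
    also have "\<dots> = (\<Oplus>b\<in>B. \<pi> b x \<otimes> j b) \<oplus> (\<Oplus>b\<in>B. a \<otimes> (\<pi> b x \<otimes> v b))"
      using c1 a by (intro finsum_addf) auto
    also have "(\<Oplus>b\<in>B. a \<otimes> (\<pi> b x \<otimes> v b)) = a \<otimes> ?\<beta> x"
      using c1 a finite_basis by (intro finsum_rdistr[symmetric]) auto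
    finally have e: "\<eta> x = (\<Oplus>b\<in>B. \<pi> b x \<otimes> j b) \<oplus> a \<otimes> ?\<beta> x" .
    have "(\<Oplus>b\<in>B. \<pi> b x \<otimes> j b) \<in> carrier R" "?\<beta> x \<in> carrier R" using c1 by auto
    moreover have "s \<oplus> a \<otimes> t \<ominus> a \<otimes> t = s" if "s \<in> carrier R" "t \<in> carrier R" for s t
      using that a by algebra
    ultimately have "\<eta> x \<ominus> a \<otimes> ?\<beta> x = (\<Oplus>b\<in>B. \<pi> b x \<otimes> j b)" unfolding e by blast
    then show ?thesis using sum_in[OF finite_basis] by simp
  qed
  then show thesis using that bl by blast
qed

text \<open>In terms of the module of \<open>p\<close>-linear maps, on which \<open>r\<close> acts by \<open>z \<mapsto> z (r \<cdot> _)\<close>: a map that every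
  \<open>f j\<close> multiplies into the submodule of maps with values in \<open>(f\<^sub>i)\<^sub>i\<close>, which is generated by
  multiples of the \<open>f\<^sub>i\<^sup>p\<close>, is a multiple of \<open>(\<Prod>f\<^sub>j)\<^sup>p\<^sup>-\<^sup>1\<close> modulo that submodule. For \<open>G = T\<close> this is the colon
  formula behind Fedder's criterion.\<close>

lemma fedder_colon:
  fixes f :: "'i \<Rightarrow> 'a"
  assumes "finite G" "G \<subseteq> T" "finite T" "f ` T \<subseteq> carrier R"
    and nzd: "\<And>S i. S \<subseteq> T \<Longrightarrow> i \<in> T \<Longrightarrow> i \<notin> S \<Longrightarrow> nonzerodivisor_mod (Idl (f ` S)) (f i)"
    and "p_linear p z" "\<And>j x. j \<in> G \<Longrightarrow> x \<in> carrier R \<Longrightarrow> z (f j \<otimes> x) \<in> Idl (f ` T)"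
  shows "\<exists>\<psi>. p_linear p \<psi> \<and> (\<forall>x\<in>carrier R. z x \<ominus> \<psi> ((\<Otimes>j\<in>G. f j) [^] (p - 1) \<otimes> x) \<in> Idl (f ` T))"
  using assms
proof (induction G arbitrary: T z rule: finite_induct)
  case (empty T z)
  have "z x \<ominus> z x \<in> Idl (f ` T)" if "x \<in> carrier R" for x
    using that p_linear_closed[OF empty(5)] ideal_0[OF genideal_ideal[OF empty(3)]] by (simp add: minus_eq r_neg)
  then show ?case using empty(5) by auto
next
  case (insert i G T z)
  note fT = insert.prems(3) and nzd = insert.prems(4) and z = insert.prems(5)
  define T' where "T' = T - {i}"
  have iT: "i \<in> T" "i \<notin> T'" and GT': "G \<subseteq> T'" and T'T: "T' \<subseteq> T" and TT': "T = insert i T'"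
    using insert unfolding T'_def by auto
  have fT': "f ` T' \<subseteq> carrier R" and fi: "f i \<in> carrier R" using fT T'T iT by auto
  have fj: "f j \<in> carrier R" if "j \<in> G" for j using that insert.prems(1) fT by auto
  have Ii: "ideal (Idl (f ` T)) R" and Ii': "ideal (Idl (f ` T')) R" using fT fT' genideal_ideal by auto
  have I'I: "Idl (f ` T') \<subseteq> Idl (f ` T)" using T'T fT by (intro subset_Idl_subset) auto
  have II': "Idl (f ` T) = Idl (insert (f i) (Idl (f ` T')))"
    unfolding TT' using Idl_insert_Idl[OF fT' fi] by simp
  obtain k where k: "p = Suc k" using p_gt_1 by (cases p) auto
  let ?g = "(\<Otimes>j\<in>G. f j) [^] (p - 1)"
  have gc: "(\<Otimes>j\<in>G. f j) \<in> carrier R" using fj by auto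
  then have gp: "?g \<in> carrier R" by simp
  let ?h = "f i [^] (p - 1)"
  have hc: "?h \<in> carrier R" using fi by simp
  have hmul: "?h \<otimes> (f i \<otimes> x) = f i [^] p \<otimes> x" if "x \<in> carrier R" for x
    using that fi k by (simp add: m_assoc)
  \<comment> \<open>The induction hypothesis is used twice: here for \<open>z\<close> with the same
    \<open>T\<close>, which splits off the factor belonging to \<open>G\<close>, and later for a
    quotient map \<open>\<beta>\<close> with the smaller set \<open>T'\<close>.\<close>
  obtain \<alpha> where \<alpha>: "p_linear p \<alpha>"
    "\<And>x. x \<in> carrier R \<Longrightarrow> z x \<ominus> \<alpha> (?g \<otimes> x) \<in> Idl (f ` T)"
    using insert.IH[of T z] insert.prems by auto
  define \<zeta> where "\<zeta> = (\<lambda>x. \<alpha> (?g \<otimes> x))"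
  have \<zeta>: "p_linear p \<zeta>" unfolding \<zeta>_def by (rule p_linear_comp_mult[OF \<alpha>(1) gp])
  have \<zeta>i: "\<zeta> (f i \<otimes> x) \<in> Idl (insert (f i) (Idl (f ` T')))" if x: "x \<in> carrier R" for x
  proof -
    have c: "z (f i \<otimes> x) \<in> carrier R" "\<zeta> (f i \<otimes> x) \<in> carrier R" using z \<zeta> x fi p_linear_closed by auto
    have "z (f i \<otimes> x) \<ominus> \<zeta> (f i \<otimes> x) \<in> Idl (f ` T)" unfolding \<zeta>_def using \<alpha>(2) x fi by simp
    moreover have "z (f i \<otimes> x) \<in> Idl (f ` T)" using insert.prems(6) x by simp
    ultimately have "z (f i \<otimes> x) \<ominus> (z (f i \<otimes> x) \<ominus> \<zeta> (f i \<otimes> x)) \<in> Idl (f ` T)"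
      using ideal_diff[OF Ii] by blast
    moreover have "z (f i \<otimes> x) \<ominus> (z (f i \<otimes> x) \<ominus> \<zeta> (f i \<otimes> x)) = \<zeta> (f i \<otimes> x)" using c by algebra
    ultimately show ?thesis using II' by simp
  qed
  obtain \<beta> where \<beta>: "p_linear p \<beta>"
    "\<And>x. x \<in> carrier R \<Longrightarrow> \<zeta> (f i \<otimes> x) \<ominus> f i \<otimes> \<beta> x \<in> Idl (f ` T')"
    by (rule p_linear_div[OF p_linear_comp_mult[OF \<zeta> fi] Ii' fi \<zeta>i]) (assumption, rule that)
  have cancel: "\<theta> x \<in> Idl (f ` T')"
    if \<theta>: "p_linear p \<theta>" "\<And>x. x \<in> carrier R \<Longrightarrow> \<theta> (f i \<otimes> x) \<in> Idl (f ` T')" and x: "x \<in> carrier R" for \<theta> x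
  proof -
    have "\<theta> (f i \<otimes> (?h \<otimes> x)) \<in> Idl (f ` T')" using \<theta>(2) x fi by simp
    moreover have "f i \<otimes> (?h \<otimes> x) = f i [^] p \<otimes> x"
      using fi x hmul[OF x] by (simp add: m_lcomm)
    ultimately have "f i \<otimes> \<theta> x \<in> Idl (f ` T')" using p_linear_smult[OF \<theta>(1) fi x] by simp
    then show ?thesis using nonzerodivisor_modD[OF nzd[OF T'T iT]] p_linear_closed[OF \<theta>(1) x] by blast
  qed
  define \<theta> where "\<theta> = (\<lambda>x. \<zeta> x \<ominus> \<beta> (?h \<otimes> x))"
  have \<beta>h: "p_linear p (\<lambda>x. \<beta> (?h \<otimes> x))" by (rule p_linear_comp_mult[OF \<beta>(1) hc])
  have \<theta>: "\<theta> x \<in> Idl (f ` T')" if x: "x \<in> carrier R" for x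
  proof (rule cancel[OF _ _ x])
    show "p_linear p \<theta>" unfolding \<theta>_def by (rule p_linear_diff[OF \<zeta> \<beta>h])
    fix x assume x: "x \<in> carrier R"
    show "\<theta> (f i \<otimes> x) \<in> Idl (f ` T')"
      using \<beta>(2)[OF x] unfolding \<theta>_def hmul[OF x] p_linear_smult[OF \<beta>(1) fi x] .
  qed
  have \<beta>j: "\<beta> (f j \<otimes> x) \<in> Idl (f ` T')" if j: "j \<in> G" and x: "x \<in> carrier R" for j x
  proof -
    have "\<beta> (f j \<otimes> (?h \<otimes> y)) \<in> Idl (f ` T')" if y: "y \<in> carrier R" for y
    proof -
      have jy: "f j \<otimes> y \<in> carrier R" using fj[OF j] y by simp
      have fjI: "f j \<in> Idl (f ` T')" using j GT' genideal_self[OF fT'] by blast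
      define r where "r = (\<Otimes>l\<in>G - {j}. f l)"
      have rc: "r \<in> carrier R" unfolding r_def using fj by auto
      have "G = insert j (G - {j})" using j by blast
      then have "(\<Otimes>l\<in>G. f l) = (\<Otimes>l\<in>insert j (G - {j}). f l)" by simp
      also have "\<dots> = f j \<otimes> r"
        unfolding r_def using insert.hyps fj j by (intro finprod_insert) auto
      finally have "?g = f j [^] k \<otimes> r [^] k" using fj[OF j] rc k by (simp add: nat_pow_distrib)
      then have "?g \<otimes> (f j \<otimes> y) = f j [^] p \<otimes> (r [^] k \<otimes> y)"
        unfolding k using fj[OF j] rc y by (simp add: m_ac)
      then have "\<zeta> (f j \<otimes> y) = f j \<otimes> \<alpha> (r [^] k \<otimes> y)"
        unfolding \<zeta>_def using p_linear_smult[OF \<alpha>(1) fj[OF j], of "r [^] k \<otimes> y"] rc y by simp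
      then have 1: "\<zeta> (f j \<otimes> y) \<in> Idl (f ` T')"
        using ideal_rmult[OF Ii' fjI] p_linear_closed[OF \<alpha>(1)] rc y by simp
      have c: "\<zeta> (f j \<otimes> y) \<in> carrier R" "\<beta> (?h \<otimes> (f j \<otimes> y)) \<in> carrier R"
        using p_linear_closed[OF \<zeta> jy] p_linear_closed[OF \<beta>h jy] by auto
      have "\<zeta> (f j \<otimes> y) \<ominus> \<theta> (f j \<otimes> y) \<in> Idl (f ` T')" using ideal_diff[OF Ii' 1 \<theta>[OF jy]] .
      moreover have "\<zeta> (f j \<otimes> y) \<ominus> \<theta> (f j \<otimes> y) = \<beta> (?h \<otimes> (f j \<otimes> y))" unfolding \<theta>_def using c by algebra
      moreover have "?h \<otimes> (f j \<otimes> y) = f j \<otimes> (?h \<otimes> y)" using fj[OF j] hc y by (simp add: m_lcomm)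
      ultimately show ?thesis by simp
    qed
    from this[of "f i \<otimes> x"] have "\<beta> (f j \<otimes> (f i [^] p \<otimes> x)) \<in> Idl (f ` T')"
      using hmul[OF x] fi x by simp
    moreover have "f j \<otimes> (f i [^] p \<otimes> x) = f i [^] p \<otimes> (f j \<otimes> x)" using fi fj[OF j] x by (simp add: m_lcomm)
    ultimately have 2: "f i \<otimes> \<beta> (f j \<otimes> x) \<in> Idl (f ` T')"
      using p_linear_smult[OF \<beta>(1) fi, of "f j \<otimes> x"] fj[OF j] x by simp
    have "f j \<otimes> x \<in> carrier R" using fj[OF j] x by simp
    then show ?thesis
      using nonzerodivisor_modD[OF nzd[OF T'T iT] p_linear_closed[OF \<beta>(1)] 2] by blast
  qed
  have "\<exists>\<psi>. p_linear p \<psi> \<and> (\<forall>x\<in>carrier R. \<beta> x \<ominus> \<psi> (?g \<otimes> x) \<in> Idl (f ` T'))"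
  proof (rule insert.IH[OF GT' _ fT' _ \<beta>(1) \<beta>j])
    show "finite T'" using insert.prems(2) unfolding T'_def by simp
    show "nonzerodivisor_mod (Idl (f ` S)) (f l)" if "S \<subseteq> T'" "l \<in> T'" "l \<notin> S" for S l
      using that T'T by (intro nzd) auto
  qed
  then obtain \<psi> where \<psi>: "p_linear p \<psi>" "\<And>x. x \<in> carrier R \<Longrightarrow> \<beta> x \<ominus> \<psi> (?g \<otimes> x) \<in> Idl (f ` T')"
    by blast
  have "z x \<ominus> \<psi> ((\<Otimes>j\<in>insert i G. f j) [^] (p - 1) \<otimes> x) \<in> Idl (f ` T)" if x: "x \<in> carrier R" for x
  proof -
    have hx: "?h \<otimes> x \<in> carrier R" using hc x by simp
    have "(\<Otimes>j\<in>insert i G. f j) = f i \<otimes> (\<Otimes>j\<in>G. f j)"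
      using insert.hyps fj fi by (intro finprod_insert) auto
    then have e: "(\<Otimes>j\<in>insert i G. f j) [^] (p - 1) \<otimes> x = ?g \<otimes> (?h \<otimes> x)"
      using fi gc x by (simp add: nat_pow_distrib m_ac)
    have c: "z x \<in> carrier R" "\<zeta> x \<in> carrier R" "\<beta> (?h \<otimes> x) \<in> carrier R" "\<psi> (?g \<otimes> (?h \<otimes> x)) \<in> carrier R"
      using p_linear_closed[OF z x] p_linear_closed[OF \<zeta> x] p_linear_closed[OF \<beta>h x]
        p_linear_closed[OF \<psi>(1), of "?g \<otimes> (?h \<otimes> x)"] gp hx by auto
    have "z x \<ominus> \<psi> (?g \<otimes> (?h \<otimes> x)) =
        (z x \<ominus> \<zeta> x) \<oplus> ((\<zeta> x \<ominus> \<beta> (?h \<otimes> x)) \<oplus> (\<beta> (?h \<otimes> x) \<ominus> \<psi> (?g \<otimes> (?h \<otimes> x))))"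
      using c by algebra
    also have "\<dots> \<in> Idl (f ` T)"
      using \<alpha>(2)[OF x] \<theta>[OF x] \<psi>(2)[OF hx] I'I unfolding \<zeta>_def \<theta>_def
      by (intro ideal_add[OF Ii]) auto
    finally show ?thesis unfolding e .
  qed
  then show ?case using \<psi>(1) by blast
qed

end

locale frobenius_dual_basis_local = noetherian_local + frobenius_dual_basis
begin

text \<open>The map \<open>\<phi>\<close> represents a splitting on the quotient by the sequence.
  \<open>fedder_colon\<close> writes it as \<open>\<psi>\<close> applied to multiples of
  \<open>?g [^] (p - 1)\<close> up to values in the ideal, so \<open>\<psi> (?g [^] (p - 1))\<close>
  is congruent to 1 modulo \<open>\<mm>\<close>, a unit.\<close>

lemma fedder:
  fixes fs :: "'a list"
  assumes fs: "set fs \<subseteq> \<mm>" and reg: "regular_mod (Idl {}) fs" and \<phi>: "p_linear p \<phi>"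
    and comp: "\<And>x. x \<in> Idl (set fs) \<Longrightarrow> \<phi> x \<in> Idl (set fs)" and one: "\<phi> \<one> \<ominus> \<one> \<in> Idl (set fs)"
  shows "(\<Otimes>j\<in>{..<length fs}. fs ! j) [^] (p ^ e - 1) \<notin> frob_power R \<mm> (p ^ e)"
proof -
  let ?T = "{..<length fs}"
  let ?g = "\<Otimes>j\<in>?T. fs ! j"
  have im: "(!) fs ` ?T = set fs" by (auto simp: set_conv_nth)
  have sc: "set fs \<subseteq> carrier R" using fs ideal_sub[OF ideal_max] by blast
  have fjc: "fs ! j \<in> carrier R" if "j < length fs" for j using that sc by auto
  note Ii = genideal_ideal[OF sc] and Is = genideal_self[OF sc]
  have Im: "Idl (set fs) \<subseteq> \<mm>" using fs by (rule genideal_minimal[OF ideal_max])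
  have gc: "?g \<in> carrier R" using fjc by (intro finprod_closed) auto
  have "\<exists>\<psi>. p_linear p \<psi> \<and> (\<forall>x\<in>carrier R. \<phi> x \<ominus> \<psi> (?g [^] (p - 1) \<otimes> x) \<in> Idl ((!) fs ` ?T))"
  proof (rule fedder_colon)
    show "(!) fs ` ?T \<subseteq> carrier R" using im sc by simp
    show "nonzerodivisor_mod (Idl ((!) fs ` S)) (fs ! i)" if "S \<subseteq> ?T" "i \<in> ?T" "i \<notin> S" for S i
      using regular_nonzerodivisor[OF fs reg] that by simp
    show "\<phi> (fs ! j \<otimes> x) \<in> Idl ((!) fs ` ?T)" if "j \<in> ?T" "x \<in> carrier R" for j x
      unfolding im using that Is by (intro comp ideal_rmult[OF Ii]) auto
  qed (use \<phi> in auto)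
  then obtain \<psi> where \<psi>: "p_linear p \<psi>" "\<phi> \<one> \<ominus> \<psi> (?g [^] (p - 1) \<otimes> \<one>) \<in> Idl (set fs)"
    unfolding im by blast
  define u where "u = \<psi> (?g [^] (p - 1))"
  have uc: "u \<in> carrier R" unfolding u_def using p_linear_closed[OF \<psi>(1)] gc by simp
  have \<phi>c: "\<phi> \<one> \<in> carrier R" using p_linear_closed[OF \<phi>] by simp
  have um: "u \<notin> \<mm>"
  proof
    assume u: "u \<in> \<mm>"
    have "\<phi> \<one> \<ominus> u \<in> \<mm>" using \<psi>(2) Im gc unfolding u_def by auto
    then have "(\<phi> \<one> \<ominus> u) \<oplus> u \<ominus> (\<phi> \<one> \<ominus> \<one>) \<in> \<mm>"
      using ideal_diff[OF ideal_max ideal_add[OF ideal_max _ u]] one Im by blast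
    moreover have "(\<phi> \<one> \<ominus> u) \<oplus> u \<ominus> (\<phi> \<one> \<ominus> \<one>) = \<one>" using \<phi>c uc by algebra
    ultimately show False using prime_one[OF prime_max] by simp
  qed
  show ?thesis
  proof (induction e)
    case 0
    have "(\<lambda>f. f [^] (1::nat)) ` \<mm> = \<mm>" using ideal_carr[OF ideal_max] by (auto simp: image_iff)
    then have "frob_power R \<mm> 1 = \<mm>" unfolding frob_power_def using Idl_ideal[OF ideal_max] by simp
    then show ?case using prime_one[OF prime_max] by simp
  next
    case (Suc e)
    let ?q = "p ^ e"
    have Fi: "ideal (frob_power R \<mm> ?q) R" by (rule frob_power_ideal[OF ideal_sub[OF ideal_max]])
    show ?case
    proof
      assume a: "?g [^] (p ^ Suc e - 1) \<in> frob_power R \<mm> (p ^ Suc e)"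
      have "?q \<ge> 1" "p \<ge> 1" using p_gt_1 by auto
      then obtain k l where kl: "?q = Suc k" "p = Suc l" by (metis Suc_le_D One_nat_def)
      \<comment> \<open>The exponent splits as p q - 1 = p (q - 1) + (p - 1). So
        \<open>\<psi>\<close> turns the power of \<open>?g\<close> for p q into a unit times the one
        for q, while it maps the corresponding Frobenius power of \<open>\<mm>\<close> into the
        previous one.\<close>
      have "p ^ Suc e = p * Suc k" using kl(1) by simp
      then have "p ^ Suc e - 1 = k * p + (p - 1)" using kl(2) by (simp add: algebra_simps)
      then have "?g [^] (p ^ Suc e - 1) = (?g [^] (?q - 1)) [^] p \<otimes> ?g [^] (p - 1)"
        using gc kl(1) by (simp add: nat_pow_mult nat_pow_pow)
      then have "\<psi> (?g [^] (p ^ Suc e - 1)) = ?g [^] (?q - 1) \<otimes> u"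
        unfolding u_def using p_linear_smult[OF \<psi>(1)] gc by simp
      moreover have "\<psi> (?g [^] (p ^ Suc e - 1)) \<in> frob_power R \<mm> ?q"
        using a unfolding frob_power_Suc[OF ideal_max] by (rule p_linear_frob_power[OF \<psi>(1) Fi])
      ultimately have "u \<otimes> ?g [^] (?q - 1) \<in> frob_power R \<mm> ?q" using uc gc by (simp add: m_comm)
      then have "?g [^] (?q - 1) \<in> saturation \<mm> (frob_power R \<mm> ?q)"
        unfolding saturation_def using uc um gc by blast
      then show False using Suc saturation_max[OF Fi] by simp
    qed
  qed
qed

end

section \<open>Localization\<close>

text \<open>A finite supremum is attained, and the top of a longest chain may be replaced by
  \<open>M\<close>. In dimension 0 the chain consisting of \<open>M\<close> alone serves.\<close>

lemma chain_between_of_krull_dim: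
  assumes M: "primeideal M R" "\<And>Q. primeideal Q R \<Longrightarrow> Q \<subseteq> M" and d: "krull_dim R = enat d"
  shows "chain_between R {} d M"
proof (cases d)
  case 0
  then show ?thesis using M unfolding chain_between_def prime_chain_def by (intro exI[of _ "\<lambda>_. M"]) auto
next
  case (Suc k)
  let ?S = "{enat n |n. \<exists>q. prime_chain R n q}"
  have "?S \<noteq> {}" "finite ?S" using d Suc unfolding krull_dim_def Sup_enat_def
    by (auto split: if_splits simp: zero_enat_def)
  then have "enat d \<in> ?S" using d Max_in[of ?S] unfolding krull_dim_def Sup_enat_def by (auto split: if_splits)
  then obtain q where q: "prime_chain R d q" by blast
  have "q k \<subset> M" using q M(2)[of "q d"] unfolding Suc prime_chain_def by (meson le_refl lessI psubset_subset_trans)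
  then have "prime_chain R d (q(d := M))"
    using q M(1) unfolding Suc prime_chain_def by (auto simp: less_Suc_eq)
  then show ?thesis unfolding chain_between_def by (intro exI[of _ "q(d := M)"]) auto
qed

context frobenius_ring
begin

text \<open>\<open>g\<close> may send several elements to the same generator; their coefficients are
  added inside the p-th power. This matters since distinct generators over R can become equal in a
  localization.\<close>

lemma frob_combination:
  assumes B: "finite B" "B \<subseteq> carrier R" and "finite D" "g \<in> D \<rightarrow> B" "d \<in> D \<rightarrow> carrier R"
  shows "\<exists>c\<in>B \<rightarrow> carrier R. (\<Oplus>x\<in>D. d x [^] p \<otimes> g x) = frob_sum B c"
  using assms(3-5)
proof (induction D rule: finite_induct)
  case empty
  show ?case using frob_sum_zero[OF B(2)] by (intro bexI[of _ "\<lambda>_. \<zero>"]) auto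
next
  case (insert x D)
  then obtain c where c: "c \<in> B \<rightarrow> carrier R" "(\<Oplus>x\<in>D. d x [^] p \<otimes> g x) = frob_sum B c" by auto
  have x: "g x \<in> B" "g x \<in> carrier R" "d x \<in> carrier R" using insert.prems B by auto
  define e where "e = (\<lambda>b. if g x = b then d x else \<zero>)"
  have e: "e \<in> B \<rightarrow> carrier R" using x unfolding e_def by auto
  have "frob_sum B e = (\<Oplus>b\<in>B. if g x = b then d x [^] p \<otimes> b else \<zero>)"
    unfolding frob_sum_def e_def using B x by (intro finsum_cong') (auto simp: zero_pow_p subset_iff)
  also have "\<dots> = d x [^] p \<otimes> g x"
    using x B by (intro finsum_singleton) auto
  finally have 1: "frob_sum B e = d x [^] p \<otimes> g x" .
  have "(\<Oplus>x\<in>insert x D. d x [^] p \<otimes> g x) = d x [^] p \<otimes> g x \<oplus> (\<Oplus>x\<in>D. d x [^] p \<otimes> g x)"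
    using insert B by (intro finsum_insert) (auto simp: Pi_iff subset_iff)
  also have "\<dots> = frob_sum B (\<lambda>b. e b \<oplus> c b)" unfolding 1[symmetric] c(2) frob_sum_add[OF B(2) e c(1)] ..
  finally show ?case using e c(1) by (intro bexI[of _ "\<lambda>b. e b \<oplus> c b"]) (auto simp: Pi_iff)
qed

lemma frob_generates_if_F_finite:
  assumes "F_finite R p"
  obtains B where "frob_generates B"
proof -
  have sum: "finsum (frob_module R p) f B = finsum R f B" for f :: "'a \<Rightarrow> 'a" and B
    unfolding finsum_def finprod_def frob_module_def by simp
  obtain B where "finite B" "B \<subseteq> carrier (frob_module R p)"
    "\<forall>x\<in>carrier (frob_module R p). \<exists>c\<in>B \<rightarrow> carrier R. x = (\<Oplus>\<^bsub>frob_module R p\<^esub>b\<in>B. c b \<odot>\<^bsub>frob_module R p\<^esub> b)"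
    using assms unfolding F_finite_def finite_module_def by blast
  then have "frob_generates B"
    unfolding frob_generates_def frob_sum_def sum by (simp add: frob_module_def)
  then show thesis by (rule that)
qed

end

text \<open>The ring axioms of the localization are an assumption here; interpretations obtain them
  from regularity through \<open>regular_local_cring\<close>.\<close>

locale cring_localization = primeideal + loc: cring "localization R I"
begin

abbreviation A where "A \<equiv> localization R I"

lemma frac_closed [simp]:
  "r \<in> carrier R \<Longrightarrow> s \<in> carrier R \<Longrightarrow> s \<notin> I \<Longrightarrow> loc_frac R I r s \<in> carrier A"
  unfolding localization_def by auto

lemma carrierE:
  assumes "a \<in> carrier A"
  obtains r s where "r \<in> carrier R" "s \<in> carrier R" "s \<notin> I" "a = loc_frac R I r s"
  using assms unfolding localization_def by auto

lemma one_loc: "\<one>\<^bsub>A\<^esub> = loc_map R I \<one>" and zero_loc: "\<zero>\<^bsub>A\<^esub> = loc_map R I \<zero>"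
  unfolding localization_def loc_map_def by auto

lemma one_notin: "\<one> \<notin> I"
  using compl_one by blast

lemma loc_map_closed [simp]: "r \<in> carrier R \<Longrightarrow> loc_map R I r \<in> carrier A"
  unfolding loc_map_def using one_notin by simp

lemma frac_mult:
  "r \<in> carrier R \<Longrightarrow> s \<in> carrier R \<Longrightarrow> s \<notin> I \<Longrightarrow> r' \<in> carrier R \<Longrightarrow> s' \<in> carrier R \<Longrightarrow> s' \<notin> I \<Longrightarrow>
   loc_frac R I r s \<otimes>\<^bsub>A\<^esub> loc_frac R I r' s' = loc_frac R I (r \<otimes> r') (s \<otimes> s')"
  by (rule localization_mult) auto

lemma frac_eqI:
  assumes "r \<in> carrier R" "s \<in> carrier R" "s \<notin> I" "r' \<in> carrier R" "s' \<in> carrier R" "s' \<notin> I"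
    and "s' \<otimes> r = s \<otimes> r'"
  shows "loc_frac R I r s = loc_frac R I r' s'"
  using assms compl_one by (subst loc_frac_eq_iff) auto

lemma loc_map_eqD:
  assumes "r \<in> carrier R" "r' \<in> carrier R" "loc_map R I r = loc_map R I r'"
  obtains u where "u \<in> carrier R" "u \<notin> I" "u \<otimes> r = u \<otimes> r'"
  using assms loc_frac_eq_iff[of r r' \<one> \<one>] compl_one unfolding loc_map_def by auto

lemma loc_map_hom: "loc_map R I \<in> ring_hom R A"
proof (rule ring_hom_memI)
  fix x y assume "x \<in> carrier R" "y \<in> carrier R"
  then show "loc_map R I (x \<otimes> y) = loc_map R I x \<otimes>\<^bsub>A\<^esub> loc_map R I y"
    "loc_map R I (x \<oplus> y) = loc_map R I x \<oplus>\<^bsub>A\<^esub> loc_map R I y"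
    unfolding loc_map_def using one_notin localization_mult[of x y \<one> \<one>] localization_add[of x y \<one> \<one>]
    by auto
qed (use one_loc in auto)

sublocale hom: ring_hom_cring R A "loc_map R I"
  using loc_map_hom by unfold_locales

lemma denom_mult_frac:
  assumes "r \<in> carrier R" "s \<in> carrier R" "s \<notin> I"
  shows "loc_map R I s \<otimes>\<^bsub>A\<^esub> loc_frac R I r s = loc_map R I r"
  unfolding loc_map_def using assms one_notin frac_eqI[of "s \<otimes> r" s r \<one>] by (simp add: frac_mult)

lemma frac_eq_mult:
  assumes "r \<in> carrier R" "s \<in> carrier R" "s \<notin> I"
  shows "loc_frac R I r s = loc_frac R I \<one> s \<otimes>\<^bsub>A\<^esub> loc_map R I r"
  unfolding loc_map_def using assms one_notin by (simp add: frac_mult)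

lemma frac_one_mult_denom:
  assumes "s \<in> carrier R" "s \<notin> I"
  shows "loc_frac R I \<one> s \<otimes>\<^bsub>A\<^esub> loc_map R I s = \<one>\<^bsub>A\<^esub>"
proof -
  have "loc_frac R I \<one> s \<otimes>\<^bsub>A\<^esub> loc_map R I s = loc_map R I s \<otimes>\<^bsub>A\<^esub> loc_frac R I \<one> s"
    using assms by (intro loc.m_comm) auto
  then show ?thesis using denom_mult_frac[of \<one> s] assms by simp
qed

lemma frac_in_ideal_iff:
  assumes J: "ideal J A" and "r \<in> carrier R" "s \<in> carrier R" "s \<notin> I"
  shows "loc_frac R I r s \<in> J \<longleftrightarrow> loc_map R I r \<in> J"
  using denom_mult_frac[OF assms(2-4)] frac_eq_mult[OF assms(2-4)] loc.ideal_lmult[OF J]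
    loc_map_closed[OF assms(3)] frac_closed[OF one_closed assms(3,4)] by metis

lemma contraction_ideal:
  assumes J: "ideal J A"
  shows "ideal {r \<in> carrier R. loc_map R I r \<in> J} R"
  using J by (intro cring_idealI) (auto simp: loc.ideal_rules)

definition extension :: "'a set \<Rightarrow> ('a \<times> 'a) set set" where
  "extension J = {loc_frac R I a s | a s. a \<in> J \<and> s \<in> carrier R \<and> s \<notin> I}"

text \<open>Fractions are equal only up to a factor outside the prime, and exactly such factors are
  absorbed by the saturation.\<close>

lemma frac_in_extension_iff:
  assumes J: "ideal J R" and r: "r \<in> carrier R" and s: "s \<in> carrier R" "s \<notin> I"
  shows "loc_frac R I r s \<in> extension J \<longleftrightarrow> r \<in> saturation I J"
proof
  assume "loc_frac R I r s \<in> extension J"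
  then obtain a t where a: "a \<in> J" "t \<in> carrier R" "t \<notin> I" "loc_frac R I r s = loc_frac R I a t"
    unfolding extension_def by blast
  have ac: "a \<in> carrier R" using a ideal_carr[OF J] by blast
  obtain u where u: "u \<in> carrier R" "u \<notin> I" "u \<otimes> (t \<otimes> r) = u \<otimes> (s \<otimes> a)"
    using loc_frac_eq_iff[of r a s t] r s ac a by auto
  have "(u \<otimes> t) \<otimes> r = (u \<otimes> s) \<otimes> a" using u a s r ac by (simp add: m_assoc)
  then have "(u \<otimes> t) \<otimes> r \<in> J" using u s a ideal_lmult[OF J] by simp
  moreover have "u \<otimes> t \<in> carrier R - I" using u a compl_mult by blast
  ultimately show "r \<in> saturation I J" unfolding saturation_def using r by blast
next
  assume "r \<in> saturation I J"
  then obtain u where u: "u \<in> carrier R" "u \<notin> I" "u \<otimes> r \<in> J" unfolding saturation_def by blast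
  have "u \<otimes> s \<in> carrier R - I" using u s compl_mult by blast
  moreover have "loc_frac R I r s = loc_frac R I (u \<otimes> r) (u \<otimes> s)"
    using u r s \<open>u \<otimes> s \<in> carrier R - I\<close> by (intro frac_eqI) (auto simp: m_ac)
  ultimately show "loc_frac R I r s \<in> extension J" using u unfolding extension_def by blast
qed

lemma extension_ideal:
  assumes J: "ideal J R"
  shows "ideal (extension J) A"
proof (rule loc.cring_idealI)
  have Jc: "\<And>a. a \<in> J \<Longrightarrow> a \<in> carrier R" using J ideal_carr by blast
  show "extension J \<subseteq> carrier A" unfolding extension_def using Jc by auto
  show "\<zero>\<^bsub>A\<^esub> \<in> extension J"
    unfolding zero_loc loc_map_def extension_def using ideal_0[OF J] one_notin by blast
  fix a b assume "a \<in> extension J" "b \<in> extension J"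
  then obtain x s y t where h: "x \<in> J" "s \<in> carrier R" "s \<notin> I" "a = loc_frac R I x s"
    "y \<in> J" "t \<in> carrier R" "t \<notin> I" "b = loc_frac R I y t" unfolding extension_def by blast
  have "a \<oplus>\<^bsub>A\<^esub> b = loc_frac R I (t \<otimes> x \<oplus> s \<otimes> y) (s \<otimes> t)"
    unfolding h(4,8) using h Jc by (intro localization_add) auto
  moreover have "t \<otimes> x \<oplus> s \<otimes> y \<in> J" using h by (intro ideal_add[OF J] ideal_lmult[OF J])
  moreover have "s \<otimes> t \<in> carrier R - I" using h compl_mult by blast
  ultimately show "a \<oplus>\<^bsub>A\<^esub> b \<in> extension J" unfolding extension_def by blast
next
  have Jc: "\<And>a. a \<in> J \<Longrightarrow> a \<in> carrier R" using J ideal_carr by blast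
  fix a c assume "a \<in> extension J" "c \<in> carrier A"
  then obtain x s y t where h: "x \<in> J" "s \<in> carrier R" "s \<notin> I" "a = loc_frac R I x s"
    "y \<in> carrier R" "t \<in> carrier R" "t \<notin> I" "c = loc_frac R I y t"
    unfolding extension_def by (auto elim!: carrierE)
  have "c \<otimes>\<^bsub>A\<^esub> a = loc_frac R I (y \<otimes> x) (t \<otimes> s)" unfolding h(4,8) using h Jc by (intro frac_mult) auto
  moreover have "y \<otimes> x \<in> J" using h by (intro ideal_lmult[OF J])
  moreover have "t \<otimes> s \<in> carrier R - I" using h compl_mult by blast
  ultimately show "c \<otimes>\<^bsub>A\<^esub> a \<in> extension J" unfolding extension_def by blast
qed

lemma Idl_loc_map_image:
  assumes S: "S \<subseteq> carrier R"
  shows "Idl\<^bsub>A\<^esub> (loc_map R I ` S) = extension (Idl S)"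
proof
  note i = genideal_ideal[OF S] and s = genideal_self[OF S]
  have c: "loc_map R I ` S \<subseteq> carrier A" using S by auto
  show "Idl\<^bsub>A\<^esub> (loc_map R I ` S) \<subseteq> extension (Idl S)"
    using s one_notin by (intro loc.genideal_minimal[OF extension_ideal[OF i]])
      (auto simp: extension_def loc_map_def)
  note iA = loc.genideal_ideal[OF c] and sA = loc.genideal_self[OF c]
  have "Idl S \<subseteq> {r \<in> carrier R. loc_map R I r \<in> Idl\<^bsub>A\<^esub> (loc_map R I ` S)}"
    using S sA by (intro genideal_minimal[OF contraction_ideal[OF iA]]) auto
  then show "extension (Idl S) \<subseteq> Idl\<^bsub>A\<^esub> (loc_map R I ` S)"
    unfolding extension_def using frac_in_ideal_iff[OF iA] by auto
qed

lemma loc_map_in_Idl_iff: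
  assumes "S \<subseteq> carrier R" "r \<in> carrier R"
  shows "loc_map R I r \<in> Idl\<^bsub>A\<^esub> (loc_map R I ` S) \<longleftrightarrow> r \<in> saturation I (Idl S)"
  unfolding Idl_loc_map_image[OF assms(1)]
  using frac_in_extension_iff[OF genideal_ideal[OF assms(1)] assms(2), of \<one>] one_notin
  by (simp add: loc_map_def)

lemma unit_if_notin:
  assumes J: "ideal J A" and "r \<in> carrier R" "r \<notin> I" "loc_map R I r \<in> J"
  shows "J = carrier A"
proof -
  have "\<one>\<^bsub>A\<^esub> \<in> J"
    using frac_one_mult_denom[OF assms(2,3)] loc.ideal_lmult[OF J assms(4)] assms(2,3)
    by (metis frac_closed one_closed)
  then show ?thesis by (rule ideal.one_imp_carrier[OF J])
qed

lemma contraction_prime: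
  assumes N: "primeideal N A"
  shows "primeideal {r \<in> carrier R. loc_map R I r \<in> N} R" "{r \<in> carrier R. loc_map R I r \<in> N} \<subseteq> I"
proof -
  have Ni: "ideal N A" using N primeideal.axioms(1) by blast
  show sub: "{r \<in> carrier R. loc_map R I r \<in> N} \<subseteq> I"
    using unit_if_notin[OF Ni] primeideal.I_notcarr[OF N] by blast
  show "primeideal {r \<in> carrier R. loc_map R I r \<in> N} R"
  proof (rule primeidealI[OF contraction_ideal[OF Ni] is_cring])
    show "carrier R \<noteq> {r \<in> carrier R. loc_map R I r \<in> N}" using sub one_notin by blast
    fix a b assume "a \<in> carrier R" "b \<in> carrier R" "a \<otimes> b \<in> {r \<in> carrier R. loc_map R I r \<in> N}"
    then show "a \<in> {r \<in> carrier R. loc_map R I r \<in> N} \<or> b \<in> {r \<in> carrier R. loc_map R I r \<in> N}"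
      using loc.prime_in_iff[OF N] by auto
  qed
qed

lemma contraction_psubset:
  assumes N: "ideal N A" "ideal N' A" "N \<subset> N'"
  shows "{r \<in> carrier R. loc_map R I r \<in> N} \<subset> {r \<in> carrier R. loc_map R I r \<in> N'}"
proof -
  obtain a where a: "a \<in> N'" "a \<notin> N" using N by blast
  then have "a \<in> carrier A" using loc.ideal_carr[OF N(2)] by blast
  then obtain r s where r: "r \<in> carrier R" "s \<in> carrier R" "s \<notin> I" "a = loc_frac R I r s" by (rule carrierE)
  have "loc_map R I r \<in> N'" "loc_map R I r \<notin> N"
    using a frac_in_ideal_iff[OF N(1) r(1-3)] frac_in_ideal_iff[OF N(2) r(1-3)] r(4) by auto
  then show ?thesis using r N by blast
qed

text \<open>Contraction to R keeps inclusions of primes strict and stays inside \<open>I\<close>.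
  The top of the contracted chain is replaced by \<open>I\<close>, so that the chain counts for the
  height.\<close>

lemma krull_dim_localization_le: "krull_dim A \<le> prime_height R I"
proof -
  have "enat n \<le> prime_height R I" if q: "prime_chain A n q" for n q
  proof -
    let ?c = "\<lambda>k. {r \<in> carrier R. loc_map R I r \<in> q k}"
    define q' where "q' = (\<lambda>k. if k = n then I else ?c k)"
    have pr: "primeideal (q k) A" if "k \<le> n" for k using q that unfolding prime_chain_def by blast
    then have id: "ideal (q k) A" if "k \<le> n" for k using that primeideal.axioms(1) by blast
    have "prime_chain R n q'" unfolding prime_chain_def
    proof (intro conjI allI impI)
      fix k assume "k \<le> n"
      then show "primeideal (q' k) R" unfolding q'_def using contraction_prime(1)[OF pr] primeideal by simp
    next
      fix k assume k: "k < n"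
      have "?c k \<subset> ?c (Suc k)"
        using q k id[of k] id[of "Suc k"] unfolding prime_chain_def by (intro contraction_psubset) auto
      moreover have "?c (Suc k) \<subseteq> I" using contraction_prime(2)[OF pr] k by simp
      ultimately show "q' k \<subset> q' (Suc k)" unfolding q'_def using k by auto
    qed
    moreover have "q' n = I" unfolding q'_def by simp
    ultimately show ?thesis unfolding prime_height_def by (intro Sup_upper) blast
  qed
  then show ?thesis unfolding krull_dim_def by (intro Sup_least) auto
qed

lemma frac_notin_extension:
  assumes "r \<in> carrier R" "s \<in> carrier R" "s \<notin> I"
  shows "loc_frac R I r s \<in> extension I \<longleftrightarrow> r \<in> I"
  unfolding frac_in_extension_iff[OF is_ideal assms] using saturation_prime[OF primeideal primeideal] by simp

lemma extension_maximal: "maximalideal (extension I) A"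
proof (rule maximalidealI[OF extension_ideal[OF is_ideal]])
  have "loc_frac R I \<one> \<one> \<notin> extension I" using frac_notin_extension one_notin by simp
  moreover have "loc_frac R I \<one> \<one> \<in> carrier A" using one_notin by simp
  ultimately show "carrier A \<noteq> extension I" by blast
  fix J assume J: "ideal J A" "extension I \<subseteq> J" "J \<subseteq> carrier A"
  show "J = extension I \<or> J = carrier A"
  proof (rule disjCI)
    assume "J \<noteq> carrier A"
    have "J \<subseteq> extension I"
    proof
      fix a assume a: "a \<in> J"
      then have "a \<in> carrier A" using J(3) by blast
      then obtain r s where r: "r \<in> carrier R" "s \<in> carrier R" "s \<notin> I" "a = loc_frac R I r s"
        by (rule carrierE)
      have "loc_map R I r \<in> J" using a r frac_in_ideal_iff[OF J(1)] by simp
      then have "r \<in> I" using unit_if_notin[OF J(1) r(1)] \<open>J \<noteq> carrier A\<close> by blast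
      then show "a \<in> extension I" using r frac_notin_extension by simp
    qed
    then show "J = extension I" using J by blast
  qed
qed

lemma maximal_ideal_eq:
  assumes "local_ring A M"
  shows "M = extension I"
  using assms extension_maximal unfolding local_ring_def by blast

text \<open>Clearing denominators in generators of the maximal ideal of \<open>A\<close> yields
  elements of the prime itself that generate it up to saturation; there are at most as many as the
  dimension of \<open>A\<close>.\<close>

lemma regular_generators:
  assumes "regular_local_ring A"
  obtains Z where "finite Z" "Z \<subseteq> I" "enat (card Z) \<le> prime_height R I" "I \<subseteq> saturation I (Idl Z)"
proof -
  obtain M S where M: "local_ring A M" "S \<subseteq> carrier A" "finite S" "M = Idl\<^bsub>A\<^esub> S" "enat (card S) = krull_dim A"
    using assms unfolding regular_local_ring_def by blast
  have Me: "M = extension I" by (rule maximal_ideal_eq[OF M(1)])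
  have "S \<subseteq> extension I" using loc.genideal_self[OF M(2)] M(4) Me by simp
  then have "\<forall>a\<in>S. \<exists>r. r \<in> I \<and> (\<exists>s. s \<in> carrier R \<and> s \<notin> I \<and> a = loc_frac R I r s)"
    unfolding extension_def by blast
  then obtain g where g: "\<forall>a\<in>S. g a \<in> I \<and> (\<exists>s. s \<in> carrier R \<and> s \<notin> I \<and> a = loc_frac R I (g a) s)" by metis
  let ?Z = "g ` S"
  have ZI: "?Z \<subseteq> I" using g by blast
  have Zc: "?Z \<subseteq> carrier R" using ZI a_subset by blast
  have c: "loc_map R I ` ?Z \<subseteq> carrier A" using Zc by auto
  note iA = loc.genideal_ideal[OF c] and sA = loc.genideal_self[OF c]
  have "M \<subseteq> Idl\<^bsub>A\<^esub> (loc_map R I ` ?Z)" unfolding M(4)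
  proof (rule loc.genideal_minimal[OF iA], rule subsetI)
    fix a assume a: "a \<in> S"
    then obtain s where s: "s \<in> carrier R" "s \<notin> I" "a = loc_frac R I (g a) s" using g by blast
    have "g a \<in> carrier R" using a Zc by blast
    then have "loc_frac R I (g a) s \<in> Idl\<^bsub>A\<^esub> (loc_map R I ` ?Z)"
      using frac_in_ideal_iff[OF iA _ s(1,2)] sA a by blast
    then show "a \<in> Idl\<^bsub>A\<^esub> (loc_map R I ` ?Z)" using s(3) by simp
  qed
  then have sub: "extension I \<subseteq> Idl\<^bsub>A\<^esub> (loc_map R I ` ?Z)" unfolding Me .
  have "I \<subseteq> saturation I (Idl ?Z)"
  proof
    fix z assume z: "z \<in> I"
    then have "loc_map R I z \<in> extension I" unfolding loc_map_def extension_def using one_notin by blast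
    then have "loc_map R I z \<in> Idl\<^bsub>A\<^esub> (loc_map R I ` ?Z)" using sub by blast
    then show "z \<in> saturation I (Idl ?Z)" using loc_map_in_Idl_iff[OF Zc Icarr[OF z]] by blast
  qed
  moreover have "card ?Z \<le> card S" by (rule card_image_le[OF M(3)])
  then have "enat (card ?Z) \<le> enat (card S)" by simp
  then have "enat (card ?Z) \<le> prime_height R I" using M(5) krull_dim_localization_le by simp
  ultimately show thesis using that[of ?Z] M(3) ZI by blast
qed

lemma loc_map_pow:
  "r \<in> carrier R \<Longrightarrow> loc_map R I (r [^] (n::nat)) = loc_map R I r [^]\<^bsub>A\<^esub> n"
  by (induction n) auto

text \<open>Every denominator can be made an n-th power by enlarging the numerator. With n = p the
  denominator can be pulled out of p-linear expressions.\<close>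

lemma frac_power_scaling:
  assumes r: "r \<in> carrier R" and s: "s \<in> carrier R" "s \<notin> I" and n: "n \<noteq> (0::nat)"
  shows "loc_frac R I r s = loc_frac R I \<one> s [^]\<^bsub>A\<^esub> n \<otimes>\<^bsub>A\<^esub> loc_map R I (s [^] (n - 1) \<otimes> r)"
proof -
  obtain k where k: "n = Suc k" using n by (cases n) auto
  let ?i = "loc_frac R I \<one> s" and ?s = "loc_map R I s"
  have c: "?i \<in> carrier A" "?s \<in> carrier A" "loc_map R I r \<in> carrier A" using r s by auto
  have "?i [^]\<^bsub>A\<^esub> k \<otimes>\<^bsub>A\<^esub> ?s [^]\<^bsub>A\<^esub> k = (?i \<otimes>\<^bsub>A\<^esub> ?s) [^]\<^bsub>A\<^esub> k"
    using c by (simp add: loc.nat_pow_distrib)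
  then have 1: "?i [^]\<^bsub>A\<^esub> k \<otimes>\<^bsub>A\<^esub> ?s [^]\<^bsub>A\<^esub> k = \<one>\<^bsub>A\<^esub>" using frac_one_mult_denom[OF s] by simp
  have "?i [^]\<^bsub>A\<^esub> n \<otimes>\<^bsub>A\<^esub> loc_map R I (s [^] (n - 1) \<otimes> r)
      = (?i [^]\<^bsub>A\<^esub> k \<otimes>\<^bsub>A\<^esub> ?s [^]\<^bsub>A\<^esub> k) \<otimes>\<^bsub>A\<^esub> (?i \<otimes>\<^bsub>A\<^esub> loc_map R I r)"
    using c r s k by (simp add: loc_map_pow loc.m_ac)
  then show ?thesis unfolding 1 using c frac_eq_mult[OF r s] by simp
qed

end

locale frobenius_localization = cring_localization + frobenius_ring
begin

lemma frobenius_ring_localization: "frobenius_ring A p"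
proof -
  have "[p] \<cdot>\<^bsub>A\<^esub> \<one>\<^bsub>A\<^esub> = loc_map R I ([p] \<cdot> \<one>)"
    by (induction p) auto
  then show ?thesis using prime_p char_p by (unfold_locales) auto
qed

sublocale locf: frobenius_ring A p
  by (rule frobenius_ring_localization)

lemma frob_generates_localization:
  assumes B: "frob_generates B"
  shows "locf.frob_generates (loc_map R I ` B)"
proof -
  have fB: "finite B" "B \<subseteq> carrier R" using B unfolding frob_generates_def by auto
  have c': "loc_map R I ` B \<subseteq> carrier A" using fB by auto
  have "\<exists>c\<in>loc_map R I ` B \<rightarrow> carrier A. a = locf.frob_sum (loc_map R I ` B) c" if a: "a \<in> carrier A" for a
  proof -
    obtain r s where r: "r \<in> carrier R" "s \<in> carrier R" "s \<notin> I" "a = loc_frac R I r s" using a by (rule carrierE)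
    define y where "y = s [^] (p - 1) \<otimes> r"
    have yc: "y \<in> carrier R" unfolding y_def using r by simp
    let ?i = "loc_frac R I \<one> s"
    have ic: "?i \<in> carrier A" using r by simp
    have ay: "a = ?i [^]\<^bsub>A\<^esub> p \<otimes>\<^bsub>A\<^esub> loc_map R I y"
      unfolding y_def r(4) using p_gt_1 r by (intro frac_power_scaling) auto
    obtain c where c: "c \<in> B \<rightarrow> carrier R" "y = frob_sum B c" using B yc unfolding frob_generates_def by blast
    have "loc_map R I y = (\<Oplus>\<^bsub>A\<^esub>b\<in>B. loc_map R I (c b) [^]\<^bsub>A\<^esub> p \<otimes>\<^bsub>A\<^esub> loc_map R I b)"
    proof -
      have "loc_map R I y = (\<Oplus>\<^bsub>A\<^esub>b\<in>B. (loc_map R I \<circ> (\<lambda>b. c b [^] p \<otimes> b)) b)"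
        unfolding c(2) frob_sum_def using fB c(1) by (subst hom.hom_finsum) (auto simp: Pi_iff subset_iff)
      also have "\<dots> = (\<Oplus>\<^bsub>A\<^esub>b\<in>B. loc_map R I (c b) [^]\<^bsub>A\<^esub> p \<otimes>\<^bsub>A\<^esub> loc_map R I b)"
        using fB c(1) by (intro loc.finsum_cong') (auto simp: Pi_iff subset_iff loc_map_pow)
      finally show ?thesis .
    qed
    moreover have "\<exists>d\<in>loc_map R I ` B \<rightarrow> carrier A.
        (\<Oplus>\<^bsub>A\<^esub>b\<in>B. loc_map R I (c b) [^]\<^bsub>A\<^esub> p \<otimes>\<^bsub>A\<^esub> loc_map R I b) = locf.frob_sum (loc_map R I ` B) d"
      using fB c(1) by (intro locf.frob_combination c') auto
    ultimately obtain d where d: "d \<in> loc_map R I ` B \<rightarrow> carrier A"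
      "loc_map R I y = locf.frob_sum (loc_map R I ` B) d" by auto
    have "a = locf.frob_sum (loc_map R I ` B) (\<lambda>b. ?i \<otimes>\<^bsub>A\<^esub> d b)"
      unfolding ay d(2) using locf.frob_sum_smult[OF c' d(1) ic] fB by simp
    moreover have "(\<lambda>b. ?i \<otimes>\<^bsub>A\<^esub> d b) \<in> loc_map R I ` B \<rightarrow> carrier A" using d(1) ic by (auto simp: Pi_iff)
    ultimately show ?thesis by blast
  qed
  then show ?thesis unfolding locf.frob_generates_def using fB c' by blast
qed

text \<open>A Frobenius power is generated by powers of generators, so it commutes with extension of
  ideals.\<close>

lemma loc_map_in_frob_power_iff:
  assumes J: "ideal J R" and x: "x \<in> carrier R"
  shows "loc_map R I x \<in> frob_power A (extension J) (p ^ e) \<longleftrightarrow> x \<in> saturation I (frob_power R J (p ^ e))"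
proof -
  let ?S = "(\<lambda>f. f [^] (p ^ e)) ` J"
  have Jc: "J \<subseteq> carrier R" by (rule ideal_sub[OF J])
  have c: "?S \<subseteq> carrier R" and cJ: "loc_map R I ` J \<subseteq> carrier A" using Jc by auto
  have "frob_power A (extension J) (p ^ e) = frob_power A (Idl\<^bsub>A\<^esub> (loc_map R I ` J)) (p ^ e)"
    unfolding Idl_loc_map_image[OF Jc] Idl_ideal[OF J] ..
  also have "\<dots> = Idl\<^bsub>A\<^esub> ((\<lambda>f. f [^]\<^bsub>A\<^esub> (p ^ e)) ` loc_map R I ` J)" by (rule locf.frob_power_Idl[OF cJ])
  also have "(\<lambda>f. f [^]\<^bsub>A\<^esub> (p ^ e)) ` loc_map R I ` J = loc_map R I ` ?S"
    unfolding image_image using Jc by (intro image_cong) (auto simp: loc_map_pow)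
  finally show ?thesis using loc_map_in_Idl_iff[OF c x] unfolding frob_power_def by simp
qed

end

section \<open>Transfer from the localization\<close>

context cring
begin

text \<open>A p-linear map of R/J recorded by representatives in R. Such a choice satisfies the
  identities only as congruences; the last condition says that the zero class goes to
  itself.\<close>

definition p_linear_mod :: "nat \<Rightarrow> 'a set \<Rightarrow> ('a \<Rightarrow> 'a) \<Rightarrow> bool" where
  "p_linear_mod p J \<rho> \<longleftrightarrow> \<rho> \<in> carrier R \<rightarrow> carrier R \<and>
     (\<forall>x\<in>carrier R. \<forall>y\<in>carrier R. \<rho> (x \<oplus> y) \<ominus> (\<rho> x \<oplus> \<rho> y) \<in> J) \<and>
     (\<forall>s\<in>carrier R. \<forall>x\<in>carrier R. \<rho> (s [^] p \<otimes> x) \<ominus> s \<otimes> \<rho> x \<in> J) \<and> (\<forall>x\<in>J. \<rho> x \<in> J)"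

lemma p_linear_modD:
  assumes "p_linear_mod p J \<rho>"
  shows "\<rho> \<in> carrier R \<rightarrow> carrier R"
    "\<And>x y. x \<in> carrier R \<Longrightarrow> y \<in> carrier R \<Longrightarrow> \<rho> (x \<oplus> y) \<ominus> (\<rho> x \<oplus> \<rho> y) \<in> J"
    "\<And>s x. s \<in> carrier R \<Longrightarrow> x \<in> carrier R \<Longrightarrow> \<rho> (s [^] p \<otimes> x) \<ominus> s \<otimes> \<rho> x \<in> J"
    "\<And>x. x \<in> J \<Longrightarrow> \<rho> x \<in> J"
  using assms unfolding p_linear_mod_def by auto

lemma F_split_lift:
  assumes J: "ideal J R" and F: "F_split (R Quot J) p"
  obtains \<rho> where "p_linear_mod p J \<rho>" "\<rho> \<one> \<ominus> \<one> \<in> J"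
proof -
  let ?Q = "R Quot J" and ?h = "\<lambda>x. J +> x"
  interpret h: ring_hom_cring R ?Q ?h by (rule ideal.rcos_ring_hom_cring[OF J is_cring])
  have eq: "a \<ominus> b \<in> J \<longleftrightarrow> ?h a = ?h b" if "a \<in> carrier R" "b \<in> carrier R" for a b
    using quotient_eq_iff_same_a_r_cos[OF J that] .
  have pow: "?h (x [^] n) = ?h x [^]\<^bsub>?Q\<^esub> (n::nat)" if "x \<in> carrier R" for x n
    using that by (induction n) auto
  obtain \<phi> where \<phi>: "\<phi> \<in> carrier ?Q \<rightarrow> carrier ?Q"
    "\<And>x y. x \<in> carrier ?Q \<Longrightarrow> y \<in> carrier ?Q \<Longrightarrow> \<phi> (x \<oplus>\<^bsub>?Q\<^esub> y) = \<phi> x \<oplus>\<^bsub>?Q\<^esub> \<phi> y"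
    "\<And>s x. s \<in> carrier ?Q \<Longrightarrow> x \<in> carrier ?Q \<Longrightarrow> \<phi> (s [^]\<^bsub>?Q\<^esub> p \<otimes>\<^bsub>?Q\<^esub> x) = s \<otimes>\<^bsub>?Q\<^esub> \<phi> x"
    "\<And>s. s \<in> carrier ?Q \<Longrightarrow> \<phi> (s [^]\<^bsub>?Q\<^esub> p) = s"
    using F unfolding F_split_def module_homs_def frob_module_def self_module_def by auto
  have surj: "\<exists>r\<in>carrier R. ?h r = a" if "a \<in> carrier ?Q" for a
    using that unfolding FactRing_def A_RCOSETS_def' by auto
  have "\<forall>x. \<exists>r. x \<in> carrier R \<longrightarrow> r \<in> carrier R \<and> ?h r = \<phi> (?h x)"
    using surj \<phi>(1) h.hom_closed by blast
  then obtain \<rho> where "\<forall>x. x \<in> carrier R \<longrightarrow> \<rho> x \<in> carrier R \<and> ?h (\<rho> x) = \<phi> (?h x)"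
    by (rule choice[THEN exE])
  then have \<rho>: "\<And>x. x \<in> carrier R \<Longrightarrow> \<rho> x \<in> carrier R" "\<And>x. x \<in> carrier R \<Longrightarrow> ?h (\<rho> x) = \<phi> (?h x)"
    by blast+
  show thesis
  proof (rule that, unfold p_linear_mod_def, intro conjI ballI)
    show "\<rho> \<in> carrier R \<rightarrow> carrier R" using \<rho>(1) by blast
    fix x y assume x: "x \<in> carrier R" and y: "y \<in> carrier R"
    show "\<rho> (x \<oplus> y) \<ominus> (\<rho> x \<oplus> \<rho> y) \<in> J"
      using x y \<rho> by (subst eq) (simp_all add: \<phi>(2))
    have "?h (\<rho> (x [^] p \<otimes> y)) = \<phi> (?h x [^]\<^bsub>?Q\<^esub> p \<otimes>\<^bsub>?Q\<^esub> ?h y)"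
      using x y \<rho>(2)[of "x [^] p \<otimes> y"] pow[OF x, of p] by simp
    then show "\<rho> (x [^] p \<otimes> y) \<ominus> x \<otimes> \<rho> y \<in> J"
      using x y \<rho> by (subst eq) (simp_all add: \<phi>(3))
  next
    have z: "\<phi> \<zero>\<^bsub>?Q\<^esub> = \<zero>\<^bsub>?Q\<^esub>"
    proof -
      have "\<phi> \<zero>\<^bsub>?Q\<^esub> \<in> carrier ?Q" using \<phi>(1) by auto
      moreover have "\<phi> \<zero>\<^bsub>?Q\<^esub> = \<phi> \<zero>\<^bsub>?Q\<^esub> \<oplus>\<^bsub>?Q\<^esub> \<phi> \<zero>\<^bsub>?Q\<^esub>" using \<phi>(2)[of "\<zero>\<^bsub>?Q\<^esub>" "\<zero>\<^bsub>?Q\<^esub>"] by simp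
      ultimately show ?thesis by (metis h.S.add.l_cancel_one')
    qed
    fix x assume x: "x \<in> J"
    have xc: "x \<in> carrier R" using x ideal_carr[OF J] by blast
    have "x \<ominus> \<zero> \<in> J" using x ideal_0[OF J] ideal_diff[OF J] by blast
    then have "?h x = \<zero>\<^bsub>?Q\<^esub>" using eq[OF xc zero_closed] by simp
    then have "?h (\<rho> x) = ?h \<zero>" using \<rho>(2)[OF xc] z by simp
    then have "\<rho> x \<ominus> \<zero> \<in> J" using eq \<rho>(1)[OF xc] by blast
    then show "\<rho> x \<in> J" using \<rho>(1)[OF xc] by (simp add: minus_eq)
  next
    have "\<phi> \<one>\<^bsub>?Q\<^esub> = \<one>\<^bsub>?Q\<^esub>" using \<phi>(4)[of "\<one>\<^bsub>?Q\<^esub>"] by simp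
    then show "\<rho> \<one> \<ominus> \<one> \<in> J" using \<rho> by (subst eq) simp_all
  qed
qed

lemma p_linear_mod_frob_sum:
  assumes J: "ideal J R" and pl: "p_linear_mod p J \<rho>"
    and D: "finite D" "c \<in> D \<rightarrow> carrier R" "\<beta> \<in> D \<rightarrow> carrier R"
  shows "\<rho> (\<Oplus>b\<in>D. c b [^] (p::nat) \<otimes> \<beta> b) \<ominus> (\<Oplus>b\<in>D. c b \<otimes> \<rho> (\<beta> b)) \<in> J"
  using D
proof (induction D rule: finite_induct)
  case empty
  have "\<rho> \<zero> \<in> J" using p_linear_modD(4)[OF pl] ideal_0[OF J] by blast
  then show ?case using ideal_carr[OF J] by (simp add: minus_eq)
next
  case (insert x D)
  note \<rho> = p_linear_modD[OF pl]
  let ?s = "\<Oplus>b\<in>D. c b [^] p \<otimes> \<beta> b" and ?t = "\<Oplus>b\<in>D. c b \<otimes> \<rho> (\<beta> b)"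
  have c: "c x \<in> carrier R" "\<beta> x \<in> carrier R" "\<rho> (\<beta> x) \<in> carrier R"
    "(\<lambda>b. c b [^] p \<otimes> \<beta> b) \<in> D \<rightarrow> carrier R" "(\<lambda>b. c b \<otimes> \<rho> (\<beta> b)) \<in> D \<rightarrow> carrier R"
    using insert.prems \<rho>(1) by (auto simp: Pi_iff)
  have sc: "?s \<in> carrier R" "?t \<in> carrier R" using c by auto
  have e: "(\<Oplus>b\<in>insert x D. c b [^] p \<otimes> \<beta> b) = c x [^] p \<otimes> \<beta> x \<oplus> ?s"
    "(\<Oplus>b\<in>insert x D. c b \<otimes> \<rho> (\<beta> b)) = c x \<otimes> \<rho> (\<beta> x) \<oplus> ?t"
    using insert.hyps c by simp_all
  define u where "u = c x [^] p \<otimes> \<beta> x"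
  have uc: "u \<in> carrier R" unfolding u_def using c by simp
  have gen: "a \<ominus> (v \<oplus> t) = (a \<ominus> (r \<oplus> s)) \<oplus> ((r \<ominus> v) \<oplus> (s \<ominus> t))"
    if "a \<in> carrier R" "v \<in> carrier R" "t \<in> carrier R" "r \<in> carrier R" "s \<in> carrier R" for a v t r s
    using that by algebra
  have cl: "\<rho> (u \<oplus> ?s) \<in> carrier R" "\<rho> u \<in> carrier R" "\<rho> ?s \<in> carrier R" using \<rho>(1) uc sc by auto
  have "\<rho> (u \<oplus> ?s) \<ominus> (c x \<otimes> \<rho> (\<beta> x) \<oplus> ?t) =
      (\<rho> (u \<oplus> ?s) \<ominus> (\<rho> u \<oplus> \<rho> ?s)) \<oplus> ((\<rho> u \<ominus> c x \<otimes> \<rho> (\<beta> x)) \<oplus> (\<rho> ?s \<ominus> ?t))"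
    using cl c sc by (intro gen) auto
  also have "\<dots> \<in> J"
    using \<rho>(2)[OF uc sc(1)] \<rho>(3)[OF c(1,2)] insert unfolding u_def
    by (intro ideal_add[OF J]) auto
  finally show ?case unfolding e u_def .
qed

end

context cring_localization
begin

lemma common_denominator:
  assumes "finite D" "f \<in> D \<rightarrow> carrier A"
  shows "\<exists>s c. s \<in> carrier R \<and> s \<notin> I \<and> c \<in> D \<rightarrow> carrier R \<and>
     (\<forall>b\<in>D. loc_map R I s \<otimes>\<^bsub>A\<^esub> f b = loc_map R I (c b))"
  using assms
proof (induction D rule: finite_induct)
  case empty
  then show ?case using one_notin by blast
next
  case (insert x D)
  obtain s c where s: "s \<in> carrier R" "s \<notin> I" "c \<in> D \<rightarrow> carrier R"
    "\<forall>b\<in>D. loc_map R I s \<otimes>\<^bsub>A\<^esub> f b = loc_map R I (c b)" using insert by auto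
  have "f x \<in> carrier A" using insert by auto
  then obtain r t where r: "r \<in> carrier R" "t \<in> carrier R" "t \<notin> I" "f x = loc_frac R I r t"
    by (rule carrierE)
  define c' where "c' = (\<lambda>b. if b = x then s \<otimes> r else t \<otimes> c b)"
  have st: "s \<otimes> t \<in> carrier R - I" using s r compl_mult by blast
  have "loc_map R I (s \<otimes> t) \<otimes>\<^bsub>A\<^esub> f b = loc_map R I (c' b)" if b: "b \<in> insert x D" for b
  proof (cases "b = x")
    case True
    have "loc_map R I (s \<otimes> t) \<otimes>\<^bsub>A\<^esub> f x = loc_map R I s \<otimes>\<^bsub>A\<^esub> (loc_map R I t \<otimes>\<^bsub>A\<^esub> f x)"
      using s r by (simp add: loc.m_assoc)
    then show ?thesis using True denom_mult_frac[OF r(1-3)] s r unfolding c'_def by simp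
  next
    case False
    then have "b \<in> D" "f b \<in> carrier A" using b insert.prems by auto
    then have "loc_map R I (s \<otimes> t) \<otimes>\<^bsub>A\<^esub> f b = loc_map R I t \<otimes>\<^bsub>A\<^esub> (loc_map R I s \<otimes>\<^bsub>A\<^esub> f b)"
      using s r by (simp add: loc.m_ac)
    then show ?thesis using False s r \<open>b \<in> D\<close> unfolding c'_def by (auto simp: Pi_iff)
  qed
  moreover have "c' \<in> insert x D \<rightarrow> carrier R" unfolding c'_def using s r by (auto simp: Pi_iff)
  ultimately show ?case using st by blast
qed

end

context frobenius_localization
begin

text \<open>Regularity of \<open>A\<close> supplies the parameters and the chain of primes that
  freeness rests on. That the basis consists of images of elements of R is what lets
  \<open>fedder_localization\<close> lift it.\<close>

lemma exists_dual_basis: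
  assumes reg: "regular_local_ring A" and gen: "frob_generates B\<^sub>0"
  obtains B \<pi> where "B \<subseteq> loc_map R I ` B\<^sub>0" "frobenius_dual_basis_local A (extension I) p B \<pi>"
proof -
  obtain M S where M: "local_ring A M" "S \<subseteq> carrier A" "finite S" "M = Idl\<^bsub>A\<^esub> S" "enat (card S) = krull_dim A"
    and noeth: "noetherian_ring A"
    using reg unfolding regular_local_ring_def by blast
  have Me: "M = extension I" by (rule maximal_ideal_eq[OF M(1)])
  interpret nc: noetherian_cring A
    using noeth by (intro noetherian_cring.intro loc.is_cring)
  interpret nl: noetherian_local A M by unfold_locales (rule M(1))
  have "chain_between A {} (card S) M"
  proof (rule chain_between_of_krull_dim[OF nl.prime_max])
    fix Q assume Q: "primeideal Q A"
    show "Q \<subseteq> M"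
      using primeideal.I_notcarr[OF Q] by (intro nl.proper_subset_max primeideal.axioms(1)[OF Q]) simp
  qed (use M(5) in simp)
  then interpret fl: frobenius_local A M p S
    using M by unfold_locales auto
  obtain B \<pi> where B: "B \<subseteq> loc_map R I ` B\<^sub>0" "finite B" "\<And>b. b \<in> B \<Longrightarrow> loc.p_linear p (\<pi> b)"
    "\<And>x. x \<in> carrier A \<Longrightarrow> x = locf.frob_sum B (\<lambda>b. \<pi> b x)"
    by (rule fl.frobenius_dual_basis[OF frob_generates_localization[OF gen]]) (rule that)
  have Bc: "B \<subseteq> carrier A" using B(1) gen unfolding frob_generates_def by auto
  have "frobenius_dual_basis_local A M p B \<pi>"
    using B Bc by unfold_locales auto
  then show thesis using that B(1) unfolding Me by blast
qed

text \<open>Modulo the extended prime the image of \<open>s\<close> is a nonzerodivisor, and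
  flatness of Frobenius on \<open>A\<close> keeps it one modulo the Frobenius powers of that
  prime.\<close>

lemma prime_frob_power_localization:
  assumes reg: "regular_local_ring A" and gen: "frob_generates B\<^sub>0"
    and Q: "primeideal Q R" "Q \<subseteq> I" and s: "s \<in> carrier R" "s \<notin> Q" and x: "x \<in> carrier R"
    and sx: "s \<otimes> x \<in> frob_power R Q (p ^ e)"
  shows "x \<in> saturation I (frob_power R Q (p ^ e))"
proof -
  have Qi: "ideal Q R" using Q primeideal.axioms(1) by blast
  note Fi = frob_power_ideal[OF ideal_sub[OF Qi]]
  obtain B \<pi> where B: "frobenius_dual_basis_local A (extension I) p B \<pi>"
    by (rule exists_dual_basis[OF reg gen])
  interpret d: frobenius_dual_basis_local A "extension I" p B \<pi> by (rule B)
  have "loc.nonzerodivisor_mod (extension Q) (loc_map R I s)"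
    unfolding loc.nonzerodivisor_mod_def
  proof (intro ballI impI)
    fix z assume "z \<in> carrier A" and z: "loc_map R I s \<otimes>\<^bsub>A\<^esub> z \<in> extension Q"
    then obtain r t where r: "r \<in> carrier R" "t \<in> carrier R" "t \<notin> I" "z = loc_frac R I r t" by (auto elim: carrierE)
    have "loc_map R I s \<otimes>\<^bsub>A\<^esub> z = loc_frac R I (s \<otimes> r) t"
      unfolding r(4) loc_map_def using s r one_notin by (simp add: frac_mult)
    then have "s \<otimes> r \<in> saturation I Q" using z s r frac_in_extension_iff[OF Qi] by simp
    then have "s \<otimes> r \<in> Q" using saturation_prime[OF Q(1) primeideal Q(2)] by simp
    then have "r \<in> Q" using prime_in_iff[OF Q(1) s(1) r(1)] s(2) by blast
    then show "z \<in> extension Q" unfolding extension_def r(4) using r by blast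
  qed
  then have nz: "loc.nonzerodivisor_mod (frob_power A (extension Q) (p ^ e)) (loc_map R I s)"
    using s by (intro d.nonzerodivisor_mod_frob_power extension_ideal Qi) auto
  have "s \<otimes> x \<in> saturation I (frob_power R Q (p ^ e))"
    using sx saturation_superset[OF primeideal Fi] by blast
  then have "loc_map R I (s \<otimes> x) \<in> frob_power A (extension Q) (p ^ e)"
    using loc_map_in_frob_power_iff[OF Qi, of "s \<otimes> x"] s x by simp
  then have "loc_map R I x \<in> frob_power A (extension Q) (p ^ e)"
    using loc.nonzerodivisor_modD[OF nz] s x by simp
  then show ?thesis using loc_map_in_frob_power_iff[OF Qi x] by simp
qed

lemma nonzerodivisor_localization:
  assumes S: "S \<subseteq> carrier R" and w: "w \<in> carrier R" and n: "nonzerodivisor_mod (Idl S) w"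
  shows "loc.nonzerodivisor_mod (Idl\<^bsub>A\<^esub> (loc_map R I ` S)) (loc_map R I w)"
  unfolding loc.nonzerodivisor_mod_def
proof (intro ballI impI)
  note i = genideal_ideal[OF S]
  fix z assume "z \<in> carrier A" and z: "loc_map R I w \<otimes>\<^bsub>A\<^esub> z \<in> Idl\<^bsub>A\<^esub> (loc_map R I ` S)"
  then obtain r t where r: "r \<in> carrier R" "t \<in> carrier R" "t \<notin> I" "z = loc_frac R I r t" by (auto elim: carrierE)
  have "loc_map R I w \<otimes>\<^bsub>A\<^esub> z = loc_frac R I (w \<otimes> r) t"
    unfolding r(4) loc_map_def using w r one_notin by (simp add: frac_mult)
  then have "w \<otimes> r \<in> saturation I (Idl S)"
    using z w r frac_in_extension_iff[OF i] unfolding Idl_loc_map_image[OF S] by simp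
  then obtain u where u: "u \<in> carrier R" "u \<notin> I" "u \<otimes> (w \<otimes> r) \<in> Idl S" unfolding saturation_def by blast
  have "u \<otimes> (w \<otimes> r) = w \<otimes> (u \<otimes> r)" using u w r by (simp add: m_lcomm)
  then have "u \<otimes> r \<in> Idl S" using nonzerodivisor_modD[OF n] u r by simp
  then have "r \<in> saturation I (Idl S)" unfolding saturation_def using u r by blast
  then show "z \<in> Idl\<^bsub>A\<^esub> (loc_map R I ` S)"
    unfolding Idl_loc_map_image[OF S] r(4) using frac_in_extension_iff[OF i r(1-3)] by simp
qed

text \<open>What is given is a splitting on a quotient of R, hence a map \<open>\<rho>\<close> on R
  that is p-linear modulo \<open>?J\<close>. A p-linear map \<open>\<phi>\<close> on
  \<open>A\<close> is built from the images of \<open>\<rho>\<close> at lifts of the basis; it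
  agrees with \<open>\<rho>\<close> modulo the extended ideal, so \<open>fedder\<close> applies to
  it.\<close>

lemma fedder_localization:
  assumes reg: "regular_local_ring A" and gen: "frob_generates B\<^sub>0"
    and fs: "set fs \<subseteq> I" and seq: "regular_sequence R fs" and F: "F_split (R Quot (Idl (set fs))) p"
  shows "(\<Otimes>j\<in>{..<length fs}. fs ! j) [^] (p ^ e - 1) \<notin> frob_power R I (p ^ e)"
proof -
  let ?l = "loc_map R I"
  have fc: "set fs \<subseteq> carrier R" using fs a_subset by blast
  let ?J = "Idl (set fs)"
  note Ji = genideal_ideal[OF fc] and Js = genideal_self[OF fc]
  obtain B \<pi> where BB: "B \<subseteq> ?l ` B\<^sub>0" and B: "frobenius_dual_basis_local A (extension I) p B \<pi>"
    by (rule exists_dual_basis[OF reg gen])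
  interpret d: frobenius_dual_basis_local A "extension I" p B \<pi> by (rule B)
  have "B\<^sub>0 \<subseteq> carrier R" using gen unfolding frob_generates_def by blast
  then have "\<forall>b\<in>B. \<exists>r. r \<in> carrier R \<and> ?l r = b" using BB by blast
  then obtain \<beta> where \<beta>: "\<forall>b\<in>B. \<beta> b \<in> carrier R \<and> ?l (\<beta> b) = b" by metis
  obtain \<rho> where pl: "p_linear_mod p ?J \<rho>" and \<rho>1: "\<rho> \<one> \<ominus> \<one> \<in> ?J"
    by (rule F_split_lift[OF Ji F])
  note \<rho> = p_linear_modD[OF pl] \<rho>1
  have \<rho>c: "x \<in> carrier R \<Longrightarrow> \<rho> x \<in> carrier R" for x using \<rho>(1) by auto
  define v where "v = (\<lambda>b. ?l (\<rho> (\<beta> b)))"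
  have v: "v \<in> B \<rightarrow> carrier A" unfolding v_def using \<beta> \<rho>c by auto
  define \<phi> where "\<phi> = (\<lambda>x. \<Oplus>\<^bsub>A\<^esub>b\<in>B. \<pi> b x \<otimes>\<^bsub>A\<^esub> v b)"
  have \<phi>: "loc.p_linear p \<phi>" unfolding \<phi>_def by (rule d.p_linear_of_values[OF v])
  let ?JA = "Idl\<^bsub>A\<^esub> (?l ` set fs)"
  have fcA: "?l ` set fs \<subseteq> carrier A" using fc by auto
  note JAi = loc.genideal_ideal[OF fcA]
  have lJ: "?l x \<in> ?JA" if "x \<in> ?J" for x
    using that loc_map_in_Idl_iff[OF fc ideal_carr[OF Ji that]] saturation_superset[OF primeideal Ji] by blast
  \<comment> \<open>For a suitable \<open>s\<close> outside the prime, s^p r is a combination of the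
    lifts \<open>\<beta> b\<close> within R. There \<open>\<rho>\<close> can be evaluated in two
    ways modulo \<open>?J\<close>, as \<open>s \<otimes> \<rho> r\<close> and as the sum defining
    \<open>\<phi>\<close> times \<open>s\<close>; finally the unit \<open>?l s\<close> is
    cancelled.\<close>
  have key: "\<phi> (?l r) \<ominus>\<^bsub>A\<^esub> ?l (\<rho> r) \<in> ?JA" if r: "r \<in> carrier R" for r
  proof -
    have lr: "?l r \<in> carrier A" using r by simp
    have pc: "(\<lambda>b. \<pi> b (?l r)) \<in> B \<rightarrow> carrier A" using d.dual_closed lr by auto
    obtain s\<^sub>0 c\<^sub>0 where s0: "s\<^sub>0 \<in> carrier R" "s\<^sub>0 \<notin> I" "c\<^sub>0 \<in> B \<rightarrow> carrier R"
      "\<forall>b\<in>B. ?l s\<^sub>0 \<otimes>\<^bsub>A\<^esub> \<pi> b (?l r) = ?l (c\<^sub>0 b)"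
      using common_denominator[OF d.finite_basis pc] by blast
    have sumc: "(\<lambda>b. c b [^] p \<otimes> \<beta> b) \<in> B \<rightarrow> carrier R" if "c \<in> B \<rightarrow> carrier R" for c
      using that \<beta> by (auto simp: Pi_iff)
    have "?l (s\<^sub>0 [^] p \<otimes> r) = ?l s\<^sub>0 [^]\<^bsub>A\<^esub> p \<otimes>\<^bsub>A\<^esub> locf.frob_sum B (\<lambda>b. \<pi> b (?l r))"
      using d.expansion[OF lr] s0 r by (simp add: loc_map_pow)
    also have "\<dots> = locf.frob_sum B (\<lambda>b. ?l s\<^sub>0 \<otimes>\<^bsub>A\<^esub> \<pi> b (?l r))"
      using s0 by (intro locf.frob_sum_smult[symmetric] d.basis_carrier pc d.finite_basis) auto
    also have "\<dots> = (\<Oplus>\<^bsub>A\<^esub>b\<in>B. (?l \<circ> (\<lambda>b. c\<^sub>0 b [^] p \<otimes> \<beta> b)) b)"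
      unfolding locf.frob_sum_def using s0 \<beta> d.basis_carrier
      by (intro loc.finsum_cong') (auto simp: Pi_iff loc_map_pow subset_iff)
    also have "\<dots> = ?l (\<Oplus>b\<in>B. c\<^sub>0 b [^] p \<otimes> \<beta> b)"
      using hom.hom_finsum[OF sumc[OF s0(3)]] by simp
    finally have eq: "?l (s\<^sub>0 [^] p \<otimes> r) = ?l (\<Oplus>b\<in>B. c\<^sub>0 b [^] p \<otimes> \<beta> b)" .
    \<comment> \<open>The expansion holds in \<open>A\<close>, hence in R only after multiplication
      by some \<open>t\<close>. Including \<open>t\<close> in \<open>s\<close> multiplies by t^p
      instead, so that the coefficients remain p-th powers.\<close>
    obtain t where t: "t \<in> carrier R" "t \<notin> I"
      "t \<otimes> (s\<^sub>0 [^] p \<otimes> r) = t \<otimes> (\<Oplus>b\<in>B. c\<^sub>0 b [^] p \<otimes> \<beta> b)"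
      using loc_map_eqD[OF _ _ eq] s0 r loc.finsum_closed finsum_closed[OF sumc[OF s0(3)]] by auto
    define s where "s = t \<otimes> s\<^sub>0"
    define c where "c = (\<lambda>b. t \<otimes> c\<^sub>0 b)"
    have s: "s \<in> carrier R" "s \<notin> I" using t s0 compl_mult unfolding s_def by auto
    have c: "c \<in> B \<rightarrow> carrier R" unfolding c_def using t s0 by (auto simp: Pi_iff)
    have cs: "?l s \<otimes>\<^bsub>A\<^esub> \<pi> b (?l r) = ?l (c b)" if b: "b \<in> B" for b
    proof -
      have "\<pi> b (?l r) \<in> carrier A" "c\<^sub>0 b \<in> carrier R" using pc s0 b by auto
      then show ?thesis unfolding s_def c_def using t s0 b by (simp add: loc.m_assoc)
    qed
    have sr: "s [^] p \<otimes> r = (\<Oplus>b\<in>B. c b [^] p \<otimes> \<beta> b)"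
    proof -
      obtain k where k: "p = Suc k" using p_gt_1 by (cases p) auto
      let ?S = "\<Oplus>b\<in>B. c\<^sub>0 b [^] p \<otimes> \<beta> b"
      have Sc: "?S \<in> carrier R" by (rule finsum_closed[OF sumc[OF s0(3)]])
      have "s [^] p \<otimes> r = t [^] k \<otimes> (t \<otimes> (s\<^sub>0 [^] p \<otimes> r))"
        unfolding s_def using t(1) s0(1) r by (simp add: nat_pow_distrib k m_ac)
      also have "\<dots> = t [^] p \<otimes> ?S" unfolding t(3) using t(1) Sc by (simp add: k m_assoc)
      also have "\<dots> = (\<Oplus>b\<in>B. t [^] p \<otimes> (c\<^sub>0 b [^] p \<otimes> \<beta> b))"
        using t by (intro finsum_rdistr d.finite_basis sumc[OF s0(3)]) auto
      also have "\<dots> = (\<Oplus>b\<in>B. c b [^] p \<otimes> \<beta> b)"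
        unfolding c_def using t(1) s0(3) \<beta> by (intro finsum_cong') (auto simp: Pi_iff nat_pow_distrib m_assoc)
      finally show ?thesis .
    qed
    let ?T = "\<Oplus>b\<in>B. c b \<otimes> \<rho> (\<beta> b)"
    have cT: "(\<lambda>b. c b \<otimes> \<rho> (\<beta> b)) \<in> B \<rightarrow> carrier R" using c \<beta> \<rho>c by (auto simp: Pi_iff)
    have Tc: "?T \<in> carrier R" by (rule finsum_closed[OF cT])
    have "\<rho> (s [^] p \<otimes> r) \<ominus> ?T \<in> ?J"
      unfolding sr using \<beta> by (intro p_linear_mod_frob_sum[OF Ji pl d.finite_basis c]) auto
    then have "(\<rho> (s [^] p \<otimes> r) \<ominus> ?T) \<ominus> (\<rho> (s [^] p \<otimes> r) \<ominus> s \<otimes> \<rho> r) \<in> ?J"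
      using \<rho>(3)[OF s(1) r] by (rule ideal_diff[OF Ji])
    moreover have "(\<rho> (s [^] p \<otimes> r) \<ominus> ?T) \<ominus> (\<rho> (s [^] p \<otimes> r) \<ominus> s \<otimes> \<rho> r) = s \<otimes> \<rho> r \<ominus> ?T"
    proof -
      have "(a \<ominus> y) \<ominus> (a \<ominus> z) = z \<ominus> y" if "a \<in> carrier R" "y \<in> carrier R" "z \<in> carrier R" for a y z
        using that by algebra
      then show ?thesis using \<rho>c s r Tc by simp
    qed
    ultimately have J1: "?l (s \<otimes> \<rho> r \<ominus> ?T) \<in> ?JA" using lJ by simp
    have \<phi>c: "\<phi> (?l r) \<in> carrier A" by (rule loc.p_linear_closed[OF \<phi> lr])
    have "?l s \<otimes>\<^bsub>A\<^esub> \<phi> (?l r) = (\<Oplus>\<^bsub>A\<^esub>b\<in>B. ?l s \<otimes>\<^bsub>A\<^esub> (\<pi> b (?l r) \<otimes>\<^bsub>A\<^esub> v b))"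
      unfolding \<phi>_def using pc v s by (intro loc.finsum_rdistr d.finite_basis) (auto simp: Pi_iff)
    also have "\<dots> = (\<Oplus>\<^bsub>A\<^esub>b\<in>B. (?l \<circ> (\<lambda>b. c b \<otimes> \<rho> (\<beta> b))) b)"
    proof (rule loc.finsum_cong')
      fix b assume b: "b \<in> B"
      have h: "\<pi> b (?l r) \<in> carrier A" "v b \<in> carrier A" "c b \<in> carrier R" "\<rho> (\<beta> b) \<in> carrier R"
        using pc v c \<beta> \<rho>c b by auto
      then have "?l s \<otimes>\<^bsub>A\<^esub> (\<pi> b (?l r) \<otimes>\<^bsub>A\<^esub> v b) = ?l (c b) \<otimes>\<^bsub>A\<^esub> v b"
        using s cs[OF b] by (simp add: loc.m_assoc[symmetric])
      then show "?l s \<otimes>\<^bsub>A\<^esub> (\<pi> b (?l r) \<otimes>\<^bsub>A\<^esub> v b) = (?l \<circ> (\<lambda>b. c b \<otimes> \<rho> (\<beta> b))) b"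
        using h unfolding v_def by simp
    qed (use cT in \<open>auto simp: Pi_iff\<close>)
    also have "\<dots> = ?l ?T" using hom.hom_finsum[OF cT] by simp
    finally have s\<phi>: "?l s \<otimes>\<^bsub>A\<^esub> \<phi> (?l r) = ?l ?T" .
    have sl: "?l s \<in> carrier A" "?l (\<rho> r) \<in> carrier A" using s \<rho>c r by auto
    have "?l s \<otimes>\<^bsub>A\<^esub> (\<phi> (?l r) \<ominus>\<^bsub>A\<^esub> ?l (\<rho> r)) = ?l s \<otimes>\<^bsub>A\<^esub> \<phi> (?l r) \<ominus>\<^bsub>A\<^esub> ?l s \<otimes>\<^bsub>A\<^esub> ?l (\<rho> r)"
      using sl \<phi>c by (simp add: loc.minus_eq loc.r_distr loc.r_minus)
    also have "\<dots> = ?l ?T \<ominus>\<^bsub>A\<^esub> ?l (s \<otimes> \<rho> r)" unfolding s\<phi> using s \<rho>c r by simp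
    also have "\<dots> = \<ominus>\<^bsub>A\<^esub> ?l (s \<otimes> \<rho> r \<ominus> ?T)"
      using s \<rho>c r Tc by (simp add: minus_eq loc.minus_eq loc.minus_add loc.a_comm)
    finally have "?l s \<otimes>\<^bsub>A\<^esub> (\<phi> (?l r) \<ominus>\<^bsub>A\<^esub> ?l (\<rho> r)) \<in> ?JA" using loc.ideal_neg[OF JAi J1] by simp
    then have "loc_frac R I \<one> s \<otimes>\<^bsub>A\<^esub> (?l s \<otimes>\<^bsub>A\<^esub> (\<phi> (?l r) \<ominus>\<^bsub>A\<^esub> ?l (\<rho> r))) \<in> ?JA"
      using frac_closed[OF one_closed s] by (rule loc.ideal_lmult[OF JAi])
    moreover have "loc_frac R I \<one> s \<otimes>\<^bsub>A\<^esub> (?l s \<otimes>\<^bsub>A\<^esub> d) = d" if d: "d \<in> carrier A" for d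
    proof -
      have "loc_frac R I \<one> s \<otimes>\<^bsub>A\<^esub> (?l s \<otimes>\<^bsub>A\<^esub> d) = (loc_frac R I \<one> s \<otimes>\<^bsub>A\<^esub> ?l s) \<otimes>\<^bsub>A\<^esub> d"
        using s sl d by (intro loc.m_assoc[symmetric]) auto
      then show ?thesis unfolding frac_one_mult_denom[OF s] using d by simp
    qed
    moreover have "\<phi> (?l r) \<ominus>\<^bsub>A\<^esub> ?l (\<rho> r) \<in> carrier A" using sl \<phi>c by simp
    ultimately show ?thesis by metis
  qed
  have key2: "\<phi> (?l r) \<in> ?JA" if r: "r \<in> ?J" for r
  proof -
    have rc: "r \<in> carrier R" using r ideal_carr[OF Ji] by blast
    have c: "\<phi> (?l r) \<in> carrier A" "?l (\<rho> r) \<in> carrier A"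
      using loc.p_linear_closed[OF \<phi>] \<rho>c rc by auto
    have "(\<phi> (?l r) \<ominus>\<^bsub>A\<^esub> ?l (\<rho> r)) \<oplus>\<^bsub>A\<^esub> ?l (\<rho> r) \<in> ?JA"
      using key[OF rc] lJ[OF \<rho>(4)[OF r]] by (rule loc.ideal_add[OF JAi])
    moreover have "(\<phi> (?l r) \<ominus>\<^bsub>A\<^esub> ?l (\<rho> r)) \<oplus>\<^bsub>A\<^esub> ?l (\<rho> r) = \<phi> (?l r)"
      using c by (simp add: loc.minus_eq loc.a_assoc loc.l_neg)
    ultimately show ?thesis by simp
  qed
  have comp: "\<phi> x \<in> ?JA" if x: "x \<in> ?JA" for x
  proof -
    have "x \<in> extension ?J" using x unfolding Idl_loc_map_image[OF fc] .
    then obtain a s where a: "a \<in> ?J" "s \<in> carrier R" "s \<notin> I" "x = loc_frac R I a s"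
      unfolding extension_def by blast
    have ac: "a \<in> carrier R" using a ideal_carr[OF Ji] by blast
    \<comment> \<open>\<open>\<phi>\<close> respects only scalars that are p-th powers, so the
      denominator is first turned into one.\<close>
    let ?b = "s [^] (p - 1) \<otimes> a"
    have bJ: "?b \<in> ?J" using a by (intro ideal_lmult[OF Ji]) auto
    have "x = loc_frac R I \<one> s [^]\<^bsub>A\<^esub> p \<otimes>\<^bsub>A\<^esub> ?l ?b"
      unfolding a(4) using ac a p_gt_1 by (intro frac_power_scaling) auto
    then have "\<phi> x = loc_frac R I \<one> s \<otimes>\<^bsub>A\<^esub> \<phi> (?l ?b)"
      using loc.p_linear_smult[OF \<phi>, of "loc_frac R I \<one> s" "?l ?b"] a ac by simp
    then show ?thesis using key2[OF bJ] loc.ideal_lmult[OF JAi] a by simp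
  qed
  have one: "\<phi> \<one>\<^bsub>A\<^esub> \<ominus>\<^bsub>A\<^esub> \<one>\<^bsub>A\<^esub> \<in> ?JA"
  proof -
    have c: "\<phi> \<one>\<^bsub>A\<^esub> \<in> carrier A" "?l (\<rho> \<one>) \<in> carrier A"
      using loc.p_linear_closed[OF \<phi>] \<rho>c by auto
    have "\<phi> (?l \<one>) \<ominus>\<^bsub>A\<^esub> ?l (\<rho> \<one>) \<oplus>\<^bsub>A\<^esub> ?l (\<rho> \<one> \<ominus> \<one>) \<in> ?JA"
      using key[OF one_closed] lJ[OF \<rho>(5)] by (rule loc.ideal_add[OF JAi])
    moreover have "?l (\<rho> \<one> \<ominus> \<one>) = ?l (\<rho> \<one>) \<ominus>\<^bsub>A\<^esub> \<one>\<^bsub>A\<^esub>"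
      using \<rho>c by (simp add: minus_eq loc.minus_eq)
    moreover have "\<phi> \<one>\<^bsub>A\<^esub> \<ominus>\<^bsub>A\<^esub> ?l (\<rho> \<one>) \<oplus>\<^bsub>A\<^esub> (?l (\<rho> \<one>) \<ominus>\<^bsub>A\<^esub> \<one>\<^bsub>A\<^esub>) = \<phi> \<one>\<^bsub>A\<^esub> \<ominus>\<^bsub>A\<^esub> \<one>\<^bsub>A\<^esub>"
      using c loc.one_closed by algebra
    ultimately show ?thesis by simp
  qed
  let ?fA = "map ?l fs"
  have reg_mod: "loc.regular_mod (Idl\<^bsub>A\<^esub> {}) ?fA"
  proof -
    have "loc.regular_mod (Idl\<^bsub>A\<^esub> (set [])) ?fA"
    proof (rule loc.regular_modI)
      show "set ([] @ ?fA) \<subseteq> carrier A" using fc by auto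
      fix i assume i: "i < length ?fA"
      have fi: "fs ! i \<in> carrier R" using i fc by auto
      have t: "set (take i fs) \<subseteq> carrier R" using fc set_take_subset by fast
      have "nonzerodivisor_mod (Idl (set (take i fs))) (fs ! i)"
        using seq i unfolding regular_sequence_def nonzerodivisor_mod_def by auto
      then have "loc.nonzerodivisor_mod (Idl\<^bsub>A\<^esub> (?l ` set (take i fs))) (?l (fs ! i))"
        by (rule nonzerodivisor_localization[OF t fi])
      then show "loc.nonzerodivisor_mod (Idl\<^bsub>A\<^esub> (set ([] @ take i ?fA))) (?fA ! i)"
        using i by (simp add: take_map)
    qed
    then show ?thesis by simp
  qed
  have fsm: "set ?fA \<subseteq> extension I"
  proof -
    have "?l ` I \<subseteq> extension I" unfolding extension_def loc_map_def using one_notin by auto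
    then show ?thesis using fs by auto
  qed
  have not: "(\<Otimes>\<^bsub>A\<^esub>j\<in>{..<length ?fA}. ?fA ! j) [^]\<^bsub>A\<^esub> (p ^ e - 1) \<notin> frob_power A (extension I) (p ^ e)"
    using comp one by (intro d.fedder[OF fsm reg_mod \<phi>]) auto
  let ?g = "\<Otimes>j\<in>{..<length fs}. fs ! j"
  have fjc: "(\<lambda>j. fs ! j) \<in> {..<length fs} \<rightarrow> carrier R" using fc by auto
  have gc: "?g \<in> carrier R" by (rule finprod_closed[OF fjc])
  have "?l ?g = (\<Otimes>\<^bsub>A\<^esub>j\<in>{..<length fs}. (?l \<circ> (\<lambda>j. fs ! j)) j)"
    using hom.hom_finprod[OF fjc] by simp
  also have "\<dots> = (\<Otimes>\<^bsub>A\<^esub>j\<in>{..<length ?fA}. ?fA ! j)"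
    using fjc by (intro loc.finprod_cong') (auto simp: Pi_iff)
  finally have "?l (?g [^] (p ^ e - 1)) \<notin> frob_power A (extension I) (p ^ e)"
    using not gc by (simp add: loc_map_pow)
  then have "?g [^] (p ^ e - 1) \<notin> saturation I (frob_power R I (p ^ e))"
    using loc_map_in_frob_power_iff[OF is_ideal, of "?g [^] (p ^ e - 1)" e] gc by simp
  then show ?thesis using saturation_superset[OF primeideal frob_power_ideal[OF a_subset]] by blast
qed

end

section \<open>Powers of ideals and thresholds\<close>

context cring
begin

lemma ideals_set_pow_Suc:
  "ordinary_powers R J (Suc n) = ideal_prod R (ordinary_powers R J n) J"
proof -
  interpret ids: comm_monoid "ideals_set R" by (rule ideals_set_is_comm_monoid)
  show ?thesis unfolding ordinary_powers_def by (simp add: ideals_set_def)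
qed

lemma ordinary_powers_0: "ordinary_powers R J 0 = carrier R"
  unfolding ordinary_powers_def by (simp add: ideals_set_def)

lemma ordinary_powers_ideal:
  assumes J: "ideal J R"
  shows "ideal (ordinary_powers R J n) R"
  by (induction n) (simp_all add: ordinary_powers_0 ideals_set_pow_Suc oneideal ideal_prod_is_ideal J)

lemma ideal_prod_least:
  assumes L: "ideal L R" and h: "\<And>i j. i \<in> I \<Longrightarrow> j \<in> J \<Longrightarrow> i \<otimes> j \<in> L"
  shows "ideal_prod R I J \<subseteq> L"
proof
  fix x assume "x \<in> ideal_prod R I J"
  then show "x \<in> L" by (induction rule: ideal_prod.induct) (auto simp: h ideal_add[OF L])
qed

lemma ordinary_powers_mono:
  assumes J: "ideal J R" and Q: "ideal Q R" and "J \<subseteq> Q"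
  shows "ordinary_powers R J n \<subseteq> ordinary_powers R Q n"
proof (induction n)
  case (Suc n)
  show ?case unfolding ideals_set_pow_Suc
    using Suc assms(3) ideal_prod_is_ideal[OF ordinary_powers_ideal[OF Q] Q]
    by (intro ideal_prod_least) (auto intro: ideal_prod.prod)
qed (simp add: ordinary_powers_0)

lemma ordinary_powers_mult:
  assumes J: "ideal J R" and x: "x \<in> ordinary_powers R J m" and y: "y \<in> ordinary_powers R J n"
  shows "x \<otimes> y \<in> ordinary_powers R J (m + n)"
  using y
proof (induction n arbitrary: y)
  case 0
  then show ?case using x ideal_rmult[OF ordinary_powers_ideal[OF J]] by (simp add: ordinary_powers_0)
next
  case (Suc n)
  note i = ordinary_powers_ideal[OF J]
  have xc: "x \<in> carrier R" using x ideal_carr[OF i] by blast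
  have "ideal {y \<in> carrier R. x \<otimes> y \<in> ordinary_powers R J (m + Suc n)} R"
    using xc i[of "m + Suc n"] by (intro cring_idealI) (auto simp: ideal_rules r_distr m_lcomm)
  then have "ideal_prod R (ordinary_powers R J n) J \<subseteq> {y \<in> carrier R. x \<otimes> y \<in> ordinary_powers R J (m + Suc n)}"
  proof (rule ideal_prod_least)
    fix a b assume a: "a \<in> ordinary_powers R J n" and b: "b \<in> J"
    have c: "a \<in> carrier R" "b \<in> carrier R" using a b ideal_carr[OF i] ideal_carr[OF J] by auto
    have "(x \<otimes> a) \<otimes> b \<in> ordinary_powers R J (Suc (m + n))"
      unfolding ideals_set_pow_Suc using Suc.IH[OF a] b by (rule ideal_prod.prod)
    then show "a \<otimes> b \<in> {y \<in> carrier R. x \<otimes> y \<in> ordinary_powers R J (m + Suc n)}"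
      using c xc by (simp add: m_assoc)
  qed
  then show ?case using Suc.prems unfolding ideals_set_pow_Suc by blast
qed

lemma ordinary_powers_pow:
  assumes J: "ideal J R" and x: "x \<in> ordinary_powers R J m"
  shows "x [^] k \<in> ordinary_powers R J (m * k)"
proof (induction k)
  case (Suc k)
  then show ?case using ordinary_powers_mult[OF J Suc x] by (simp add: add.commute)
qed (simp add: ordinary_powers_0)

lemma ordinary_powers_finprod:
  assumes J: "ideal J R" and f: "\<And>j. j < n \<Longrightarrow> f j \<in> J"
  shows "(\<Otimes>j\<in>{..<n}. f j) \<in> ordinary_powers R J n"
  using f
proof (induction n)
  case (Suc n)
  have c: "f \<in> {..<n} \<rightarrow> carrier R" "f n \<in> carrier R" using Suc.prems ideal_carr[OF J] by auto
  have "(\<Otimes>j\<in>{..<Suc n}. f j) = f n \<otimes> (\<Otimes>j\<in>{..<n}. f j)"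
    unfolding lessThan_Suc using c by (intro finprod_insert) auto
  also have "\<dots> = (\<Otimes>j\<in>{..<n}. f j) \<otimes> f n" using c by (intro m_comm) auto
  also have "\<dots> \<in> ordinary_powers R J (Suc n)"
    unfolding ideals_set_pow_Suc using Suc by (intro ideal_prod.prod) auto
  finally show ?case .
qed (simp add: ordinary_powers_0)

lemma Idl_mult:
  assumes S: "S \<subseteq> carrier R" and T: "T \<subseteq> carrier R" and L: "ideal L R"
    and h: "\<And>s t. s \<in> S \<Longrightarrow> t \<in> T \<Longrightarrow> s \<otimes> t \<in> L" and a: "a \<in> Idl S" and b: "b \<in> Idl T"
  shows "a \<otimes> b \<in> L"
proof -
  have 1: "a \<otimes> t \<in> L" if t: "t \<in> T" for t
  proof -
    have tc: "t \<in> carrier R" using t T by blast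
    have "ideal {a \<in> carrier R. a \<otimes> t \<in> L} R"
      using tc L by (intro cring_idealI) (auto simp: ideal_rules l_distr m_assoc)
    then have "Idl S \<subseteq> {a \<in> carrier R. a \<otimes> t \<in> L}" using S h t by (intro genideal_minimal) auto
    then show ?thesis using a by blast
  qed
  have ac: "a \<in> carrier R" using a ideal_carr[OF genideal_ideal[OF S]] by blast
  have "ideal {b \<in> carrier R. a \<otimes> b \<in> L} R"
    using ac L by (intro cring_idealI) (auto simp: ideal_rules r_distr m_lcomm)
  then have "Idl T \<subseteq> {b \<in> carrier R. a \<otimes> b \<in> L}" using T 1 by (intro genideal_minimal) auto
  then show ?thesis using b by blast
qed

definition monomials :: "'a set \<Rightarrow> nat \<Rightarrow> 'a set" where
  "monomials Z n = {foldr (\<otimes>) l \<one> | l. set l \<subseteq> Z \<and> length l = n}"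

lemma foldr_mult_closed: "set l \<subseteq> carrier R \<Longrightarrow> foldr (\<otimes>) l \<one> \<in> carrier R"
  by (induction l) auto

lemma foldr_mult_count:
  assumes "set l \<subseteq> carrier R" "z \<in> carrier R"
  shows "\<exists>y\<in>carrier R. foldr (\<otimes>) l \<one> = z [^] count_list l z \<otimes> y"
  using assms(1)
proof (induction l)
  case (Cons a l)
  then obtain y where y: "y \<in> carrier R" "foldr (\<otimes>) l \<one> = z [^] count_list l z \<otimes> y" by auto
  show ?case
  proof (cases "a = z")
    case True
    then show ?thesis using y assms(2) by (intro bexI[of _ y]) (auto simp: m_ac)
  next
    case False
    then show ?thesis using y assms(2) Cons.prems by (intro bexI[of _ "a \<otimes> y"]) (auto simp: m_ac)
  qed
qed (auto intro!: bexI[of _ \<one>])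

text \<open>Pigeonhole: if every element of \<open>Z\<close> occurred at most q - 1 times, the
  length would be at most card Z (q - 1). So some q-th power divides the product.\<close>

lemma monomials_subset_frob_power:
  assumes Q: "ideal Q R" and Z: "finite Z" "Z \<subseteq> Q" and n: "card Z * (q - 1) < n"
  shows "monomials Z n \<subseteq> frob_power R Q q"
proof
  fix x assume "x \<in> monomials Z n"
  then obtain l where l: "set l \<subseteq> Z" "length l = n" "x = foldr (\<otimes>) l \<one>" unfolding monomials_def by blast
  have Qc: "Q \<subseteq> carrier R" by (rule ideal_sub[OF Q])
  have "(\<lambda>f. f [^] q) ` Q \<subseteq> carrier R" using Qc by auto
  note Fi = genideal_ideal[OF this, folded frob_power_def] and Fs = genideal_self[OF this, folded frob_power_def]
  have "\<exists>z\<in>Z. q \<le> count_list l z"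
  proof (rule ccontr)
    assume "\<not> ?thesis"
    then have "\<forall>z\<in>Z. count_list l z \<le> q - 1" by force
    then have "(\<Sum>z\<in>Z. count_list l z) \<le> card Z * (q - 1)" using sum_bounded_above[of Z "count_list l" "q - 1"] by simp
    moreover have "(\<Sum>z\<in>Z. count_list l z) = length l" using l Z(1) by (intro sum_count_set)
    ultimately show False using l n by simp
  qed
  then obtain z where z: "z \<in> Z" "q \<le> count_list l z" by blast
  have zc: "z \<in> carrier R" and lc: "set l \<subseteq> carrier R" using z l Z Qc by auto
  obtain y where y: "y \<in> carrier R" "x = z [^] count_list l z \<otimes> y"
    using foldr_mult_count[OF lc zc] l(3) by blast
  have "count_list l z = q + (count_list l z - q)" using z(2) by simp
  then have "z [^] count_list l z = z [^] q \<otimes> z [^] (count_list l z - q)" using zc by (metis nat_pow_mult)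
  then have "x = z [^] q \<otimes> (z [^] (count_list l z - q) \<otimes> y)" using y zc by (simp add: m_assoc)
  moreover have "z [^] q \<in> frob_power R Q q" using Fs z(1) Z(2) by blast
  then have "z [^] q \<otimes> (z [^] (count_list l z - q) \<otimes> y) \<in> frob_power R Q q"
    using y(1) zc by (intro ideal_rmult[OF Fi]) auto
  ultimately show "x \<in> frob_power R Q q" by simp
qed

text \<open>Locally at \<open>Q\<close> the set \<open>Z\<close> generates \<open>Q\<close>, so
  products of n of its elements generate the n-th power. The denominators of the factors multiply to
  an element outside \<open>Q\<close>, as \<open>Q\<close> is prime.\<close>

lemma ordinary_power_subset_monomials:
  assumes Q: "primeideal Q R" and Z: "Z \<subseteq> carrier R" "Q \<subseteq> saturation Q (Idl Z)"
  shows "ordinary_powers R Q n \<subseteq> saturation Q (Idl (monomials Z n))"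
proof -
  have mc: "monomials Z n \<subseteq> carrier R" for n using foldr_mult_closed Z(1) unfolding monomials_def by blast
  note mi = genideal_ideal[OF mc] and ms = genideal_self[OF mc]
  have mult: "a \<otimes> b \<in> Idl (monomials Z (Suc n))" if "a \<in> Idl (monomials Z n)" "b \<in> Idl Z" for a b n
  proof (rule Idl_mult[OF mc Z(1) mi _ that])
    fix s t assume "s \<in> monomials Z n" and t: "t \<in> Z"
    then obtain l where l: "set l \<subseteq> Z" "length l = n" "s = foldr (\<otimes>) l \<one>" unfolding monomials_def by blast
    have lc: "set l \<subseteq> carrier R" and tc: "t \<in> carrier R" using l(1) t Z(1) by auto
    have "s \<otimes> t = foldr (\<otimes>) (t # l) \<one>" using m_comm[OF tc foldr_mult_closed[OF lc]] l(3) by simp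
    then have "s \<otimes> t \<in> monomials Z (Suc n)" using l t unfolding monomials_def
      by (intro CollectI exI[of _ "t # l"]) auto
    then show "s \<otimes> t \<in> Idl (monomials Z (Suc n))" using ms by blast
  qed
  show ?thesis
  proof (induction n)
    case 0
    have "monomials Z 0 = {\<one>}" unfolding monomials_def by auto
    then show ?case using saturation_superset[OF Q oneideal] by (simp add: ordinary_powers_0 genideal_one)
  next
    case (Suc n)
    show ?case unfolding ideals_set_pow_Suc
    proof (rule ideal_prod_least[OF saturation_ideal[OF Q mi]])
      fix a b assume "a \<in> ordinary_powers R Q n" "b \<in> Q"
      then have "a \<in> saturation Q (Idl (monomials Z n))" "b \<in> saturation Q (Idl Z)" using Suc Z(2) by auto
      then obtain s t where h: "s \<in> carrier R - Q" "s \<otimes> a \<in> Idl (monomials Z n)" "a \<in> carrier R"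
        "t \<in> carrier R - Q" "t \<otimes> b \<in> Idl Z" "b \<in> carrier R" unfolding saturation_def by blast
      have "(s \<otimes> t) \<otimes> (a \<otimes> b) = (s \<otimes> a) \<otimes> (t \<otimes> b)" using h by (simp add: m_ac)
      then have "(s \<otimes> t) \<otimes> (a \<otimes> b) \<in> Idl (monomials Z (Suc n))" using mult[OF h(2,5)] by simp
      moreover have "s \<otimes> t \<in> carrier R - Q" using h prime_in_iff[OF Q] by auto
      ultimately show "a \<otimes> b \<in> saturation Q (Idl (monomials Z (Suc n)))"
        unfolding saturation_def using h by blast
    qed
  qed
qed

lemma ordinary_power_subset_frob_power:
  assumes Q: "primeideal Q R" and Z: "finite Z" "Z \<subseteq> Q" "Q \<subseteq> saturation Q (Idl Z)" and n: "card Z * (q - 1) < n"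
  shows "ordinary_powers R Q n \<subseteq> saturation Q (frob_power R Q q)"
proof -
  have Qi: "ideal Q R" using Q primeideal.axioms(1) by blast
  have c: "(\<lambda>f. f [^] q) ` Q \<subseteq> carrier R" using ideal_carr[OF Qi] by auto
  have "Idl (monomials Z n) \<subseteq> frob_power R Q q"
    using monomials_subset_frob_power[OF Qi Z(1,2) n] genideal_ideal[OF c]
    unfolding frob_power_def by (rule genideal_minimal[rotated])
  then show ?thesis
    using ordinary_power_subset_monomials[OF Q _ Z(3), of n] saturation_mono Z(2) ideal_sub[OF Qi] by blast
qed

end

text \<open>Outside the local case elements \<open>u\<close> not in \<open>M\<close> need not be
  units, but 1 = j + a u with \<open>j\<close> in \<open>M\<close>. Raising this to the q-th power
  gives 1 = j^q + a^q u^q, so \<open>x\<close> lies in the Frobenius power as soon as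
  \<open>u \<otimes> x\<close> does.\<close>

lemma (in frobenius_ring) maximal_frob_power_saturated:
  assumes M: "maximalideal M R"
  shows "saturation M (frob_power R M (p ^ e)) \<subseteq> frob_power R M (p ^ e)"
proof
  let ?q = "p ^ e" and ?F = "frob_power R M (p ^ e)"
  have Mi: "ideal M R" using M maximalideal.axioms(1) by blast
  have Mc: "(\<lambda>f. f [^] ?q) ` M \<subseteq> carrier R" using ideal_carr[OF Mi] by auto
  note Fi = genideal_ideal[OF Mc, folded frob_power_def] and Fs = genideal_self[OF Mc, folded frob_power_def]
  fix x assume "x \<in> saturation M ?F"
  then obtain u where u: "u \<in> carrier R" "u \<notin> M" "u \<otimes> x \<in> ?F" and x: "x \<in> carrier R"
    unfolding saturation_def by blast
  have c: "insert u M \<subseteq> carrier R" using u ideal_sub[OF Mi] by blast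
  have "Idl (insert u M) = carrier R"
    using maximalideal.I_maximal[OF M genideal_ideal[OF c]] genideal_self[OF c]
      ideal_sub[OF genideal_ideal[OF c]] u(2) by blast
  then have "\<one> \<in> Idl (insert u M)" by simp
  then obtain j a where a: "j \<in> M" "a \<in> carrier R" "\<one> = j \<oplus> a \<otimes> u"
    unfolding Idl_insert_iff[OF Mi u(1)] by blast
  have jc: "j \<in> carrier R" using a ideal_carr[OF Mi] by blast
  have "?q \<ge> 1" using p_gt_1 by simp
  then obtain k where k: "?q = Suc k" by (metis One_nat_def Suc_le_D)
  have "j [^] ?q \<oplus> a [^] ?q \<otimes> u [^] ?q = (j \<oplus> a \<otimes> u) [^] ?q"
    using add_pow_q[of j "a \<otimes> u"] jc a(2) u(1) by (simp add: nat_pow_distrib)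
  also have "\<dots> = \<one>" unfolding a(3)[symmetric] by simp
  finally have "x = (j [^] ?q \<oplus> a [^] ?q \<otimes> u [^] ?q) \<otimes> x" using x by simp
  also have "\<dots> = j [^] ?q \<otimes> x \<oplus> (a [^] ?q \<otimes> u [^] k) \<otimes> (u \<otimes> x)"
  proof -
    have "(b \<oplus> c \<otimes> (d \<otimes> u)) \<otimes> x = b \<otimes> x \<oplus> (c \<otimes> d) \<otimes> (u \<otimes> x)"
      if "b \<in> carrier R" "c \<in> carrier R" "d \<in> carrier R" for b c d
      using that u(1) x by algebra
    then show ?thesis using jc a(2) u(1) by (simp add: k)
  qed
  also have "\<dots> \<in> ?F"
  proof (rule ideal_add[OF Fi ideal_rmult[OF Fi _ x] ideal_lmult[OF Fi u(3)]])
    show "j [^] ?q \<in> ?F" using Fs a(1) by blast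
  qed (use a(2) u(1) in simp)
  finally show "x \<in> ?F" .
qed

section \<open>Heights and the limit of the threshold sequence\<close>

lemma prime_height_ge:
  assumes "enat h \<le> prime_height R Q" "primeideal Q R"
  shows "\<exists>n q. h \<le> n \<and> prime_chain R n q \<and> q n = Q"
proof (rule ccontr)
  assume n: "\<not> ?thesis"
  have "prime_chain R 0 (\<lambda>_. Q)" using assms(2) unfolding prime_chain_def by simp
  then have "h \<noteq> 0" using n by (metis le0)
  then obtain k where k: "h = Suc k" using not0_implies_Suc by blast
  have "prime_height R Q \<le> enat k" unfolding prime_height_def
  proof (rule Sup_least)
    fix x assume "x \<in> {enat n |n. \<exists>q. prime_chain R n q \<and> q n = Q}"
    then obtain m q where m: "x = enat m" "prime_chain R m q" "q m = Q" by blast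
    then have "\<not> h \<le> m" using n by blast
    then show "x \<le> enat k" using m(1) k by simp
  qed
  then have "enat h \<le> enat k" using assms(1) by (rule order_trans[rotated])
  then show False using k by simp
qed

text \<open>The infimum is attained by some \<open>P\<close>. A smaller prime over \<open>J\<close>
  would also have height at least \<open>h\<close>, and a chain ending there could be prolonged by
  \<open>P\<close> beyond the height of \<open>P\<close>.\<close>

lemma (in noetherian_cring) minimal_prime_of_height:
  assumes h: "ideal_height R J = enat h"
  obtains P where "minimal_prime J P" "prime_height R P = enat h"
proof -
  let ?S = "{prime_height R P | P. primeideal P R \<and> J \<subseteq> P}"
  have ne: "?S \<noteq> {}"
  proof
    assume e: "?S = {}"
    have "ideal_height R J = \<infinity>" unfolding ideal_height_def e Inf_enat_def by simp
    then show False using h by simp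
  qed
  then have "Inf ?S \<in> ?S" unfolding Inf_enat_def using LeastI_ex[of "\<lambda>x. x \<in> ?S"] by (metis (no_types, lifting) ex_in_conv)
  then have "enat h \<in> ?S" using h unfolding ideal_height_def by simp
  then obtain P where P: "primeideal P R" "J \<subseteq> P" "prime_height R P = enat h" by auto
  have "minimal_prime J P" unfolding minimal_prime_def
  proof (intro conjI allI impI P)
    fix Q assume Q: "primeideal Q R" "J \<subseteq> Q" "Q \<subseteq> P"
    have "enat h \<le> prime_height R Q"
      using h Q unfolding ideal_height_def by (metis (mono_tags, lifting) Inf_lower mem_Collect_eq)
    then obtain n q where q: "h \<le> n" "prime_chain R n q" "q n = Q" using prime_height_ge[OF _ Q(1)] by blast
    show "Q = P"
    proof (rule ccontr)
      assume "Q \<noteq> P"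
      then have "prime_chain R (Suc n) (q(Suc n := P))"
        using q Q P unfolding prime_chain_def by (auto simp: less_Suc_eq)
      then have "enat (Suc n) \<le> prime_height R P" unfolding prime_height_def
        by (intro Sup_upper CollectI exI[of _ "Suc n"] conjI exI[of _ "q(Suc n := P)"]) auto
      then show False using P(3) q(1) by simp
    qed
  qed
  then show thesis using that P by blast
qed

lemma threshold_tendsto:
  assumes p: "1 < p" and lo: "\<And>e. enat (h * (p ^ e - 1)) \<le> nu R M A (p ^ e)"
    and up: "\<And>e. nu R M A (p ^ e) \<le> enat (h * p ^ e)"
  shows "threshold_seq R p M A \<longlonglongrightarrow> ereal (real h)"
proof -
  have "\<exists>N. nu R M A (p ^ e) = enat N" for e using up[of e] by (cases "nu R M A (p ^ e)") auto
  then obtain N where N: "\<And>e. nu R M A (p ^ e) = enat (N e)" by metis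
  have b: "h * (p ^ e - 1) \<le> N e" "N e \<le> h * p ^ e" for e using lo[of e] up[of e] unfolding N by auto
  have q: "real (p ^ e) > 0" for e using p by simp
  have eq: "threshold_seq R p M A e = ereal (real (N e) / real (p ^ e))" for e
    unfolding threshold_seq_def N using q[of e] by simp
  have "(\<lambda>e. real (N e) / real (p ^ e)) \<longlonglongrightarrow> real h"
  proof (rule tendsto_sandwich)
    show "\<forall>\<^sub>F e in sequentially. real h - real h * inverse (real p ^ e) \<le> real (N e) / real (p ^ e)"
    proof (rule always_eventually, rule allI)
      fix e
      have "real h * (real (p ^ e) - 1) = real (h * (p ^ e - 1))" using p by (simp add: of_nat_diff)
      also have "\<dots> \<le> real (N e)" using b(1) by (simp only: of_nat_le_iff)
      finally have "real h * (real (p ^ e) - 1) / real (p ^ e) \<le> real (N e) / real (p ^ e)"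
        using q[of e] by (intro divide_right_mono) auto
      moreover have "real h * (real (p ^ e) - 1) / real (p ^ e) = real h - real h * inverse (real p ^ e)"
        using q[of e] by (simp add: field_simps)
      ultimately show "real h - real h * inverse (real p ^ e) \<le> real (N e) / real (p ^ e)" by simp
    qed
    show "\<forall>\<^sub>F e in sequentially. real (N e) / real (p ^ e) \<le> real h"
    proof (rule always_eventually, rule allI)
      fix e
      have "real (N e) \<le> real (h * p ^ e)" using b(2) by (simp only: of_nat_le_iff)
      then show "real (N e) / real (p ^ e) \<le> real h" using q[of e] by (simp add: field_simps)
    qed
    have "(\<lambda>e. inverse (real p ^ e)) \<longlonglongrightarrow> 0" using p by (intro LIMSEQ_inverse_realpow_zero) simp
    then have "(\<lambda>e. real h - real h * inverse (real p ^ e)) \<longlonglongrightarrow> real h - real h * 0"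
      by (intro tendsto_intros)
    then show "(\<lambda>e. real h - real h * inverse (real p ^ e)) \<longlonglongrightarrow> real h" by simp
  qed simp
  then show ?thesis unfolding eq[abs_def] by simp
qed

lemma regular_local_cring: "regular_local_ring A \<Longrightarrow> cring A"
  unfolding regular_local_ring_def local_ring_def by blast

text \<open>The local and the graded case in one statement: the assumption \<open>sat\<close> says
  that \<open>J\<close> is contracted from its localization at \<open>M\<close>. It forces
  \<open>J\<close>, and its minimal prime \<open>Q\<close>, into \<open>M\<close> although R may
  have other maximal ideals.\<close>

lemma thresholds_eq_height:
  fixes R :: "('a, 'b) ring_scheme"
  assumes prime: "Factorial_Ring.prime p" and char: "has_char R p" and fin: "F_finite R p"
    and reg: "regular_ring R" and M: "maximalideal M R" and sat: "cring.saturation R M J \<subseteq> J"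
    and F: "F_Koenig R p H J"
  obtains h where "ideal_height R J = enat h"
    "threshold_seq R p M (ordinary_powers R J) \<longlonglongrightarrow> ereal (real h)"
    "threshold_seq R p M (symbolic_powers R J) \<longlonglongrightarrow> ereal (real h)"
proof -
  have cr: "cring R" and nr: "noetherian_ring R"
    and loc: "\<And>Q. primeideal Q R \<Longrightarrow> regular_local_ring (localization R Q)"
    using reg unfolding regular_ring_def by auto
  have "add_pow R p \<one>\<^bsub>R\<^esub> = \<zero>\<^bsub>R\<^esub>" using char unfolding has_char_def by simp
  then interpret frobenius_ring R p
    using cr prime by (intro frobenius_ring.intro frobenius_ring_axioms.intro)
  interpret noetherian_cring R using cr nr by (rule noetherian_cring.intro)
  obtain B where B: "frob_generates B" by (rule frob_generates_if_F_finite[OF fin])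
  have J: "ideal J R" and Jproper: "J \<noteq> carrier R" and "\<exists>fs. set fs \<subseteq> J \<inter> H \<and> enat (length fs) = ideal_height R J \<and>
      regular_sequence R fs \<and> F_split (R Quot (Idl\<^bsub>R\<^esub> (set fs))) p"
    using F unfolding F_Koenig_def by auto
  then obtain fs where fs: "set fs \<subseteq> J" "enat (length fs) = ideal_height R J" "regular_sequence R fs"
    "F_split (R Quot (Idl\<^bsub>R\<^esub> (set fs))) p" by auto
  define h where "h = length fs"
  have Mp: "primeideal M R" by (rule maximalideal_prime[OF M])
  have Mi: "ideal M R" using Mp primeideal.axioms(1) by blast
  note Mloc = loc[OF Mp]
  interpret m: frobenius_localization M R p
    using Mp regular_local_cring[OF Mloc] frobenius_ring_axioms
    by (intro frobenius_localization.intro cring_localization.intro)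
  obtain Q where Q: "minimal_prime J Q" "prime_height R Q = enat h"
    using minimal_prime_of_height[of J h] fs(2) unfolding h_def by metis
  have Qp: "primeideal Q R" and JQ: "J \<subseteq> Q" using Q(1) unfolding minimal_prime_def by auto
  have Qi: "ideal Q R" using Qp primeideal.axioms(1) by blast
  \<comment> \<open>The symbolic power is controlled only at associated primes, so the prime of
    height \<open>h\<close> must be one of them.\<close>
  have Qass: "Q \<in> ass_primes R J"
    using minimal_prime_associated[OF J Q(1)] Qp unfolding ass_primes_def by blast
  interpret l: cring_localization Q R
    using Qp regular_local_cring[OF loc[OF Qp]] by (rule cring_localization.intro)
  obtain Z where Z: "finite Z" "Z \<subseteq> Q" "enat (card Z) \<le> enat h" "Q \<subseteq> saturation Q (Idl\<^bsub>R\<^esub> Z)"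
    using l.regular_generators[OF loc[OF Qp]] unfolding Q(2) by blast
  have one_J: "\<one>\<^bsub>R\<^esub> \<notin> J" using ideal.one_imp_carrier[OF J] Jproper by blast
  have JM: "J \<subseteq> M"
  proof (rule ccontr)
    assume "\<not> J \<subseteq> M"
    then obtain z where z: "z \<in> J" "z \<notin> M" by blast
    then have "z \<in> carrier R" "z \<otimes>\<^bsub>R\<^esub> \<one>\<^bsub>R\<^esub> \<in> J" using ideal_carr[OF J] by auto
    then have "\<one>\<^bsub>R\<^esub> \<in> saturation M J" unfolding saturation_def using z by blast
    then show False using sat one_J by blast
  qed
  \<comment> \<open>\<open>Q\<close> is the annihilator of some \<open>y\<close> modulo
    \<open>J\<close>. An element of \<open>Q\<close> outside \<open>M\<close> would put
    \<open>y\<close> into the saturation of \<open>J\<close>, hence into \<open>J\<close>.\<close>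
  have QM: "Q \<subseteq> M"
  proof (rule ccontr)
    assume "\<not> Q \<subseteq> M"
    then obtain z where z: "z \<in> Q" "z \<notin> M" by blast
    obtain y where y: "y \<in> carrier R" "Q = {r \<in> carrier R. r \<otimes>\<^bsub>R\<^esub> y \<in> J}"
      by (rule minimal_prime_associated[OF J Q(1)])
    have "y \<in> saturation M J" unfolding saturation_def using z y by blast
    then have "y \<in> J" using sat by blast
    then have "\<one>\<^bsub>R\<^esub> \<in> Q" using y(1) by (subst y(2)) simp
    then show False using prime_one[OF Qp] by blast
  qed
  let ?F = "\<lambda>e. frob_power R M (p ^ e)"
  have upper: "symbolic_powers R J n \<subseteq> ?F e" if n: "h * p ^ e < n" for n e
  proof
    let ?P = "ordinary_powers R J n"
    have Pi: "ideal ?P R" by (rule ordinary_powers_ideal[OF J])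
    fix x assume "x \<in> symbolic_powers R J n"
    then have x: "x \<in> carrier R" "loc_map R Q x \<in> Idl\<^bsub>localization R Q\<^esub> (loc_map R Q ` ?P)"
      using Qass unfolding symbolic_powers_def by auto
    have "x \<in> saturation Q ?P"
      using l.loc_map_in_Idl_iff[OF ideal_sub[OF Pi] x(1)] x(2) unfolding Idl_ideal[OF Pi] by blast
    then obtain s where s: "s \<in> carrier R" "s \<notin> Q" "s \<otimes>\<^bsub>R\<^esub> x \<in> ?P" unfolding saturation_def by blast
    \<comment> \<open>Counting would give h (q - 1); the coarser h q has the same limit after
      division by q.\<close>
    have "card Z * (p ^ e - 1) \<le> h * p ^ e" using Z(3) by (intro mult_le_mono) auto
    then have "ordinary_powers R Q n \<subseteq> saturation Q (frob_power R Q (p ^ e))"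
      using n by (intro ordinary_power_subset_frob_power[OF Qp Z(1,2,4)]) simp
    then have "s \<otimes>\<^bsub>R\<^esub> x \<in> saturation Q (frob_power R Q (p ^ e))"
      using s(3) ordinary_powers_mono[OF J Qi JQ, of n] by blast
    then obtain t where t: "t \<in> carrier R" "t \<notin> Q" "t \<otimes>\<^bsub>R\<^esub> (s \<otimes>\<^bsub>R\<^esub> x) \<in> frob_power R Q (p ^ e)"
      unfolding saturation_def by blast
    then have ts: "(t \<otimes>\<^bsub>R\<^esub> s) \<otimes>\<^bsub>R\<^esub> x \<in> frob_power R Q (p ^ e)" using s x by (simp add: m_assoc)
    have tsc: "t \<otimes>\<^bsub>R\<^esub> s \<in> carrier R" "t \<otimes>\<^bsub>R\<^esub> s \<notin> Q" using s t prime_in_iff[OF Qp] by auto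
    have "x \<in> saturation M (frob_power R Q (p ^ e))"
      by (rule m.prime_frob_power_localization[OF Mloc B Qp QM tsc x(1) ts])
    then have "x \<in> saturation M (?F e)"
      using saturation_mono[OF frob_power_mono[OF QM ideal_sub[OF Mi]]] by blast
    then show "x \<in> ?F e" using maximal_frob_power_saturated[OF M] by blast
  qed
  have sub: "ordinary_powers R J n \<subseteq> symbolic_powers R J n" for n
  proof
    let ?P = "ordinary_powers R J n"
    have Pi: "ideal ?P R" by (rule ordinary_powers_ideal[OF J])
    fix x assume x: "x \<in> ?P"
    have "loc_map R P x \<in> Idl\<^bsub>localization R P\<^esub> (loc_map R P ` ?P)" if "P \<in> ass_primes R J" for P
    proof -
      have Pp: "primeideal P R" using that unfolding ass_primes_def by blast
      interpret k: cring_localization P R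
        using Pp regular_local_cring[OF loc[OF Pp]] by (rule cring_localization.intro)
      show ?thesis
        using k.loc.genideal_self[of "loc_map R P ` ?P"] x ideal_carr[OF Pi] by auto
    qed
    then show "x \<in> symbolic_powers R J n"
      unfolding symbolic_powers_def using x ideal_carr[OF Pi] by blast
  qed
  let ?g = "\<Otimes>\<^bsub>R\<^esub>j\<in>{..<length fs}. fs ! j"
  have lower: "\<not> ordinary_powers R J (h * (p ^ e - 1)) \<subseteq> ?F e" for e
  proof -
    have "?g \<in> ordinary_powers R J h" unfolding h_def using fs(1) by (intro ordinary_powers_finprod[OF J]) auto
    then have "?g [^]\<^bsub>R\<^esub> (p ^ e - 1) \<in> ordinary_powers R J (h * (p ^ e - 1))"
      by (rule ordinary_powers_pow[OF J])
    moreover have "?g [^]\<^bsub>R\<^esub> (p ^ e - 1) \<notin> ?F e"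
      using fs JM by (intro m.fedder_localization[OF Mloc B]) auto
    ultimately show ?thesis by blast
  qed
  \<comment> \<open>Any family between the ordinary and the symbolic powers inherits the lower bound
    from the former and the upper bound from the latter; the two extreme families are inserted at
    the end.\<close>
  have conv: "threshold_seq R p M A \<longlonglongrightarrow> ereal (real h)"
    if A: "\<And>n. ordinary_powers R J n \<subseteq> A n" "\<And>n. A n \<subseteq> symbolic_powers R J n" for A
  proof (rule threshold_tendsto[OF p_gt_1])
    fix e
    show "enat (h * (p ^ e - 1)) \<le> nu R M A (p ^ e)"
      unfolding nu_def using lower[of e] A(1) by (intro Sup_upper) blast
    show "nu R M A (p ^ e) \<le> enat (h * p ^ e)"
      unfolding nu_def
    proof (rule Sup_least)
      fix x assume "x \<in> {enat r |r. \<not> A r \<subseteq> ?F e}"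
      then obtain r where r: "x = enat r" "\<not> A r \<subseteq> ?F e" by blast
      then have "\<not> h * p ^ e < r" using upper[of e r] A(2)[of r] by blast
      then show "x \<le> enat (h * p ^ e)" using r(1) by simp
    qed
  qed
  show thesis
  proof (rule that)
    show "ideal_height R J = enat h" using fs(2) unfolding h_def by simp
  qed (use conv[of "ordinary_powers R J"] conv[of "symbolic_powers R J"] sub in auto)
qed

section \<open>Graded polynomial rings\<close>

locale graded_polynomial_ring = cring +
  fixes K xs w
  assumes graded: "graded_poly_ring R K xs w"
begin

abbreviation polys where "polys \<equiv> formal_polys R K (length xs)"
abbreviation ev where "ev \<equiv> eval_poly R xs"
abbreviation \<mm> where "\<mm> \<equiv> Idl (set xs)"

definition mon :: "nat multiset \<Rightarrow> 'a" where
  "mon \<mu> = (\<Otimes>i\<in>{..<length xs}. (xs ! i) [^] count \<mu> i)"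

definition weight :: "nat multiset \<Rightarrow> nat" where
  "weight \<mu> = (\<Sum>i\<in>#\<mu>. w ! i)"

definition trunc :: "nat \<Rightarrow> (nat multiset \<Rightarrow> 'a) \<Rightarrow> nat multiset \<Rightarrow> 'a" where
  "trunc d c = (\<lambda>\<mu>. if weight \<mu> < d then c \<mu> else \<zero>)"

text \<open>\<open>\<tau> d y\<close> is the sum of the homogeneous components of \<open>y\<close> of degree less than \<open>d\<close>.\<close>

definition \<tau> :: "nat \<Rightarrow> 'a \<Rightarrow> 'a" where
  "\<tau> d y = ev (trunc d (the_inv_into polys ev y))"

lemma subfield: "subfield K R" and xs_carrier: "set xs \<subseteq> carrier R"
  and bij: "bij_betw ev polys (carrier R)"
  using graded unfolding graded_poly_ring_def by auto

lemma w_pos: "i < length xs \<Longrightarrow> w ! i > 0"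
  using graded unfolding graded_poly_ring_def by auto

lemma K_carrier: "K \<subseteq> carrier R"
  using subfieldE(3)[OF subfield] .

lemma x_carrier [simp]: "i < length xs \<Longrightarrow> xs ! i \<in> carrier R"
  using xs_carrier by auto

lemma K_zero: "\<zero> \<in> K" and K_one: "\<one> \<in> K"
  using subfieldE(1)[OF subfield] subringE(2,3) by auto

lemma K_mult: "a \<in> K \<Longrightarrow> b \<in> K \<Longrightarrow> a \<otimes> b \<in> K"
  by (rule subringE(6)[OF subfieldE(1)[OF subfield]])

lemma K_unit:
  assumes "k \<in> K" "k \<noteq> \<zero>"
  obtains k' where "k' \<in> K" "k' \<otimes> k = \<one>"
  using subfield_m_inv[OF subfield, of k] assms K_carrier m_comm by (metis DiffI singletonD subsetD that DiffD1)

lemma polysI: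
  "k \<in> K \<Longrightarrow> indexed_const k \<in> polys"
  "c \<in> polys \<Longrightarrow> d \<in> polys \<Longrightarrow> indexed_padd c d \<in> polys"
  "c \<in> polys \<Longrightarrow> i < length xs \<Longrightarrow> indexed_pmult c i \<in> polys"
  unfolding formal_polys_def by (auto intro: indexed_pset.intros)

lemma polys_induct [consumes 1, case_names const add mult]:
  assumes "c \<in> polys" "\<And>k. k \<in> K \<Longrightarrow> P (indexed_const k)"
    "\<And>c d. c \<in> polys \<Longrightarrow> d \<in> polys \<Longrightarrow> P c \<Longrightarrow> P d \<Longrightarrow> P (indexed_padd c d)"
    "\<And>c i. c \<in> polys \<Longrightarrow> i < length xs \<Longrightarrow> P c \<Longrightarrow> P (indexed_pmult c i)"
  shows "P c"
  using assms(1) unfolding formal_polys_def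
proof (induction rule: indexed_pset.induct)
  case (indexed_const k) then show ?case by (rule assms(2))
next
  case (indexed_padd c d) then show ?case using assms(3) unfolding formal_polys_def by blast
next
  case (indexed_pmult c i) then show ?case using assms(4)[of c i] unfolding formal_polys_def by simp
qed

lemma polys_support:
  assumes "c \<in> polys"
  shows "finite {\<mu>. c \<mu> \<noteq> \<zero>}" "c \<mu> \<in> carrier R" "c \<mu> \<noteq> \<zero> \<Longrightarrow> set_mset \<mu> \<subseteq> {..<length xs}"
proof -
  have "finite {\<mu>. c \<mu> \<noteq> \<zero>} \<and> (\<forall>\<mu>. c \<mu> \<in> carrier R) \<and> (\<forall>\<mu>. c \<mu> \<noteq> \<zero> \<longrightarrow> set_mset \<mu> \<subseteq> {..<length xs})"
    using assms
  proof (induction rule: polys_induct)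
    case (const k)
    have "finite {\<mu>. indexed_const k \<mu> \<noteq> \<zero>}"
      by (rule finite_subset[of _ "{{#}}"]) (auto simp: indexed_const_def)
    then show ?case using const K_carrier by (auto simp: indexed_const_def)
  next
    case (add c d)
    have "finite {\<mu>. indexed_padd c d \<mu> \<noteq> \<zero>}"
      by (rule finite_subset[of _ "{\<mu>. c \<mu> \<noteq> \<zero>} \<union> {\<mu>. d \<mu> \<noteq> \<zero>}"]) (use add in \<open>auto simp: indexed_padd_def\<close>)
    moreover have "set_mset \<mu> \<subseteq> {..<length xs}" if "indexed_padd c d \<mu> \<noteq> \<zero>" for \<mu>
    proof -
      have "c \<mu> \<noteq> \<zero> \<or> d \<mu> \<noteq> \<zero>" using that by (auto simp: indexed_padd_def)
      then show ?thesis using add by blast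
    qed
    ultimately show ?case using add by (auto simp: indexed_padd_def)
  next
    case (mult c i)
    have "finite {\<mu>. indexed_pmult c i \<mu> \<noteq> \<zero>}"
      by (rule finite_subset[of _ "add_mset i ` {\<mu>. c \<mu> \<noteq> \<zero>}"])
        (use mult in \<open>auto simp: indexed_pmult_def image_iff split: if_splits intro!: exI[of _ "_ - {#i#}"]\<close>)
    moreover have "set_mset \<mu> \<subseteq> {..<length xs}" if "indexed_pmult c i \<mu> \<noteq> \<zero>" for \<mu>
    proof -
      have h: "i \<in># \<mu>" "c (\<mu> - {#i#}) \<noteq> \<zero>" using that by (auto simp: indexed_pmult_def split: if_splits)
      then have "set_mset (\<mu> - {#i#}) \<subseteq> {..<length xs}" using mult by blast
      then have "set_mset (add_mset i (\<mu> - {#i#})) \<subseteq> {..<length xs}" using mult by simp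
      then show ?thesis using h by simp
    qed
    ultimately show ?case using mult by (auto simp: indexed_pmult_def)
  qed
  then show "finite {\<mu>. c \<mu> \<noteq> \<zero>}" "c \<mu> \<in> carrier R" "c \<mu> \<noteq> \<zero> \<Longrightarrow> set_mset \<mu> \<subseteq> {..<length xs}" by blast+
qed

lemma mon_carrier [simp]: "mon \<mu> \<in> carrier R"
  unfolding mon_def by (intro finprod_closed) auto

lemma mon_empty: "mon {#} = \<one>"
proof -
  have "mon {#} = (\<Otimes>i\<in>{..<length xs}. \<one>)" unfolding mon_def by (intro finprod_cong') auto
  then show ?thesis by (simp add: finprod_one)
qed

lemma mon_add:
  assumes i: "i < length xs"
  shows "mon (add_mset i \<mu>) = mon \<mu> \<otimes> xs ! i"
proof -
  have "mon (add_mset i \<mu>) = (\<Otimes>j\<in>{..<length xs}. (xs ! j) [^] count \<mu> j \<otimes> (if i = j then xs ! j else \<one>))"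
    unfolding mon_def by (intro finprod_cong') auto
  also have "\<dots> = mon \<mu> \<otimes> (\<Otimes>j\<in>{..<length xs}. if i = j then xs ! j else \<one>)"
    unfolding mon_def by (intro finprod_multf) auto
  also have "(\<Otimes>j\<in>{..<length xs}. if i = j then xs ! j else \<one>) = xs ! i"
    using i by (intro finprod_singleton) auto
  finally show ?thesis .
qed

lemma ev_superset:
  assumes c: "c \<in> polys" and S: "finite S" "{\<mu>. c \<mu> \<noteq> \<zero>} \<subseteq> S"
  shows "ev c = (\<Oplus>\<mu>\<in>S. c \<mu> \<otimes> mon \<mu>)"
  unfolding eval_poly_def mon_def[symmetric]
  using S polys_support(2)[OF c] by (intro add.finprod_mono_neutral_cong_left) auto

lemma ev_const:
  assumes "k \<in> K"
  shows "ev (indexed_const k) = k"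
proof -
  have "ev (indexed_const k) = (\<Oplus>\<mu>\<in>{{#}}. indexed_const k \<mu> \<otimes> mon \<mu>)"
    using polysI(1)[OF assms] by (intro ev_superset) (auto simp: indexed_const_def)
  then show ?thesis using assms K_carrier by (auto simp: indexed_const_def mon_empty)
qed

lemma ev_add:
  assumes c: "c \<in> polys" and d: "d \<in> polys"
  shows "ev (indexed_padd c d) = ev c \<oplus> ev d"
proof -
  let ?S = "{\<mu>. c \<mu> \<noteq> \<zero>} \<union> {\<mu>. d \<mu> \<noteq> \<zero>}"
  have f: "finite ?S" using polys_support(1) c d by simp
  have "ev (indexed_padd c d) = (\<Oplus>\<mu>\<in>?S. indexed_padd c d \<mu> \<otimes> mon \<mu>)"
    using f by (intro ev_superset polysI c d) (auto simp: indexed_padd_def)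
  also have "\<dots> = (\<Oplus>\<mu>\<in>?S. c \<mu> \<otimes> mon \<mu> \<oplus> d \<mu> \<otimes> mon \<mu>)"
    using polys_support(2) c d by (intro finsum_cong') (auto simp: indexed_padd_def l_distr)
  also have "\<dots> = (\<Oplus>\<mu>\<in>?S. c \<mu> \<otimes> mon \<mu>) \<oplus> (\<Oplus>\<mu>\<in>?S. d \<mu> \<otimes> mon \<mu>)"
    using polys_support(2) c d by (intro finsum_addf) auto
  also have "\<dots> = ev c \<oplus> ev d" using f c d by (simp add: ev_superset[of _ ?S])
  finally show ?thesis .
qed

lemma ev_mult:
  assumes c: "c \<in> polys" and i: "i < length xs"
  shows "ev (indexed_pmult c i) = ev c \<otimes> xs ! i"
proof -
  let ?S = "{\<mu>. c \<mu> \<noteq> \<zero>}"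
  have f: "finite ?S" using polys_support(1) c by simp
  have cc: "c \<mu> \<in> carrier R" for \<mu> using polys_support(2)[OF c] .
  have p: "indexed_pmult c i (add_mset i \<mu>) = c \<mu>" for \<mu> unfolding indexed_pmult_def by simp
  have "ev (indexed_pmult c i) = (\<Oplus>\<mu>\<in>add_mset i ` ?S. indexed_pmult c i \<mu> \<otimes> mon \<mu>)"
    using f by (intro ev_superset polysI c i)
      (auto simp: indexed_pmult_def image_iff split: if_splits intro!: exI[of _ "_ - {#i#}"])
  also have "\<dots> = (\<Oplus>\<mu>\<in>?S. indexed_pmult c i (add_mset i \<mu>) \<otimes> mon (add_mset i \<mu>))"
    using cc p by (intro finsum_reindex) (auto simp: inj_on_def)
  also have "\<dots> = (\<Oplus>\<mu>\<in>?S. (c \<mu> \<otimes> mon \<mu>) \<otimes> xs ! i)"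
    using cc i by (intro finsum_cong') (auto simp: p mon_add m_assoc)
  also have "\<dots> = (\<Oplus>\<mu>\<in>?S. c \<mu> \<otimes> mon \<mu>) \<otimes> xs ! i"
    using cc i f by (intro finsum_ldistr[symmetric]) auto
  also have "\<dots> = ev c \<otimes> xs ! i" using f c by (simp add: ev_superset[of _ ?S])
  finally show ?thesis .
qed

lemma polys_scale:
  assumes "c \<in> polys" and k: "k \<in> K"
  shows "(\<lambda>\<mu>. k \<otimes> c \<mu>) \<in> polys"
  using assms(1)
proof (induction rule: polys_induct)
  case (const l)
  have "(\<lambda>\<mu>. k \<otimes> indexed_const l \<mu>) = indexed_const (k \<otimes> l)"
    using k K_carrier by (auto simp: indexed_const_def fun_eq_iff)
  then show ?case using polysI(1)[OF K_mult[OF k const]] by metis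
next
  case (add c d)
  have "k \<otimes> indexed_padd c d \<mu> = indexed_padd (\<lambda>\<mu>. k \<otimes> c \<mu>) (\<lambda>\<mu>. k \<otimes> d \<mu>) \<mu>" for \<mu>
    using polys_support(2)[OF add(1)] polys_support(2)[OF add(2)] k K_carrier
    by (simp add: indexed_padd_def r_distr subset_iff)
  then have "(\<lambda>\<mu>. k \<otimes> indexed_padd c d \<mu>) = indexed_padd (\<lambda>\<mu>. k \<otimes> c \<mu>) (\<lambda>\<mu>. k \<otimes> d \<mu>)" by blast
  then show ?case using polysI(2)[OF add(3,4)] by metis
next
  case (mult c i)
  have "(\<lambda>\<mu>. k \<otimes> indexed_pmult c i \<mu>) = indexed_pmult (\<lambda>\<mu>. k \<otimes> c \<mu>) i"
    using k K_carrier by (auto simp: indexed_pmult_def fun_eq_iff)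
  then show ?case using polysI(3)[OF mult(3,2)] by metis
qed

lemma ev_scale:
  assumes c: "c \<in> polys" and k: "k \<in> K"
  shows "ev (\<lambda>\<mu>. k \<otimes> c \<mu>) = k \<otimes> ev c"
proof -
  let ?S = "{\<mu>. c \<mu> \<noteq> \<zero>}"
  have f: "finite ?S" using polys_support(1) c by simp
  have cc: "c \<mu> \<in> carrier R" and kc: "k \<in> carrier R" for \<mu> using polys_support(2)[OF c] k K_carrier by auto
  have "ev (\<lambda>\<mu>. k \<otimes> c \<mu>) = (\<Oplus>\<mu>\<in>?S. (k \<otimes> c \<mu>) \<otimes> mon \<mu>)"
    using f kc by (intro ev_superset polys_scale c k) auto
  also have "\<dots> = (\<Oplus>\<mu>\<in>?S. k \<otimes> (c \<mu> \<otimes> mon \<mu>))"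
    using cc kc by (intro finsum_cong') (auto simp: m_assoc)
  also have "\<dots> = k \<otimes> (\<Oplus>\<mu>\<in>?S. c \<mu> \<otimes> mon \<mu>)" using cc kc f by (intro finsum_rdistr[symmetric]) auto
  also have "\<dots> = k \<otimes> ev c" using f c by (simp add: ev_superset[of _ ?S])
  finally show ?thesis .
qed

lemma ev_carrier [simp]: "c \<in> polys \<Longrightarrow> ev c \<in> carrier R"
  using bij bij_betwE by blast

lemma carrier_ev:
  assumes "y \<in> carrier R"
  obtains c where "c \<in> polys" "y = ev c"
  using assms bij unfolding bij_betw_def by blast

text \<open>Induction over the ring elements themselves treats products one variable at a time,
  without a formula for the coefficients of a product.\<close>

lemma carrier_induct [consumes 1, case_names const add mult]:
  assumes "r \<in> carrier R" "\<And>k. k \<in> K \<Longrightarrow> P k"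
    "\<And>a b. a \<in> carrier R \<Longrightarrow> b \<in> carrier R \<Longrightarrow> P a \<Longrightarrow> P b \<Longrightarrow> P (a \<oplus> b)"
    "\<And>a i. a \<in> carrier R \<Longrightarrow> i < length xs \<Longrightarrow> P a \<Longrightarrow> P (a \<otimes> xs ! i)"
  shows "P r"
proof -
  obtain c where c: "c \<in> polys" "r = ev c" using assms(1) by (rule carrier_ev)
  have "P (ev c)" using c(1)
    by (induction rule: polys_induct) (simp_all add: ev_const ev_add ev_mult assms(2-4))
  then show ?thesis using c by simp
qed

section \<open>Truncation by degree and the order of a polynomial\<close>

lemma weight_empty: "weight {#} = 0"
  unfolding weight_def by simp

lemma trunc_const: "trunc d (indexed_const k) = indexed_const (if 0 < d then k else \<zero>)"
  unfolding trunc_def indexed_const_def by (auto simp: weight_empty fun_eq_iff)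

lemma trunc_add: "trunc d (indexed_padd c c') = indexed_padd (trunc d c) (trunc d c')"
  unfolding trunc_def indexed_padd_def by (auto simp: fun_eq_iff)

text \<open>The subtraction is the truncated one: if \<open>d\<close> does not exceed the weight of
  the variable, it gives 0, and truncation at 0 removes everything, as it should.\<close>

lemma trunc_mult: "trunc d (indexed_pmult c i) = indexed_pmult (trunc (d - w ! i) c) i"
proof
  fix \<mu>
  show "trunc d (indexed_pmult c i) \<mu> = indexed_pmult (trunc (d - w ! i) c) i \<mu>"
  proof (cases "i \<in># \<mu>")
    case True
    then obtain \<nu> where "\<mu> = add_mset i \<nu>" by (metis insert_DiffM)
    then show ?thesis by (auto simp: trunc_def indexed_pmult_def weight_def)
  qed (simp add: trunc_def indexed_pmult_def)
qed

lemma trunc_polys: "c \<in> polys \<Longrightarrow> trunc d c \<in> polys"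
proof (induction arbitrary: d rule: polys_induct)
  case (const k) then show ?case using polysI(1) K_zero by (simp add: trunc_const)
qed (simp_all add: trunc_add trunc_mult polysI)

lemma \<tau>_ev: "c \<in> polys \<Longrightarrow> \<tau> d (ev c) = ev (trunc d c)"
  unfolding \<tau>_def using the_inv_into_f_f[OF bij_betw_imp_inj_on[OF bij]] by simp

lemma \<tau>_closed [simp]: "y \<in> carrier R \<Longrightarrow> \<tau> d y \<in> carrier R"
  by (elim carrier_ev) (simp add: \<tau>_ev trunc_polys)

lemma \<tau>_add: "y \<in> carrier R \<Longrightarrow> z \<in> carrier R \<Longrightarrow> \<tau> d (y \<oplus> z) = \<tau> d y \<oplus> \<tau> d z"
  by (elim carrier_ev) (simp add: \<tau>_ev trunc_polys trunc_add ev_add[symmetric] polysI)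

lemma \<tau>_mult: "y \<in> carrier R \<Longrightarrow> i < length xs \<Longrightarrow> \<tau> d (y \<otimes> xs ! i) = \<tau> (d - w ! i) y \<otimes> xs ! i"
  by (elim carrier_ev) (simp add: \<tau>_ev trunc_polys trunc_mult ev_mult[symmetric] polysI)

lemma \<tau>_const: "k \<in> K \<Longrightarrow> \<tau> d k = (if 0 < d then k else \<zero>)"
  using \<tau>_ev[OF polysI(1), of k d] by (simp add: ev_const trunc_const K_zero)

lemma \<tau>_scale:
  assumes "y \<in> carrier R" "k \<in> K"
  shows "\<tau> d (k \<otimes> y) = k \<otimes> \<tau> d y"
proof -
  obtain c where c: "c \<in> polys" "y = ev c" using assms(1) by (rule carrier_ev)
  have "trunc d (\<lambda>\<mu>. k \<otimes> c \<mu>) = (\<lambda>\<mu>. k \<otimes> trunc d c \<mu>)"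
    using assms(2) K_carrier by (auto simp: trunc_def fun_eq_iff)
  then show ?thesis
    unfolding c(2) ev_scale[OF c(1) assms(2), symmetric] \<tau>_ev[OF polys_scale[OF c(1) assms(2)]] \<tau>_ev[OF c(1)]
    using ev_scale[OF trunc_polys[OF c(1)] assms(2)] by simp
qed

lemma \<tau>_zero: "\<tau> 0 y = \<zero>"
proof -
  have "trunc 0 c = indexed_const \<zero>" for c unfolding trunc_def indexed_const_def by auto
  then show ?thesis unfolding \<tau>_def using ev_const[OF K_zero] by simp
qed

lemma \<tau>_\<tau>: "y \<in> carrier R \<Longrightarrow> d \<le> d' \<Longrightarrow> \<tau> d (\<tau> d' y) = \<tau> d y"
proof (elim carrier_ev)
  fix c assume "d \<le> d'" and c: "c \<in> polys" "y = ev c"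
  then have "trunc d (trunc d' c) = trunc d c" by (auto simp: trunc_def fun_eq_iff)
  then show ?thesis using c by (simp add: \<tau>_ev trunc_polys)
qed

lemma \<tau>_eventually:
  assumes "y \<in> carrier R"
  obtains d where "\<tau> d y = y"
proof -
  obtain c where c: "c \<in> polys" "y = ev c" using assms by (rule carrier_ev)
  let ?d = "Suc (Max (insert 0 (weight ` {\<mu>. c \<mu> \<noteq> \<zero>})))"
  have "trunc ?d c = c"
  proof
    fix \<mu>
    have "weight \<mu> < ?d" if "c \<mu> \<noteq> \<zero>"
      using that polys_support(1)[OF c(1)] by (intro le_imp_less_Suc Max_ge) auto
    then show "trunc ?d c \<mu> = c \<mu>" unfolding trunc_def by (cases "c \<mu> = \<zero>") auto
  qed
  then have "\<tau> ?d y = y" using c by (simp add: \<tau>_ev)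
  then show thesis by (rule that)
qed

lemma \<tau>_diff_zero:
  assumes y: "y \<in> carrier R"
  shows "\<tau> d (y \<ominus> \<tau> d y) = \<zero>"
proof -
  have "\<tau> d y = \<tau> d ((y \<ominus> \<tau> d y) \<oplus> \<tau> d y)"
  proof -
    have "(y \<ominus> t) \<oplus> t = y" if "t \<in> carrier R" for t using y that by algebra
    then show ?thesis using y by simp
  qed
  also have "\<dots> = \<tau> d (y \<ominus> \<tau> d y) \<oplus> \<tau> d y" using y by (subst \<tau>_add) (auto simp: \<tau>_\<tau>)
  finally show ?thesis using y by simp
qed

text \<open>\<open>\<tau> d y = \<zero>\<close> means that \<open>y\<close> has order at least
  \<open>d\<close>; multiplication never lowers the order, since no variable has negative
  degree.\<close>

lemma \<tau>_mult_zero: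
  assumes "r \<in> carrier R" "y \<in> carrier R" "\<tau> d y = \<zero>"
  shows "\<tau> d (r \<otimes> y) = \<zero>"
  using assms
proof (induction arbitrary: d y rule: carrier_induct)
  case (const k)
  then show ?case using \<tau>_scale K_carrier by auto
next
  case (add a b)
  then show ?case by (simp add: l_distr \<tau>_add)
next
  case (mult a i)
  have "(a \<otimes> xs ! i) \<otimes> y = (a \<otimes> y) \<otimes> xs ! i" using mult by (simp add: m_ac)
  then have e: "\<tau> d ((a \<otimes> xs ! i) \<otimes> y) = \<tau> (d - w ! i) (a \<otimes> y) \<otimes> xs ! i" using mult by (simp add: \<tau>_mult)
  have "\<tau> (d - w ! i) y = \<tau> (d - w ! i) (\<tau> d y)" using mult(4) by (intro \<tau>_\<tau>[symmetric]) auto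
  also have "\<dots> = \<zero>" unfolding mult(5) using \<tau>_const[OF K_zero] by simp
  finally have "\<tau> (d - w ! i) (a \<otimes> y) = \<zero>" using mult by simp
  then show ?case using e mult by simp
qed

lemma \<mm>_ideal: "ideal \<mm> R"
  by (rule genideal_ideal[OF xs_carrier])

text \<open>Here positivity of the grading enters: every variable has degree at least 1, so
  multiplication by any element of \<open>\<mm>\<close> raises the order.\<close>

lemma \<mm>_raises_order:
  assumes "z \<in> \<mm>" "y \<in> carrier R" "\<tau> d y = \<zero>"
  shows "\<tau> (Suc d) (z \<otimes> y) = \<zero>"
proof -
  let ?S = "{z \<in> carrier R. \<forall>y\<in>carrier R. \<forall>d. \<tau> d y = \<zero> \<longrightarrow> \<tau> (Suc d) (z \<otimes> y) = \<zero>}"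
  have "ideal ?S R"
  proof (rule cring_idealI)
    show "\<zero> \<in> ?S" using \<tau>_const[OF K_zero] by auto
    fix a b assume "a \<in> ?S" "b \<in> ?S"
    then show "a \<oplus> b \<in> ?S" by (auto simp: l_distr \<tau>_add)
  next
    fix a r assume a: "a \<in> ?S" and r: "r \<in> carrier R"
    have "\<tau> (Suc d) ((r \<otimes> a) \<otimes> y) = \<zero>" if y: "y \<in> carrier R" "\<tau> d y = \<zero>" for y d
    proof -
      have "(r \<otimes> a) \<otimes> y = a \<otimes> (r \<otimes> y)" using a r y by (auto simp: m_ac)
      then show ?thesis using a \<tau>_mult_zero[OF r y] r y by auto
    qed
    then show "r \<otimes> a \<in> ?S" using a r by auto
  qed auto
  moreover have "set xs \<subseteq> ?S"
  proof
    fix x assume "x \<in> set xs"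
    then obtain i where i: "i < length xs" "x = xs ! i" by (auto simp: in_set_conv_nth)
    have "\<tau> (Suc d) (x \<otimes> y) = \<zero>" if y: "y \<in> carrier R" "\<tau> d y = \<zero>" for y d
    proof -
      have "\<tau> (Suc d) (x \<otimes> y) = \<tau> (Suc d - w ! i) y \<otimes> xs ! i"
        using i y m_comm[of x y] by (simp add: \<tau>_mult)
      moreover have "\<tau> (Suc d - w ! i) y = \<tau> (Suc d - w ! i) (\<tau> d y)"
        using y w_pos[OF i(1)] by (intro \<tau>_\<tau>[symmetric]) auto
      ultimately show ?thesis using y i \<tau>_const[OF K_zero] by simp
    qed
    then show "x \<in> ?S" using i by auto
  qed
  ultimately have "\<mm> \<subseteq> ?S" by (rule genideal_minimal)
  then show ?thesis using assms by blast
qed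

lemma one_notin_\<mm>: "\<one> \<notin> \<mm>"
proof
  assume "\<one> \<in> \<mm>"
  \<comment> \<open>Every element has order at least 0, so 1 as an element of \<open>\<mm>\<close>
    times 1 would have order at least 1, although it is a nonzero constant.\<close>
  then have "\<tau> (Suc 0) (\<one> \<otimes> \<one>) = \<zero>" by (rule \<mm>_raises_order) (auto simp: \<tau>_zero)
  then have "\<one> = \<zero>" using \<tau>_const[OF K_one] by simp
  then show False using subfieldE(6)[OF subfield] by simp
qed

lemma constant_term:
  assumes "r \<in> carrier R"
  obtains k z where "k \<in> K" "z \<in> \<mm>" "r = k \<oplus> z"
proof -
  have "\<exists>k\<in>K. \<exists>z\<in>\<mm>. r = k \<oplus> z"
    using assms
  proof (induction rule: carrier_induct)
    case (const k)
    then show ?case using K_carrier ideal_0[OF \<mm>_ideal] by (intro bexI[of _ k] bexI[of _ \<zero>]) auto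
  next
    case (add a b)
    then obtain k z l y where h: "k \<in> K" "z \<in> \<mm>" "a = k \<oplus> z" "l \<in> K" "y \<in> \<mm>" "b = l \<oplus> y" by blast
    have c: "k \<in> carrier R" "l \<in> carrier R" "z \<in> carrier R" "y \<in> carrier R"
      using h K_carrier ideal_carr[OF \<mm>_ideal] by auto
    have "a \<oplus> b = (k \<oplus> l) \<oplus> (z \<oplus> y)" unfolding h(3,6) using c by algebra
    moreover have "k \<oplus> l \<in> K" using subringE(7)[OF subfieldE(1)[OF subfield]] h by blast
    ultimately show ?case using ideal_add[OF \<mm>_ideal h(2,5)] by blast
  next
    case (mult a i)
    have "xs ! i \<in> \<mm>" using mult genideal_self[OF xs_carrier] by auto
    then have "a \<otimes> xs ! i \<in> \<mm>" using mult ideal_lmult[OF \<mm>_ideal] by blast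
    then show ?case using K_zero mult by (intro bexI[of _ \<zero>] bexI[of _ "a \<otimes> xs ! i"]) auto
  qed
  then show thesis using that by blast
qed

lemma \<mm>_maximal: "maximalideal \<mm> R"
proof (rule maximalidealI[OF \<mm>_ideal])
  show "carrier R \<noteq> \<mm>" using one_notin_\<mm> by auto
  fix J assume J: "ideal J R" "\<mm> \<subseteq> J" "J \<subseteq> carrier R"
  show "J = \<mm> \<or> J = carrier R"
  proof (rule disjCI)
    assume n: "J \<noteq> carrier R"
    have "J \<subseteq> \<mm>"
    proof
      fix r assume r: "r \<in> J"
      then obtain k z where h: "k \<in> K" "z \<in> \<mm>" "r = k \<oplus> z" using J(3) by (blast elim: constant_term)
      have c: "k \<in> carrier R" using h K_carrier by blast
      have kJ: "k \<in> J" using r h J c by (intro ideal_add_cancel[OF J(1), of k z]) auto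
      have "k = \<zero>"
      proof (rule ccontr)
        assume "k \<noteq> \<zero>"
        then obtain k' where "k' \<in> K" "k' \<otimes> k = \<one>" using h by (blast elim: K_unit)
        then have "\<one> \<in> J" using ideal_lmult[OF J(1) kJ, of k'] K_carrier by auto
        then show False using ideal.one_imp_carrier[OF J(1)] n by blast
      qed
      then show "r \<in> \<mm>" using h ideal_carr[OF \<mm>_ideal] by simp
    qed
    then show "J = \<mm>" using J by blast
  qed
qed

lemma \<tau>_homogeneous:
  assumes "s \<in> homogeneous_elements R K xs w"
  shows "\<tau> d s = s \<or> \<tau> d s = \<zero>" "s \<in> carrier R"
proof -
  obtain c e where c: "s = ev c" "c \<in> polys" "\<And>\<mu>. c \<mu> \<noteq> \<zero> \<Longrightarrow> weight \<mu> = e"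
    using assms unfolding homogeneous_elements_def weight_def by blast
  have "trunc d c \<mu> = (if e < d then c else indexed_const \<zero>) \<mu>" for \<mu>
    using c(3)[of \<mu>] by (cases "c \<mu> = \<zero>") (auto simp: trunc_def indexed_const_def)
  then have "trunc d c = (if e < d then c else indexed_const \<zero>)" by blast
  then show "\<tau> d s = s \<or> \<tau> d s = \<zero>" using c \<tau>_ev ev_const[OF K_zero] by auto
  show "s \<in> carrier R" using c by simp
qed

lemma \<tau>_homogeneous_ideal:
  assumes J: "homogeneous_ideal R K xs w J" and y: "y \<in> J"
  shows "\<tau> d y \<in> J"
proof -
  obtain S where S: "S \<subseteq> homogeneous_elements R K xs w" "J = Idl S"
    using J unfolding homogeneous_ideal_def by blast
  have Sc: "S \<subseteq> carrier R" using S(1) \<tau>_homogeneous(2) by blast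
  have Ji: "ideal J R" unfolding S(2) by (rule genideal_ideal[OF Sc])
  let ?T = "{y \<in> carrier R. \<forall>d. \<tau> d y \<in> J}"
  have "ideal ?T R"
  proof (rule cring_idealI)
    show "\<zero> \<in> ?T" using \<tau>_const[OF K_zero] ideal_0[OF Ji] by auto
    fix a b assume "a \<in> ?T" "b \<in> ?T"
    then show "a \<oplus> b \<in> ?T" by (auto simp: \<tau>_add ideal_add[OF Ji])
  next
    fix a r assume a: "a \<in> ?T" and r: "r \<in> carrier R"
    \<comment> \<open>The degree bound is quantified inside the induction because multiplication by
      a variable shifts it.\<close>
    have "\<forall>a d. a \<in> ?T \<longrightarrow> \<tau> d (r \<otimes> a) \<in> J" using r
    proof (induction rule: carrier_induct)
      case (const k)
      then show ?case using ideal_lmult[OF Ji] K_carrier by (auto simp: \<tau>_scale)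
    next
      case (add b c)
      then show ?case by (auto simp: l_distr \<tau>_add ideal_add[OF Ji])
    next
      case (mult b i)
      have "\<tau> d ((b \<otimes> xs ! i) \<otimes> a) \<in> J" if a: "a \<in> ?T" for a d
      proof -
        have "(b \<otimes> xs ! i) \<otimes> a = (b \<otimes> a) \<otimes> xs ! i" using mult a by (auto simp: m_ac)
        then have "\<tau> d ((b \<otimes> xs ! i) \<otimes> a) = \<tau> (d - w ! i) (b \<otimes> a) \<otimes> xs ! i" using mult a by (auto simp: \<tau>_mult)
        moreover have "\<tau> (d - w ! i) (b \<otimes> a) \<in> J" using mult a by blast
        ultimately show ?thesis using mult ideal_rmult[OF Ji] by simp
      qed
      then show ?case by blast
    qed
    then show "r \<otimes> a \<in> ?T" using a r by auto
  qed auto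
  moreover have "S \<subseteq> ?T"
  proof
    fix s assume s: "s \<in> S"
    have "s \<in> J" using s genideal_self[OF Sc] S(2) by blast
    then have "\<tau> d s \<in> J" for d using \<tau>_homogeneous(1)[of s d] s S(1) ideal_0[OF Ji] by (metis subsetD)
    then show "s \<in> ?T" using s Sc by blast
  qed
  ultimately have "J \<subseteq> ?T" unfolding S(2) by (rule genideal_minimal)
  then show ?thesis using y by blast
qed

text \<open>An element outside \<open>\<mm>\<close> is \<open>1 + z\<close> with \<open>z \<in> \<mm>\<close> up to a scalar, and \<open>z\<close> raises degrees.
  Hence if \<open>(1 + z) x \<in> J\<close>, the homogeneous components of \<open>x\<close> lie in \<open>J\<close> one after the other.\<close>

lemma saturation_homogeneous:
  assumes J: "homogeneous_ideal R K xs w J"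
  shows "saturation \<mm> J \<subseteq> J"
proof
  have "\<exists>S\<subseteq>carrier R. J = Idl S"
    using J \<tau>_homogeneous(2) unfolding homogeneous_ideal_def by blast
  then have Ji: "ideal J R" using genideal_ideal by blast
  fix x assume "x \<in> saturation \<mm> J"
  then obtain s where s: "s \<in> carrier R" "s \<notin> \<mm>" "s \<otimes> x \<in> J" and x: "x \<in> carrier R"
    unfolding saturation_def by blast
  obtain k y where k: "k \<in> K" "y \<in> \<mm>" "s = k \<oplus> y" using s(1) by (rule constant_term)
  have yc: "y \<in> carrier R" and kc: "k \<in> carrier R" using k K_carrier ideal_carr[OF \<mm>_ideal] by auto
  have "k \<noteq> \<zero>" using s k yc by auto
  then obtain k' where k': "k' \<in> K" "k' \<otimes> k = \<one>" using k by (blast elim: K_unit)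
  have k'c: "k' \<in> carrier R" using k' K_carrier by blast
  define z where "z = k' \<otimes> y"
  have z: "z \<in> \<mm>" unfolding z_def using k(2) k'c by (rule ideal_lmult[OF \<mm>_ideal])
  have zc: "z \<in> carrier R" using z ideal_carr[OF \<mm>_ideal] by blast
  have "k' \<otimes> (s \<otimes> x) = (k' \<otimes> k) \<otimes> x \<oplus> z \<otimes> x"
    unfolding k(3) z_def using k'c kc yc x by algebra
  then have "k' \<otimes> (s \<otimes> x) = x \<oplus> z \<otimes> x" using k' x by simp
  then have u: "x \<oplus> z \<otimes> x \<in> J" using ideal_lmult[OF Ji s(3) k'c] by simp
  have "\<tau> d x \<in> J" for d
  proof (induction d)
    case 0
    then show ?case using ideal_0[OF Ji] by (simp add: \<tau>_zero)
  next
    case (Suc d)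
    let ?t = "\<tau> d x"
    have tc: "?t \<in> carrier R" using x by simp
    have split: "z \<otimes> x = z \<otimes> t \<oplus> z \<otimes> (x \<ominus> t)" if "t \<in> carrier R" for t
      using that zc x by algebra
    \<comment> \<open>The remainder of \<open>x\<close> has order at least \<open>d\<close>, and
      \<open>z\<close> raises it by one. So up to degree \<open>d\<close> the product with
      \<open>z\<close> sees only \<open>?t\<close>, which is in \<open>J\<close> by
      induction.\<close>
    have "\<tau> (Suc d) (z \<otimes> (x \<ominus> ?t)) = \<zero>"
      using \<tau>_diff_zero[OF x] x by (intro \<mm>_raises_order[OF z]) auto
    then have "\<tau> (Suc d) (z \<otimes> x) = \<tau> (Suc d) (z \<otimes> ?t)"
      using split[OF tc] \<tau>_add[of "z \<otimes> ?t" "z \<otimes> (x \<ominus> ?t)" "Suc d"] zc x by simp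
    moreover have "\<tau> (Suc d) (z \<otimes> ?t) \<in> J"
      by (rule \<tau>_homogeneous_ideal[OF J ideal_lmult[OF Ji Suc zc]])
    moreover have "\<tau> (Suc d) (x \<oplus> z \<otimes> x) \<in> J" by (rule \<tau>_homogeneous_ideal[OF J u])
    ultimately have 1: "\<tau> (Suc d) x \<oplus> \<tau> (Suc d) (z \<otimes> x) \<in> J" and 2: "\<tau> (Suc d) (z \<otimes> x) \<in> J"
      using \<tau>_add[of x "z \<otimes> x" "Suc d"] zc x by auto
    show ?case using x by (intro ideal_add_cancel[OF Ji 1 2]) simp
  qed
  moreover obtain d where "\<tau> d x = x" using x by (rule \<tau>_eventually)
  ultimately show "x \<in> J" by metis
qed

end

theorem theorem5p7:
  fixes R :: "('a, 'b) ring_scheme" and \<mm> \<aa> K :: "'a set" and xs :: "'a list"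
    and w :: "nat list" and p :: nat
  assumes "Factorial_Ring.prime p" and "has_char R p"
    and "F_finite R p" and "regular_ring R"
    and "(local_ring R \<mm> \<and> F_Koenig R p (carrier R) \<aa>) \<or>
         (graded_poly_ring R K xs w \<and> \<mm> = Idl\<^bsub>R\<^esub> (set xs) \<and> homogeneous_ideal R K xs w \<aa> \<and>
          F_Koenig R p (homogeneous_elements R K xs w) \<aa>)"
  shows "convergent (threshold_seq R p \<mm> (ordinary_powers R \<aa>)) \<and>
         convergent (threshold_seq R p \<mm> (symbolic_powers R \<aa>)) \<and>
         F_threshold R p \<mm> (ordinary_powers R \<aa>) = F_threshold R p \<mm> (symbolic_powers R \<aa>) \<and>
         F_threshold R p \<mm> (symbolic_powers R \<aa>) = ereal_of_enat (ideal_height R \<aa>)"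
proof -
  have cr: "cring R" and nr: "noetherian_ring R" using assms(4) unfolding regular_ring_def by auto
  interpret noetherian_cring R using cr nr by (rule noetherian_cring.intro)
  \<comment> \<open>Both settings are reduced to the same three facts. In the local case saturation
    at \<open>\<mm>\<close> changes no ideal; in the graded case it changes no homogeneous
    ideal.\<close>
  obtain H where "maximalideal \<mm> R" "saturation \<mm> \<aa> \<subseteq> \<aa>" "F_Koenig R p H \<aa>"
    using assms(5)
  proof (elim disjE conjE)
    assume "local_ring R \<mm>" and F: "F_Koenig R p (carrier R) \<aa>"
    then interpret noetherian_local R \<mm> by unfold_locales
    have "ideal \<aa> R" using F unfolding F_Koenig_def by blast
    then show thesis using that[OF maximal _ F] saturation_max by simp
  next
    assume g: "graded_poly_ring R K xs w" and m: "\<mm> = Idl\<^bsub>R\<^esub> (set xs)" and h: "homogeneous_ideal R K xs w \<aa>"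
      and F: "F_Koenig R p (homogeneous_elements R K xs w) \<aa>"
    interpret graded_polynomial_ring R K xs w using g by unfold_locales
    show thesis using that[OF _ _ F] \<mm>_maximal saturation_homogeneous[OF h] unfolding m by simp
  qed
  from thresholds_eq_height[OF assms(1-4) this]
  obtain h where h: "ideal_height R \<aa> = enat h"
    "threshold_seq R p \<mm> (ordinary_powers R \<aa>) \<longlonglongrightarrow> ereal (real h)"
    "threshold_seq R p \<mm> (symbolic_powers R \<aa>) \<longlonglongrightarrow> ereal (real h)" .
  then show ?thesis
    unfolding F_threshold_def using convergentI limI by (metis ereal_of_enat_simps(1))
qed

end
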